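(* Let $\Omega\subset\mathbb{C}^n$ be open, let $T$ be a positive plurisubharmonic current of bi-dimension $(p,p)$, $p\geq 1$, on $\Omega$, and let $g\in Psh^{-}(\Omega)\cap\mathcal{C}^{1}(\Omega\setminus L_{g})$ with $L_{g}$ compact. Then for every $0<\varepsilon<1$ the current $|g|^{1-\varepsilon}T$ is well defined, i.e. for every sequence $(g_j)$ of smooth plurisubharmonic functions on $\Omega$ decreasing to $g$ and converging to $g$ in $\mathcal{C}^1(\Omega\setminus L_g)$, the currents $|g_j|^{1-\varepsilon}T$ converge weakly$^*$ to a current denoted $|g|^{1-\varepsilon}T$. Moreover, if $L_{g}=P_{g}$ and $p\geq 2$, then $gT$ is well defined, i.e. for every such sequence $(g_j)$ the currents $g_jT$ converge weakly$^*$ to a current denoted $gT$.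
   Context: $Psh^{-}(\Omega)$ is the set of negative plurisubharmonic functions on $\Omega$. For $g\in Psh^{-}(\Omega)$, $L_g$ is the set of points $z\in\Omega$ such that $g$ is unbounded in every neighborhood of $z$, and $P_g=\{g=-\infty\}$ is the pole set of $g$. A current $T$ is plurisubharmonic if $dd^{c}T\geq 0$. *)

theory Defs
  imports "HOL-Analysis.Analysis"
begin

definition dirderiv :: "('a::real_normed_vector \<Rightarrow> 'b::real_normed_vector) \<Rightarrow> 'a \<Rightarrow> 'a \<Rightarrow> 'b" where
  "dirderiv f v x = vector_derivative (\<lambda>t::real. f (x + t *\<^sub>R v)) (at 0)"

fun Ck :: "nat \<Rightarrow> 'a::euclidean_space set \<Rightarrow> ('a \<Rightarrow> 'b::real_normed_vector) \<Rightarrow> bool" where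
  "Ck 0 U f = continuous_on U f"
| "Ck (Suc k) U f = (continuous_on U f \<and> (\<forall>x\<in>U. f differentiable (at x)) \<and>
                       (\<forall>v\<in>Basis. Ck k U (dirderiv f v)))"

definition smooth_on :: "'a::euclidean_space set \<Rightarrow> ('a \<Rightarrow> 'b::real_normed_vector) \<Rightarrow> bool" where
  "smooth_on U f \<longleftrightarrow> (\<forall>k. Ck k U f)"

definition dz :: "'n::finite \<Rightarrow> (complex^'n \<Rightarrow> complex) \<Rightarrow> complex^'n \<Rightarrow> complex" where
  "dz k f z = (dirderiv f (axis k 1) z - \<i> * dirderiv f (axis k \<i>) z) / 2"

definition dzbar :: "'n::finite \<Rightarrow> (complex^'n \<Rightarrow> complex) \<Rightarrow> complex^'n \<Rightarrow> complex" where
  "dzbar k f z = (dirderiv f (axis k 1) z + \<i> * dirderiv f (axis k \<i>) z) / 2"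

definition Cc :: "(complex^'n::finite) set \<Rightarrow> (complex^'n \<Rightarrow> complex) set" where
  "Cc \<Omega> = {\<phi>. continuous_on UNIV \<phi> \<and> compact (closure {z. \<phi> z \<noteq> 0})
                 \<and> closure {z. \<phi> z \<noteq> 0} \<subseteq> \<Omega>}"

definition Dtest :: "(complex^'n::finite) set \<Rightarrow> (complex^'n \<Rightarrow> complex) set" where
  "Dtest \<Omega> = {\<phi>. \<phi> \<in> Cc \<Omega> \<and> smooth_on UNIV \<phi>}"

definition nonneg_fun :: "('a \<Rightarrow> complex) \<Rightarrow> bool" where
  "nonneg_fun \<phi> \<longleftrightarrow> (\<forall>z. Im (\<phi> z) = 0 \<and> 0 \<le> Re (\<phi> z))"

text \<open>Encoding.  A constant (1,0)-form \<alpha> = \<Sum>k a_k dz_k is represented by its coefficient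
  vector a :: complex^'n.  A current \<T> of bidimension (p,p) (bidegree (n-p,n-p)) is encoded by
    T \<phi> [\<alpha>1,...,\<alpha>p] [\<beta>1,...,\<beta>p] = \<T>( \<phi> * c_p * (\<alpha>1\<and>...\<and>\<alpha>p) \<and> conj(\<beta>1\<and>...\<and>\<beta>p) ),
  c_p = i^(p^2) (-1)^(p(p-1)/2), so that on the diagonal
    T \<phi> \<alpha>s \<alpha>s = \<T>( \<phi> * i\<alpha>1\<and>conj \<alpha>1 \<and> ... \<and> i\<alpha>p\<and>conj \<alpha>p ).
  Since the forms \<phi>*(\<alpha>-wedge)\<and>conj(\<beta>-wedge) span all test (p,p)-forms, \<T> corresponds exactly
  to a T that is complex-linear in \<phi>, multilinear and alternating in the \<alpha>s and
  conjugate-multilinear and alternating in the \<beta>s.  Positive currents have order 0, so they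
  act (uniquely) on continuous compactly supported forms; we take that as the domain.\<close>

definition multilin_alt :: "nat \<Rightarrow> ((complex^'n::finite) list \<Rightarrow> complex) \<Rightarrow> bool" where
  "multilin_alt p F \<longleftrightarrow>
     (\<forall>xs i (c::complex) u v. length xs = p \<and> i < p \<longrightarrow>
        F (xs[i := c *s u + v]) = c * F (xs[i := u]) + F (xs[i := v])) \<and>
     (\<forall>xs i j. length xs = p \<and> i < p \<and> j < p \<and> i \<noteq> j \<and> xs ! i = xs ! j \<longrightarrow> F xs = 0)"

definition conj_multilin_alt :: "nat \<Rightarrow> ((complex^'n::finite) list \<Rightarrow> complex) \<Rightarrow> bool" where
  "conj_multilin_alt p F \<longleftrightarrow>
     (\<forall>xs i (c::complex) u v. length xs = p \<and> i < p \<longrightarrow>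
        F (xs[i := c *s u + v]) = cnj c * F (xs[i := u]) + F (xs[i := v])) \<and>
     (\<forall>xs i j. length xs = p \<and> i < p \<and> j < p \<and> i \<noteq> j \<and> xs ! i = xs ! j \<longrightarrow> F xs = 0)"

definition order0_current ::
  "(complex^'n::finite) set \<Rightarrow> nat \<Rightarrow>
   ((complex^'n \<Rightarrow> complex) \<Rightarrow> (complex^'n) list \<Rightarrow> (complex^'n) list \<Rightarrow> complex) \<Rightarrow> bool" where
  "order0_current \<Omega> p T \<longleftrightarrow>
     (\<forall>\<phi>1\<in>Cc \<Omega>. \<forall>\<phi>2\<in>Cc \<Omega>. \<forall>c as bs. length as = p \<and> length bs = p \<longrightarrow>
        T (\<lambda>z. c * \<phi>1 z + \<phi>2 z) as bs = c * T \<phi>1 as bs + T \<phi>2 as bs) \<and>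
     (\<forall>\<phi>\<in>Cc \<Omega>. \<forall>bs. length bs = p \<longrightarrow> multilin_alt p (\<lambda>as. T \<phi> as bs)) \<and>
     (\<forall>\<phi>\<in>Cc \<Omega>. \<forall>as. length as = p \<longrightarrow> conj_multilin_alt p (\<lambda>bs. T \<phi> as bs))"

definition positive_current ::
  "(complex^'n::finite) set \<Rightarrow> nat \<Rightarrow>
   ((complex^'n \<Rightarrow> complex) \<Rightarrow> (complex^'n) list \<Rightarrow> (complex^'n) list \<Rightarrow> complex) \<Rightarrow> bool" where
  "positive_current \<Omega> p T \<longleftrightarrow> order0_current \<Omega> p T \<and>
     (\<forall>\<phi>\<in>Cc \<Omega>. \<forall>as. nonneg_fun \<phi> \<and> length as = p \<longrightarrow>
        Im (T \<phi> as as) = 0 \<and> 0 \<le> Re (T \<phi> as as))"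

text \<open>dd^c T \<ge> 0 (up to the positive constant in d^c):  for test \<phi> \<ge> 0 and constant
  (1,0)-forms \<gamma>1..\<gamma>(p-1),  T( i\<partial>\<partial>bar \<phi> \<and> i\<gamma>1\<and>conj \<gamma>1 \<and> ... ) \<ge> 0, where
  i dz_k\<and>dzbar_l \<and> \<Pi> i\<gamma>\<and>conj \<gamma> = c_p (dz_k\<and>\<gamma>s)\<and>conj(dz_l\<and>\<gamma>s).\<close>
definition psh_current ::
  "(complex^'n::finite) set \<Rightarrow> nat \<Rightarrow>
   ((complex^'n \<Rightarrow> complex) \<Rightarrow> (complex^'n) list \<Rightarrow> (complex^'n) list \<Rightarrow> complex) \<Rightarrow> bool" where
  "psh_current \<Omega> p T \<longleftrightarrow>
     (\<forall>\<phi>\<in>Dtest \<Omega>. \<forall>gs. nonneg_fun \<phi> \<and> length gs = p - 1 \<longrightarrow>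
        (let s = (\<Sum>k\<in>UNIV. \<Sum>l\<in>UNIV. T (dz k (dzbar l \<phi>)) (axis k 1 # gs) (axis l 1 # gs))
         in Im s = 0 \<and> 0 \<le> Re s))"

definition weak_star_tendsto ::
  "(complex^'n::finite) set \<Rightarrow> nat \<Rightarrow>
   (nat \<Rightarrow> (complex^'n \<Rightarrow> complex) \<Rightarrow> (complex^'n) list \<Rightarrow> (complex^'n) list \<Rightarrow> complex) \<Rightarrow>
   ((complex^'n \<Rightarrow> complex) \<Rightarrow> (complex^'n) list \<Rightarrow> (complex^'n) list \<Rightarrow> complex) \<Rightarrow> bool" where
  "weak_star_tendsto \<Omega> p Ts S \<longleftrightarrow>
     (\<forall>\<phi>\<in>Dtest \<Omega>. \<forall>as bs. length as = p \<and> length bs = p \<longrightarrow>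
        (\<lambda>j. Ts j \<phi> as bs) \<longlonglongrightarrow> S \<phi> as bs)"

definition mult_current ::
  "(complex^'n::finite \<Rightarrow> real) \<Rightarrow>
   ((complex^'n \<Rightarrow> complex) \<Rightarrow> (complex^'n) list \<Rightarrow> (complex^'n) list \<Rightarrow> complex) \<Rightarrow>
   ((complex^'n \<Rightarrow> complex) \<Rightarrow> (complex^'n) list \<Rightarrow> (complex^'n) list \<Rightarrow> complex)" where
  "mult_current f T = (\<lambda>\<phi> as bs. T (\<lambda>z. complex_of_real (f z) * \<phi> z) as bs)"

definition usc_on :: "'a::topological_space set \<Rightarrow> ('a \<Rightarrow> ereal) \<Rightarrow> bool" where
  "usc_on U u \<longleftrightarrow> (\<forall>z\<in>U. \<forall>c. u z < c \<longrightarrow> eventually (\<lambda>w. u w < c) (at z within U))"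

definition circle_mean :: "(complex^'n::finite \<Rightarrow> ereal) \<Rightarrow> complex^'n \<Rightarrow> complex^'n \<Rightarrow> ereal" where
  "circle_mean u a b =
     (enn2ereal (\<integral>\<^sup>+ \<theta>. e2ennreal (max 0 (u (a + cis \<theta> *s b))) * indicator {0..2*pi} \<theta> \<partial>lborel)
      - enn2ereal (\<integral>\<^sup>+ \<theta>. e2ennreal (max 0 (- u (a + cis \<theta> *s b))) * indicator {0..2*pi} \<theta> \<partial>lborel))
     / ereal (2 * pi)"

definition psh :: "(complex^'n::finite) set \<Rightarrow> (complex^'n \<Rightarrow> ereal) \<Rightarrow> bool" where
  "psh \<Omega> u \<longleftrightarrow> (\<forall>z\<in>\<Omega>. u z \<noteq> \<infinity>) \<and> usc_on \<Omega> u \<and>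
     (\<forall>a b. (\<forall>\<zeta>::complex. norm \<zeta> \<le> 1 \<longrightarrow> a + \<zeta> *s b \<in> \<Omega>) \<longrightarrow> u a \<le> circle_mean u a b)"

definition psh_neg :: "(complex^'n::finite) set \<Rightarrow> (complex^'n \<Rightarrow> ereal) set" where
  "psh_neg \<Omega> = {u. psh \<Omega> u \<and> (\<forall>z\<in>\<Omega>. u z \<le> 0)}"

definition unbounded_locus :: "(complex^'n::finite) set \<Rightarrow> (complex^'n \<Rightarrow> ereal) \<Rightarrow> (complex^'n) set" where
  "unbounded_locus \<Omega> g = {z\<in>\<Omega>. \<forall>U. open U \<and> z \<in> U \<longrightarrow>
      \<not> (\<exists>M::real. \<forall>w\<in>U \<inter> \<Omega>. \<bar>g w\<bar> \<le> ereal M)}"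

definition pole_set :: "(complex^'n::finite) set \<Rightarrow> (complex^'n \<Rightarrow> ereal) \<Rightarrow> (complex^'n) set" where
  "pole_set \<Omega> g = {z\<in>\<Omega>. g z = -\<infinity>}"

definition admissible_seq :: "(complex^'n::finite) set \<Rightarrow> (complex^'n \<Rightarrow> ereal) \<Rightarrow> (nat \<Rightarrow> complex^'n \<Rightarrow> real) \<Rightarrow> bool" where
  "admissible_seq \<Omega> g G \<longleftrightarrow>
     (\<forall>j. smooth_on \<Omega> (G j) \<and> psh \<Omega> (\<lambda>z. ereal (G j z))) \<and>
     (\<forall>j. \<forall>z\<in>\<Omega>. G (Suc j) z \<le> G j z) \<and>
     (\<forall>z\<in>\<Omega>. (\<lambda>j. ereal (G j z)) \<longlonglongrightarrow> g z) \<and>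
     (\<forall>K. compact K \<and> K \<subseteq> \<Omega> - unbounded_locus \<Omega> g \<longrightarrow>
        uniform_limit K G (\<lambda>z. real_of_ereal (g z)) sequentially \<and>
        (\<forall>v\<in>Basis. uniform_limit K (\<lambda>j. dirderiv (G j) v)
                      (dirderiv (\<lambda>z. real_of_ereal (g z)) v) sequentially))"

end

theory Submission
  imports Defs
begin

text \<open>Near the compact unbounded locus put \<open>s = c - g\<^sub>j \<ge> 1\<close>, \<open>r = R - |z|\<^sup>2 \<ge> 1\<close> and
  \<open>F = s\<^sup>q r\<^sup>1\<^sup>-\<^sup>q\<close>. Since \<open>F\<close> is concave and increasing in \<open>(s, r)\<close>, \<open>- F\<close> is plurisubharmonic, and even
  \<open>\<omega> = dd\<^sup>c (- F) \<ge> (1 - q) s\<^sup>q r\<^sup>-\<^sup>q dd\<^sup>c |z|\<^sup>2\<close>. Let \<open>\<kappa>\<close> be a cutoff function equal to 1 near the locus.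
  Testing \<open>dd\<^sup>c T \<ge> 0\<close> on \<open>\<kappa> F\<close> bounds the mass of \<open>\<kappa> T \<and> \<omega>\<close>, hence that of \<open>s\<^sup>q T\<close>, by terms
  that live where \<open>d\<kappa> \<noteq> 0\<close>, and there \<open>g\<^sub>j\<close> is bounded in \<open>C\<^sup>1\<close>. If \<open>p \<ge> 2\<close>, testing \<open>dd\<^sup>c T \<ge> 0\<close> on the positive form
  \<open>\<kappa> F \<omega>\<close> bounds \<open>\<kappa> T \<and> \<omega> \<and> \<omega>\<close>, which for \<open>q = 1/2\<close> dominates \<open>s T\<close>.
  With these uniform bounds convergence is monotone, and the limit does not depend on the sequence by Dini's
  argument, which compares two sequences decreasing to the same function.\<close>

section \<open>Differential calculus of iterated directional derivatives\<close>

text \<open>The factor r^(1-q) supplies the strict positivity: - s^q alone has the Hessian q s^(q-1)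
  dd^c g_j plus a multiple of the square of dg_j, and this bounds no multiple of dd^c |z|^2 from
  below. The gained coefficient (1-q) s^q r^(-q) degenerates at q = 1, which is why s T is reached
  only through the square of the case q = 1/2, at the price of a second pair of arguments. The
  current need not be closed, so the inequality dd^c T \<ge> 0 replaces integration by parts; its
  test forms must be nonnegative, which dictates the factor F \<ge> 0 and the sign of \<omega>.
  Positivity of \<open>T\<close> is given on constant (1,0)-forms and their conjugates, whereas
  \<omega> varies with the point; this forces a passage from constant to variable positive matrices.
  Members of the sequence may be positive somewhere, so positive and negative parts, each monotone
  in j, are treated apart. Positivity controls equal argument lists only; general ones come by
  polarization.\<close>

lemma dirderiv_eq:
  assumes "(f has_derivative f') (at x)"
  shows "dirderiv f v x = f' v"
proof -
  have l: "linear f'" using assms has_derivative_linear by blast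
  have "((\<lambda>t::real. x + t *\<^sub>R v) has_derivative (\<lambda>t. t *\<^sub>R v)) (at 0)"
    by (auto intro!: derivative_eq_intros)
  moreover have "(f has_derivative f') (at (x + 0 *\<^sub>R v))" using assms by simp
  ultimately have "((\<lambda>t::real. f (x + t *\<^sub>R v)) has_derivative (\<lambda>t. f' (t *\<^sub>R v))) (at 0)"
    using has_derivative_compose by blast
  then have "((\<lambda>t::real. f (x + t *\<^sub>R v)) has_vector_derivative f' v) (at 0)"
    unfolding has_vector_derivative_def by (simp add: linear_scale[OF l])
  then show ?thesis unfolding dirderiv_def by (rule vector_derivative_at)
qed

lemma has_vector_derivative_dirderiv:
  assumes "f differentiable (at (x + t *\<^sub>R v))"
  shows "((\<lambda>t::real. f (x + t *\<^sub>R v)) has_vector_derivative dirderiv f v (x + t *\<^sub>R v)) (at t)"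
proof -
  obtain f' where f': "(f has_derivative f') (at (x + t *\<^sub>R v))"
    using assms unfolding differentiable_def by auto
  have l: "linear f'" using f' has_derivative_linear by blast
  have "((\<lambda>t::real. x + t *\<^sub>R v) has_derivative (\<lambda>t. t *\<^sub>R v)) (at t)"
    by (auto intro!: derivative_eq_intros)
  then have "((\<lambda>t::real. f (x + t *\<^sub>R v)) has_derivative (\<lambda>t. f' (t *\<^sub>R v))) (at t)"
    using f' has_derivative_compose by blast
  then show ?thesis
    unfolding has_vector_derivative_def dirderiv_eq[OF f'] by (simp add: linear_scale[OF l])
qed

lemma dirderiv_cong:
  assumes "open U" "x \<in> U" "\<And>y. y \<in> U \<Longrightarrow> f y = g y"
  shows "dirderiv f v x = dirderiv g v x"
proof -
  have "((\<lambda>t::real. x + t *\<^sub>R v) \<longlongrightarrow> x + 0 *\<^sub>R v) (nhds 0)"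
    by (intro tendsto_intros filterlim_ident)
  then have "eventually (\<lambda>t::real. x + t *\<^sub>R v \<in> U) (nhds 0)"
    using assms(1,2) by (simp add: topological_tendstoD)
  then have "eventually (\<lambda>t::real. f (x + t *\<^sub>R v) = g (x + t *\<^sub>R v)) (nhds 0)"
    by eventually_elim (use assms in auto)
  then show ?thesis unfolding dirderiv_def
    by (intro vector_derivative_cong_eq) (auto elim: eventually_mono)
qed

lemma Ck_continuous: "Ck k U f \<Longrightarrow> continuous_on U f"
  by (cases k) auto

lemma Ck_has_derivative:
  assumes "Ck (Suc k) U f" "x \<in> U"
  obtains f' where "(f has_derivative f') (at x)"
proof -
  have "f differentiable (at x)" using assms by simp
  then show thesis using that unfolding differentiable_def by blast
qed

lemma Ck_decr: "Ck (Suc k) U f \<Longrightarrow> Ck k U f"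
  by (induction k arbitrary: f) (auto simp: Ck_continuous)

lemma Ck_subset: "Ck k U f \<Longrightarrow> V \<subseteq> U \<Longrightarrow> Ck k V f"
  by (induction k arbitrary: f) (auto intro: continuous_on_subset)

lemma Ck_cong:
  assumes "open U" "\<And>x. x \<in> U \<Longrightarrow> f x = g x" "Ck k U f"
  shows "Ck k U g"
  using assms(2,3)
proof (induction k arbitrary: f g)
  case 0
  then show ?case using continuous_on_cong[OF refl, of U f g] by simp
next
  case (Suc k)
  have "g differentiable (at x)" if xU: "x \<in> U" for x
  proof -
    obtain f' where "(f has_derivative f') (at x)"
      using Ck_has_derivative[OF Suc.prems(2) xU] .
    then have "(g has_derivative f') (at x)"
      using has_derivative_transform_within_open[OF _ assms(1) xU] Suc.prems(1) by blast
    then show ?thesis unfolding differentiable_def by blast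
  qed
  moreover have "continuous_on U g"
    using Ck_continuous[OF Suc.prems(2)] Suc.prems(1) continuous_on_cong[OF refl, of U f g] by simp
  moreover have "Ck k U (dirderiv g v)" if "v \<in> Basis" for v
  proof (rule Suc.IH)
    show "dirderiv f v x = dirderiv g v x" if "x \<in> U" for x
      by (rule dirderiv_cong[OF assms(1) that Suc.prems(1)])
    show "Ck k U (dirderiv f v)" using Suc.prems(2) that by simp
  qed
  ultimately show ?case by simp
qed

lemma Ck_local:
  assumes "\<And>x. x \<in> U \<Longrightarrow> \<exists>V. open V \<and> x \<in> V \<and> Ck k V f"
  shows "Ck k U f"
  using assms
proof (induction k arbitrary: f)
  case 0
  have "isCont f x" if x: "x \<in> U" for x
  proof -
    obtain V where "open V" "x \<in> V" "Ck 0 V f" using 0[OF x] by blast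
    then show ?thesis by (simp add: continuous_on_eq_continuous_at)
  qed
  then show ?case by (simp add: continuous_at_imp_continuous_on)
next
  case (Suc k)
  have "f differentiable (at x)" if "x \<in> U" for x using Suc.prems[OF that] by auto
  moreover then have "continuous_on U f"
    by (simp add: continuous_at_imp_continuous_on differentiable_imp_continuous_within)
  moreover have "Ck k U (dirderiv f v)" if v: "v \<in> Basis" for v
  proof (rule Suc.IH)
    fix x assume "x \<in> U"
    then obtain V where "open V" "x \<in> V" "Ck (Suc k) V f" using Suc.prems by blast
    then show "\<exists>V. open V \<and> x \<in> V \<and> Ck k V (dirderiv f v)" using v by auto
  qed
  ultimately show ?case by simp
qed

lemma Ck_const: "Ck k U (\<lambda>x. c)"
proof (induction k arbitrary: c)
  case (Suc k)
  have "dirderiv (\<lambda>x. c) v = (\<lambda>x. 0)" for v :: 'a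
    using dirderiv_eq[OF has_derivative_const] by blast
  with Suc show ?case by simp
qed auto

lemma Ck_bounded_linear:
  assumes h: "bounded_linear h" and U: "open U" and f: "Ck k U f"
  shows "Ck k U (\<lambda>x. h (f x))"
  using f
proof (induction k arbitrary: f)
  case 0
  then show ?case by (simp add: bounded_linear.continuous_on[OF h])
next
  case (Suc k)
  have D: "((\<lambda>x. h (f x)) has_derivative (\<lambda>v. h (f' v))) (at x)"
    if "(f has_derivative f') (at x)" for f' x
    by (rule bounded_linear.has_derivative[OF h that])
  have eqD: "dirderiv (\<lambda>x. h (f x)) v x = h (dirderiv f v x)" if xU: "x \<in> U" for v x
  proof -
    obtain f' where "(f has_derivative f') (at x)"
      using Ck_has_derivative[OF Suc.prems xU] .
    then show ?thesis using D dirderiv_eq by metis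
  qed
  have ckD: "Ck k U (\<lambda>x. h (dirderiv f v x))" if "v \<in> Basis" for v
    using Suc.IH Suc.prems that by simp
  have "Ck k U (dirderiv (\<lambda>x. h (f x)) v)" if "v \<in> Basis" for v
    by (rule Ck_cong[OF U eqD[symmetric] ckD[OF that]])
  moreover have "(\<lambda>x. h (f x)) differentiable (at x)" if xU: "x \<in> U" for x
  proof -
    obtain f' where f': "(f has_derivative f') (at x)"
      using Ck_has_derivative[OF Suc.prems(1) xU] .
    show ?thesis by (rule differentiableI[OF D[OF f']])
  qed
  moreover have "continuous_on U (\<lambda>x. h (f x))"
    using Suc.prems by (simp add: bounded_linear.continuous_on[OF h])
  ultimately show ?case by simp
qed

lemma Ck_add:
  assumes U: "open U" and "Ck k U f" "Ck k U g"
  shows "Ck k U (\<lambda>x. f x + g x)"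
  using assms(2,3)
proof (induction k arbitrary: f g)
  case 0
  then show ?case by (simp add: continuous_on_add)
next
  case (Suc k)
  have eqD: "dirderiv (\<lambda>x. f x + g x) v x = dirderiv f v x + dirderiv g v x" if xU: "x \<in> U" for v x
  proof -
    obtain f' where f': "(f has_derivative f') (at x)"
      using Ck_has_derivative[OF Suc.prems(1) xU] .
    obtain g' where g': "(g has_derivative g') (at x)"
      using Ck_has_derivative[OF Suc.prems(2) xU] .
    note fg = f' g'
    show ?thesis unfolding dirderiv_eq[OF has_derivative_add[OF fg]] dirderiv_eq[OF fg(1)] dirderiv_eq[OF fg(2)] ..
  qed
  have ckD: "Ck k U (\<lambda>x. dirderiv f v x + dirderiv g v x)" if "v \<in> Basis" for v
    using Suc.IH Suc.prems that by simp
  have "Ck k U (dirderiv (\<lambda>x. f x + g x) v)" if "v \<in> Basis" for v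
    by (rule Ck_cong[OF U eqD[symmetric] ckD[OF that]])
  then show ?case using Suc.prems by (auto intro: continuous_on_add)
qed

lemma Ck_bilinear:
  assumes h: "bounded_bilinear h" and U: "open U" and "Ck k U f" "Ck k U g"
  shows "Ck k U (\<lambda>x. h (f x) (g x))"
  using assms(3,4)
proof (induction k arbitrary: f g)
  case 0
  then show ?case by (simp add: bounded_bilinear.continuous_on[OF h])
next
  case (Suc k)
  have D: "((\<lambda>x. h (f x) (g x)) has_derivative (\<lambda>v. h (f x) (g' v) + h (f' v) (g x))) (at x)"
    if "(f has_derivative f') (at x)" "(g has_derivative g') (at x)" for f' g' x
    by (rule bounded_bilinear.FDERIV[OF h that(1) that(2)])
  have eqD: "dirderiv (\<lambda>x. h (f x) (g x)) v x = h (f x) (dirderiv g v x) + h (dirderiv f v x) (g x)"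
    if xU: "x \<in> U" for v x
  proof -
    obtain f' where f': "(f has_derivative f') (at x)"
      using Ck_has_derivative[OF Suc.prems(1) xU] .
    obtain g' where g': "(g has_derivative g') (at x)"
      using Ck_has_derivative[OF Suc.prems(2) xU] .
    note fg = f' g'
    show ?thesis unfolding dirderiv_eq[OF D[OF fg]] dirderiv_eq[OF fg(1)] dirderiv_eq[OF fg(2)] ..
  qed
  have ckD: "Ck k U (\<lambda>x. h (f x) (dirderiv g v x) + h (dirderiv f v x) (g x))"
    if "v \<in> Basis" for v
  proof (rule Ck_add[OF U])
    show "Ck k U (\<lambda>x. h (f x) (dirderiv g v x))"
      using Suc.IH[OF Ck_decr[OF Suc.prems(1)]] Suc.prems that by simp
    show "Ck k U (\<lambda>x. h (dirderiv f v x) (g x))"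
      using Suc.IH[OF _ Ck_decr[OF Suc.prems(2)]] Suc.prems that by simp
  qed
  have "Ck k U (dirderiv (\<lambda>x. h (f x) (g x)) v)" if "v \<in> Basis" for v
    by (rule Ck_cong[OF U eqD[symmetric] ckD[OF that]])
  moreover have "(\<lambda>x. h (f x) (g x)) differentiable (at x)" if xU: "x \<in> U" for x
  proof -
    obtain f' where f': "(f has_derivative f') (at x)"
      using Ck_has_derivative[OF Suc.prems(1) xU] .
    obtain g' where g': "(g has_derivative g') (at x)"
      using Ck_has_derivative[OF Suc.prems(2) xU] .
    show ?thesis by (rule differentiableI[OF D[OF f' g']])
  qed
  moreover have "continuous_on U (\<lambda>x. h (f x) (g x))"
    using Suc.prems by (simp add: bounded_bilinear.continuous_on[OF h])
  ultimately show ?case by simp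
qed

text \<open>The outer function enters as the whole sequence \<open>Fs\<close> of its successive
  derivatives on \<open>V\<close>. One differentiation turns \<open>Fs m (f x)\<close> into
  \<open>Fs (Suc m) (f x)\<close> times a derivative of \<open>f\<close>, so the induction on
  \<open>k\<close> has to let \<open>m\<close> vary. Powers and exp(-1/t) are then handled by
  listing their derivatives.\<close>

lemma Ck_chain:
  fixes f :: "'a::euclidean_space \<Rightarrow> real"
  assumes Fs: "\<And>m t. t \<in> V \<Longrightarrow> (Fs m has_real_derivative Fs (Suc m) t) (at t)"
    and U: "open U" and "Ck k U f" and fU: "f ` U \<subseteq> V"
  shows "Ck k U (\<lambda>x. Fs m (f x) :: real)"
  using assms(3)
proof (induction k arbitrary: m)
  case 0
  have "continuous_on V (Fs m)"
    by (meson Fs DERIV_isCont continuous_at_imp_continuous_on)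
  then show ?case using 0 fU continuous_on_compose2 by fastforce
next
  case (Suc k)
  have D: "((\<lambda>x. Fs m (f x)) has_derivative (\<lambda>v. Fs (Suc m) (f x) * f' v)) (at x)"
    if "(f has_derivative f') (at x)" "x \<in> U" for f' x
    using has_derivative_compose[OF that(1)] Fs[of "f x" m] that fU
    unfolding has_field_derivative_def by blast
  have eqD: "dirderiv (\<lambda>x. Fs m (f x)) v x = Fs (Suc m) (f x) * dirderiv f v x"
    if xU: "x \<in> U" for v x
  proof -
    obtain f' where f': "(f has_derivative f') (at x)"
      using Ck_has_derivative[OF Suc.prems xU] .
    show ?thesis unfolding dirderiv_eq[OF D[OF f' xU]] dirderiv_eq[OF f'] ..
  qed
  have ckD: "Ck k U (\<lambda>x. Fs (Suc m) (f x) * dirderiv f v x)" if "v \<in> Basis" for v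
  proof (rule Ck_bilinear[OF bounded_bilinear_mult U])
    show "Ck k U (\<lambda>x. Fs (Suc m) (f x))" by (rule Suc.IH[OF Ck_decr[OF Suc.prems]])
    show "Ck k U (dirderiv f v)" using Suc.prems that by simp
  qed
  have "Ck k U (dirderiv (\<lambda>x. Fs m (f x)) v)" if "v \<in> Basis" for v
    by (rule Ck_cong[OF U eqD[symmetric] ckD[OF that]])
  moreover have d: "(\<lambda>x. Fs m (f x)) differentiable (at x)" if xU: "x \<in> U" for x
  proof -
    obtain f' where f': "(f has_derivative f') (at x)"
      using Ck_has_derivative[OF Suc.prems(1) xU] .
    show ?thesis by (rule differentiableI[OF D[OF f' xU]])
  qed
  moreover have "continuous_on U (\<lambda>x. Fs m (f x))"
    using d by (simp add: continuous_at_imp_continuous_on differentiable_imp_continuous_within)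
  ultimately show ?case by simp
qed

lemma smooth_onD: "smooth_on U f \<Longrightarrow> Ck k U f"
  by (simp add: smooth_on_def)

lemma smooth_onI: "(\<And>k. Ck k U f) \<Longrightarrow> smooth_on U f"
  by (simp add: smooth_on_def)

lemma smooth_on_differentiable: "smooth_on U f \<Longrightarrow> x \<in> U \<Longrightarrow> f differentiable (at x)"
  using smooth_onD[of U f "Suc 0"] by simp

lemma smooth_on_continuous: "smooth_on U f \<Longrightarrow> continuous_on U f"
  using smooth_onD[of U f 0] by simp

lemma smooth_on_dirderiv:
  assumes "smooth_on U f" "v \<in> Basis"
  shows "smooth_on U (dirderiv f v)"
proof (rule smooth_onI)
  show "Ck k U (dirderiv f v)" for k using smooth_onD[OF assms(1), of "Suc k"] assms(2) by simp
qed

lemma smooth_on_subset: "smooth_on U f \<Longrightarrow> V \<subseteq> U \<Longrightarrow> smooth_on V f"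
  by (intro smooth_onI) (rule Ck_subset[OF smooth_onD])

lemma smooth_on_cong: "open U \<Longrightarrow> (\<And>x. x \<in> U \<Longrightarrow> f x = g x) \<Longrightarrow> smooth_on U f \<Longrightarrow> smooth_on U g"
  by (intro smooth_onI) (rule Ck_cong[OF _ _ smooth_onD])

lemma smooth_on_Un:
  assumes "open U" "open V" "smooth_on U f" "smooth_on V f"
  shows "smooth_on (U \<union> V) f"
  unfolding smooth_on_def
proof (intro allI Ck_local)
  fix k x assume x: "x \<in> U \<union> V"
  have f: "Ck k U f" "Ck k V f" using assms(3,4) by (simp_all add: smooth_on_def)
  show "\<exists>W. open W \<and> x \<in> W \<and> Ck k W f"
  proof (cases "x \<in> U")
    case True
    show ?thesis by (rule exI[of _ U]) (simp add: True assms(1) f)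
  next
    case False
    then have "x \<in> V" using x by simp
    then show ?thesis by (intro exI[of _ V]) (simp add: assms(2) f)
  qed
qed

lemma smooth_on_const: "smooth_on U (\<lambda>x. c)"
  by (simp add: smooth_on_def Ck_const)

lemma smooth_on_bounded_linear:
  "bounded_linear h \<Longrightarrow> open U \<Longrightarrow> smooth_on U f \<Longrightarrow> smooth_on U (\<lambda>x. h (f x))"
  by (simp add: smooth_on_def Ck_bounded_linear)

lemma smooth_on_add:
  "open U \<Longrightarrow> smooth_on U f \<Longrightarrow> smooth_on U g \<Longrightarrow> smooth_on U (\<lambda>x. f x + g x)"
  by (simp add: smooth_on_def Ck_add)

lemma smooth_on_mult:
  fixes f g :: "_ \<Rightarrow> 'b::real_normed_algebra"
  shows "open U \<Longrightarrow> smooth_on U f \<Longrightarrow> smooth_on U g \<Longrightarrow> smooth_on U (\<lambda>x. f x * g x)"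
  by (simp add: smooth_on_def Ck_bilinear[OF bounded_bilinear_mult])

lemma smooth_on_minus: "open U \<Longrightarrow> smooth_on U f \<Longrightarrow> smooth_on U (\<lambda>x. - f x)"
  using smooth_on_bounded_linear[OF bounded_linear_minus[OF bounded_linear_ident]] .

lemma smooth_on_diff:
  "open U \<Longrightarrow> smooth_on U f \<Longrightarrow> smooth_on U g \<Longrightarrow> smooth_on U (\<lambda>x. f x - g x)"
  using smooth_on_add[of U f "\<lambda>x. - g x"] smooth_on_minus[of U g] by simp

lemma smooth_on_sum:
  "open U \<Longrightarrow> (\<And>i. i \<in> I \<Longrightarrow> smooth_on U (f i)) \<Longrightarrow> smooth_on U (\<lambda>x. \<Sum>i\<in>I. f i x)"
  by (induction I rule: infinite_finite_induct) (auto simp: smooth_on_const intro!: smooth_on_add)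

lemma smooth_on_of_real:
  "open U \<Longrightarrow> smooth_on U f \<Longrightarrow> smooth_on U (\<lambda>x. complex_of_real (f x))"
  using smooth_on_bounded_linear[OF bounded_linear_of_real] .

lemma smooth_on_linear: "bounded_linear h \<Longrightarrow> smooth_on U h"
proof -
  assume h: "bounded_linear h"
  have "dirderiv h v = (\<lambda>x. h v)" for v
    using dirderiv_eq[OF bounded_linear_imp_has_derivative[OF h]] by blast
  then have "Ck k U h" for k
    using h by (cases k)
      (auto simp: Ck_const linear_continuous_on bounded_linear_imp_differentiable)
  then show ?thesis unfolding smooth_on_def by blast
qed

lemma smooth_on_powr:
  fixes f :: "'a::euclidean_space \<Rightarrow> real"
  assumes "open U" "smooth_on U f" "\<And>x. x \<in> U \<Longrightarrow> 0 < f x"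
  shows "smooth_on U (\<lambda>x. f x powr a)"
proof -
  \<comment> \<open>The m-th derivative of t^a, with the falling factorial a (a-1) ... (a-m+1) as
    coefficient.\<close>
  define Fs where "Fs m t = (\<Prod>i<m. a - real i) * t powr (a - real m)" for m t
  have "(Fs m has_real_derivative Fs (Suc m) t) (at t)" if "t \<in> {0<..}" for m t
  proof -
    have "((\<lambda>t. (\<Prod>i<m. a - real i) * t powr (a - real m)) has_real_derivative
           (\<Prod>i<m. a - real i) * ((a - real m) * t powr (a - real m - 1))) (at t)"
      using that by (intro DERIV_cmult has_real_derivative_powr) auto
    then show ?thesis unfolding Fs_def[abs_def] by (simp add: mult_ac diff_diff_eq add.commute)
  qed
  then have "Ck k U (\<lambda>x. Fs 0 (f x))" for k
    using Ck_chain[where Fs = Fs and V = "{0<..}" and f = f and U = U and k = k and m = 0] assms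
    unfolding smooth_on_def by auto
  then show ?thesis unfolding smooth_on_def Fs_def by simp
qed

section \<open>Symmetry of mixed second derivatives\<close>

text \<open>The mean value theorem is applied twice: along \<open>v\<close> to the increment of
  \<open>f\<close> in direction \<open>w\<close>, and along \<open>w\<close> to
  \<open>dirderiv f v\<close>. The second difference on the left is symmetric in \<open>v\<close>
  and \<open>w\<close>, the mixed derivative on the right is not obviously so; comparing the two
  orders at points close to x gives the symmetry.\<close>

lemma second_difference_mean_value:
  fixes f :: "'a::real_normed_vector \<Rightarrow> real"
  assumes t: "0 < t"
    and U: "\<And>a b. 0 \<le> a \<Longrightarrow> a \<le> t \<Longrightarrow> 0 \<le> b \<Longrightarrow> b \<le> t \<Longrightarrow> x + a *\<^sub>R v + b *\<^sub>R w \<in> U"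
    and f: "\<And>y. y \<in> U \<Longrightarrow> f differentiable (at y)"
    and fv: "\<And>y. y \<in> U \<Longrightarrow> dirderiv f v differentiable (at y)"
  shows "\<exists>a b. 0 < a \<and> a < t \<and> 0 < b \<and> b < t \<and>
     f (x + t *\<^sub>R v + t *\<^sub>R w) - f (x + t *\<^sub>R v) - f (x + t *\<^sub>R w) + f x
      = t * t * dirderiv (dirderiv f v) w (x + a *\<^sub>R v + b *\<^sub>R w)"
proof -
  define \<phi> where "\<phi> s = f ((x + t *\<^sub>R w) + s *\<^sub>R v) - f (x + s *\<^sub>R v)" for s
  have d1: "(\<phi> has_real_derivative dirderiv f v ((x + t *\<^sub>R w) + s *\<^sub>R v) - dirderiv f v (x + s *\<^sub>R v)) (at s)"
    if "0 \<le> s" "s \<le> t" for s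
  proof -
    have "f differentiable (at ((x + t *\<^sub>R w) + s *\<^sub>R v))" "f differentiable (at (x + s *\<^sub>R v))"
      using f U[of s t] U[of s 0] that t by (auto simp: algebra_simps)
    then show ?thesis unfolding \<phi>_def has_real_derivative_iff_has_vector_derivative
      by (intro has_vector_derivative_diff has_vector_derivative_dirderiv)
  qed
  obtain a where a: "0 < a" "a < t"
    "\<phi> t - \<phi> 0 = (t - 0) * (dirderiv f v ((x + t *\<^sub>R w) + a *\<^sub>R v) - dirderiv f v (x + a *\<^sub>R v))"
    using MVT2[OF t d1] by blast
  define \<psi> where "\<psi> s = dirderiv f v ((x + a *\<^sub>R v) + s *\<^sub>R w)" for s
  have d2: "(\<psi> has_real_derivative dirderiv (dirderiv f v) w ((x + a *\<^sub>R v) + s *\<^sub>R w)) (at s)"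
    if "0 \<le> s" "s \<le> t" for s
    unfolding \<psi>_def has_real_derivative_iff_has_vector_derivative
    using fv U[of a s] that a by (intro has_vector_derivative_dirderiv) auto
  obtain b where b: "0 < b" "b < t"
    "\<psi> t - \<psi> 0 = (t - 0) * dirderiv (dirderiv f v) w ((x + a *\<^sub>R v) + b *\<^sub>R w)"
    using MVT2[OF t d2] by blast
  have "\<phi> t - \<phi> 0 = t * (\<psi> t - \<psi> 0)" using a(3) unfolding \<psi>_def by (simp add: algebra_simps)
  with b have "\<phi> t - \<phi> 0 = t * t * dirderiv (dirderiv f v) w (x + a *\<^sub>R v + b *\<^sub>R w)" by simp
  moreover have "\<phi> t - \<phi> 0
     = f (x + t *\<^sub>R v + t *\<^sub>R w) - f (x + t *\<^sub>R v) - f (x + t *\<^sub>R w) + f x"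
    unfolding \<phi>_def by (simp add: algebra_simps)
  ultimately show ?thesis using a b by metis
qed

lemma dirderiv_commute_real:
  fixes f :: "'a::euclidean_space \<Rightarrow> real"
  assumes U: "open U" "x \<in> U" and f: "smooth_on U f" and v: "v \<in> Basis" and w: "w \<in> Basis"
  shows "dirderiv (dirderiv f v) w x = dirderiv (dirderiv f w) v x"
proof (rule ccontr)
  let ?A = "dirderiv (dirderiv f v) w" and ?B = "dirderiv (dirderiv f w) v"
  assume ne: "?A x \<noteq> ?B x"
  define e where "e = \<bar>?A x - ?B x\<bar> / 2"
  have e: "e > 0" using ne by (simp add: e_def)
  have "continuous_on U ?A" "continuous_on U ?B"
    using f v w by (auto intro!: smooth_on_continuous smooth_on_dirderiv)
  then have "isCont ?A x" "isCont ?B x" using U by (auto simp: continuous_on_eq_continuous_at)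
  then obtain d1 d2 where d: "d1 > 0" "\<And>y. dist y x < d1 \<Longrightarrow> dist (?A y) (?A x) < e"
     "d2 > 0" "\<And>y. dist y x < d2 \<Longrightarrow> dist (?B y) (?B x) < e"
    unfolding continuous_at_eps_delta using e by metis
  obtain d3 where d3: "d3 > 0" "ball x d3 \<subseteq> U" using U openE by blast
  \<comment> \<open>The intermediate points differ from \<open>x\<close> by at most 2 t, so three
    times \<open>t\<close> leaves room for the strict inequality.\<close>
  define t where "t = min (min d1 d2) d3 / 3"
  have t: "t > 0" "3 * t \<le> d1" "3 * t \<le> d2" "3 * t \<le> d3" using d d3 by (auto simp: t_def)
  have near: "dist (x + a *\<^sub>R v' + b *\<^sub>R w') x < 3 * t"
    if "0 \<le> a" "a \<le> t" "0 \<le> b" "b \<le> t" "v' \<in> Basis" "w' \<in> Basis" for a b v' w'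
  proof -
    have "norm (a *\<^sub>R v' + b *\<^sub>R w') \<le> \<bar>a\<bar> * norm v' + \<bar>b\<bar> * norm w'"
      by (metis norm_scaleR norm_triangle_ineq)
    also have "\<dots> < 3 * t" using that t by simp
    finally show ?thesis by (simp add: dist_norm add.assoc)
  qed
  have inU: "x + a *\<^sub>R v' + b *\<^sub>R w' \<in> U"
    if "0 \<le> a" "a \<le> t" "0 \<le> b" "b \<le> t" "v' \<in> Basis" "w' \<in> Basis" for a b v' w'
    using near[OF that] d3 t by (auto simp: subset_iff dist_commute)
  have dif: "f differentiable (at y)" "dirderiv f v differentiable (at y)" "dirderiv f w differentiable (at y)"
    if "y \<in> U" for y
    using that f v w smooth_on_differentiable smooth_on_dirderiv by blast+
  obtain a b where ab: "0 < a" "a < t" "0 < b" "b < t"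
     "f (x + t *\<^sub>R v + t *\<^sub>R w) - f (x + t *\<^sub>R v) - f (x + t *\<^sub>R w) + f x = t * t * ?A (x + a *\<^sub>R v + b *\<^sub>R w)"
    using second_difference_mean_value[OF t(1) inU dif(1) dif(2)] v w by blast
  obtain a' b' where ab': "0 < a'" "a' < t" "0 < b'" "b' < t"
     "f (x + t *\<^sub>R w + t *\<^sub>R v) - f (x + t *\<^sub>R w) - f (x + t *\<^sub>R v) + f x = t * t * ?B (x + a' *\<^sub>R w + b' *\<^sub>R v)"
    using second_difference_mean_value[OF t(1) inU dif(1) dif(3)] v w by blast
  have "f (x + t *\<^sub>R w + t *\<^sub>R v) = f (x + t *\<^sub>R v + t *\<^sub>R w)" by (simp add: algebra_simps)
  then have "t * t * ?A (x + a *\<^sub>R v + b *\<^sub>R w) = t * t * ?B (x + a' *\<^sub>R w + b' *\<^sub>R v)"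
    using ab(5) ab'(5) by linarith
  then have eq: "?A (x + a *\<^sub>R v + b *\<^sub>R w) = ?B (x + a' *\<^sub>R w + b' *\<^sub>R v)" using t by simp
  have "dist (?A (x + a *\<^sub>R v + b *\<^sub>R w)) (?A x) < e"
    using d(2) near[of a b v w] ab v w t by force
  moreover have "dist (?B (x + a' *\<^sub>R w + b' *\<^sub>R v)) (?B x) < e"
    using d(4) near[of a' b' w v] ab' v w t by force
  ultimately have "\<bar>?A x - ?B x\<bar> < e + e" unfolding eq dist_real_def by linarith
  then show False by (simp add: e_def)
qed

lemma dirderiv_bounded_linear:
  assumes "bounded_linear h" "f differentiable (at x)"
  shows "dirderiv (\<lambda>x. h (f x)) v x = h (dirderiv f v x)"
  using assms bounded_linear.has_derivative dirderiv_eq unfolding differentiable_def by metis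

lemma dirderiv_commute:
  fixes f :: "'a::euclidean_space \<Rightarrow> complex"
  assumes U: "open U" "x \<in> U" and f: "smooth_on U f" and v: "v \<in> Basis" and w: "w \<in> Basis"
  shows "dirderiv (dirderiv f v) w x = dirderiv (dirderiv f w) v x"
proof -
  have *: "h (dirderiv (dirderiv f v) w x) = h (dirderiv (dirderiv f w) v x)"
    if h: "bounded_linear (h :: complex \<Rightarrow> real)" for h
  proof -
    have d: "dirderiv (\<lambda>x. h (f x)) u y = h (dirderiv f u y)" if "y \<in> U" for u y
      using dirderiv_bounded_linear[OF h] smooth_on_differentiable[OF f that] by blast
    have "dirderiv (dirderiv (\<lambda>x. h (f x)) u) u' x = h (dirderiv (dirderiv f u) u' x)"
      if "u \<in> Basis" for u u'
    proof -
      have "dirderiv (dirderiv (\<lambda>x. h (f x)) u) u' x = dirderiv (\<lambda>x. h (dirderiv f u x)) u' x"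
        by (rule dirderiv_cong[OF U d])
      also have "\<dots> = h (dirderiv (dirderiv f u) u' x)"
        by (rule dirderiv_bounded_linear[OF h smooth_on_differentiable[OF smooth_on_dirderiv[OF f that] U(2)]])
      finally show ?thesis .
    qed
    from this[OF v, of w] this[OF w, of v] show ?thesis
      using dirderiv_commute_real[OF U smooth_on_bounded_linear[OF h U(1) f] v w] by simp
  qed
  show ?thesis using *[OF bounded_linear_Re] *[OF bounded_linear_Im] by (simp add: complex_eq_iff)
qed

section \<open>Smooth cutoff functions and partitions\<close>

lemma smooth_on_inner:
  fixes f g :: "_ \<Rightarrow> 'b::real_inner"
  shows "open U \<Longrightarrow> smooth_on U f \<Longrightarrow> smooth_on U g \<Longrightarrow> smooth_on U (\<lambda>x. f x \<bullet> g x)"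
  by (simp add: smooth_on_def Ck_bilinear[OF bounded_bilinear_inner])

lemma smooth_on_ident: "smooth_on U (\<lambda>x. x)"
  by (rule smooth_on_linear[OF bounded_linear_ident])

lemma poly_over_exp_tendsto_0: "((\<lambda>x. poly p x * exp (- x)) \<longlongrightarrow> (0::real)) at_top"
proof -
  have "((\<lambda>x. \<Sum>i\<le>degree p. coeff p i * (x ^ i / exp x)) \<longlongrightarrow> (\<Sum>i\<le>degree p. coeff p i * 0)) at_top"
    by (intro tendsto_intros tendsto_power_div_exp_0)
  moreover have "(\<lambda>x. \<Sum>i\<le>degree p. coeff p i * (x ^ i / exp x)) = (\<lambda>x. poly p x * exp (- x))"
    by (rule ext) (simp add: poly_altdef sum_divide_distrib exp_minus field_simps)
  ultimately show ?thesis by simp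
qed

definition expbump :: "real \<Rightarrow> real" where
  "expbump t = (if 0 < t then exp (- (1 / t)) else 0)"

lemma smooth_on_expbump:
  fixes f :: "'a::euclidean_space \<Rightarrow> real"
  assumes "open U" "smooth_on U f"
  shows "smooth_on U (\<lambda>x. expbump (f x))"
proof -
  \<comment> \<open>The m-th derivative of exp(-1/t) for t > 0 is P_m(1/t) exp(-1/t).
    Differentiating once more gives P_(m+1)(x) = x^2 (P_m(x) - P_m'(x)), and
    \<open>[:0,0,1:]\<close> is x^2.\<close>
  define P :: "nat \<Rightarrow> real poly" where "P = rec_nat 1 (\<lambda>m p. [:0,0,1:] * (p - pderiv p))"
  define Fs where "Fs m t = (if 0 < t then poly (P m) (1 / t) * exp (- (1 / t)) else 0)" for m t
  have P: "P 0 = 1" "P (Suc m) = [:0,0,1:] * (P m - pderiv (P m))" for m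
    by (simp_all add: P_def)
  have der: "(Fs m has_real_derivative Fs (Suc m) t) (at t)" for m t
  proof -
    consider "t > 0" | "t < 0" | "t = 0" by linarith
    then show ?thesis
    proof cases
      case 1
      have "((\<lambda>t. poly (P m) (1 / t) * exp (- (1 / t))) has_real_derivative Fs (Suc m) t) (at t)"
        using 1 by (auto intro!: derivative_eq_intros DERIV_chain2[OF poly_DERIV]
              simp: Fs_def P power2_eq_square field_simps)
      then show ?thesis
        by (rule has_field_derivative_transform_within_open[of _ _ _ "{0<..}"]) (use 1 in \<open>auto simp: Fs_def\<close>)
    next
      case 2
      have "((\<lambda>t. 0) has_real_derivative Fs (Suc m) t) (at t)" using 2 by (simp add: Fs_def)
      then show ?thesis
        by (rule has_field_derivative_transform_within_open[of _ _ _ "{..<0}"]) (use 2 in \<open>auto simp: Fs_def\<close>)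
    next
      case 3
      have "((\<lambda>h. (Fs m (0 + h) - Fs m 0) / h) \<longlongrightarrow> 0) (at_left 0)"
      proof (rule tendsto_eventually)
        show "\<forall>\<^sub>F h in at_left 0. (Fs m (0 + h) - Fs m 0) / h = 0"
          by (auto simp: eventually_at_filter Fs_def)
      qed
      moreover have "((\<lambda>h. (Fs m (0 + h) - Fs m 0) / h) \<longlongrightarrow> 0) (at_right 0)"
      proof -
        \<comment> \<open>With x = 1/h the difference quotient at 0 is x P_m(x) exp(-x);
          \<open>pCons 0\<close> is multiplication by x.\<close>
        have "((\<lambda>h. poly (pCons 0 (P m)) (inverse h) * exp (- inverse h)) \<longlongrightarrow> 0) (at_right (0::real))"
          by (rule filterlim_compose[OF poly_over_exp_tendsto_0 filterlim_inverse_at_top_right])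
        moreover have "\<forall>\<^sub>F h in at_right (0::real).
            poly (pCons 0 (P m)) (inverse h) * exp (- inverse h) = (Fs m (0 + h) - Fs m 0) / h"
          by (auto simp: eventually_at_filter Fs_def field_simps)
        ultimately show ?thesis by (rule Lim_transform_eventually)
      qed
      ultimately show ?thesis using 3 unfolding has_field_derivative_iff
        by (auto simp: Fs_def filterlim_split_at)
    qed
  qed
  show ?thesis
  proof (rule smooth_onI)
    fix k
    have "Ck k U (\<lambda>x. Fs 0 (f x))"
      by (rule Ck_chain[where V = UNIV and Fs = Fs]) (use der assms smooth_onD in auto)
    moreover have "Fs 0 = expbump" by (auto simp: Fs_def P expbump_def)
    ultimately show "Ck k U (\<lambda>x. expbump (f x))" by simp
  qed
qed

lemma expbump_nonneg: "0 \<le> expbump t" and expbump_pos_iff: "0 < expbump t \<longleftrightarrow> 0 < t"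
  by (auto simp: expbump_def)

lemma ball_bump:
  fixes x :: "'a::euclidean_space"
  obtains \<rho> :: "'a \<Rightarrow> real"
  where "smooth_on UNIV \<rho>" "\<And>z. 0 \<le> \<rho> z" "\<And>z. 0 < \<rho> z \<longleftrightarrow> dist x z < \<delta>"
proof (cases "0 < \<delta>")
  case True
  define \<rho> where "\<rho> z = expbump (\<delta>\<^sup>2 - (z - x) \<bullet> (z - x))" for z
  have "smooth_on UNIV \<rho>"
    unfolding \<rho>_def[abs_def]
    by (intro smooth_on_expbump smooth_on_diff smooth_on_inner smooth_on_const smooth_on_ident) auto
  moreover have "0 < \<rho> z \<longleftrightarrow> dist x z < \<delta>" for z
  proof -
    have "0 < \<rho> z \<longleftrightarrow> (norm (z - x))\<^sup>2 < \<delta>\<^sup>2"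
      by (simp add: \<rho>_def expbump_pos_iff power2_norm_eq_inner)
    also have "\<dots> \<longleftrightarrow> norm (z - x) < \<delta>"
      using True by (metis norm_ge_zero power2_less_imp_less power_strict_mono less_imp_le pos2)
    finally show ?thesis by (simp add: dist_norm norm_minus_commute)
  qed
  ultimately show ?thesis using that expbump_nonneg unfolding \<rho>_def by blast
next
  case False
  then have "\<not> dist x z < \<delta>" for z using zero_le_dist[of x z] by linarith
  then show ?thesis using that[of "\<lambda>_. 0"] by (simp add: smooth_on_const)
qed

text \<open>The bumps are left unnormalized: a cutoff needs only that their sum is positive on
  \<open>K\<close>, while a partition divides by that sum. The exact sets of positivity, balls of
  radius \<open>r x\<close>, serve both uses.\<close>

lemma finite_bump_cover:
  fixes K :: "'a::euclidean_space set"
  assumes "compact K" "\<And>x. x \<in> K \<Longrightarrow> 0 < r x"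
  obtains X \<rho> where "finite X" "X \<subseteq> K"
    "\<And>x. smooth_on UNIV (\<rho> x :: 'a \<Rightarrow> real)" "\<And>x z. 0 \<le> \<rho> x z"
    "\<And>x z. 0 < \<rho> x z \<longleftrightarrow> dist x z < r x" "\<And>z. z \<in> K \<Longrightarrow> 0 < (\<Sum>x\<in>X. \<rho> x z)"
proof -
  have "\<exists>\<rho>::'a \<Rightarrow> real. smooth_on UNIV \<rho> \<and> (\<forall>z. 0 \<le> \<rho> z) \<and> (\<forall>z. 0 < \<rho> z \<longleftrightarrow> dist x z < r x)" for x
    by (rule ball_bump[of x "r x"]) (intro exI conjI allI; assumption)
  then obtain \<rho> :: "'a \<Rightarrow> 'a \<Rightarrow> real" where \<rho>: "\<And>x. smooth_on UNIV (\<rho> x)" "\<And>x z. 0 \<le> \<rho> x z"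
    "\<And>x z. 0 < \<rho> x z \<longleftrightarrow> dist x z < r x" by metis
  have "K \<subseteq> (\<Union>x\<in>K. ball x (r x))" using assms(2) by force
  then obtain X where X: "X \<subseteq> K" "finite X" "K \<subseteq> (\<Union>x\<in>X. ball x (r x))"
    using compactE_image[OF assms(1), of K "\<lambda>x. ball x (r x)"] by auto
  have "0 < (\<Sum>x\<in>X. \<rho> x z)" if zK: "z \<in> K" for z
  proof -
    obtain x where "x \<in> X" "dist x z < r x" using X(3) zK by auto
    then show ?thesis using \<rho>(2,3) X(2) by (intro sum_pos2[of X x]) auto
  qed
  then show ?thesis using that[OF X(2,1) \<rho>] by blast
qed

abbreviation supp :: "('a::topological_space \<Rightarrow> 'b::zero) \<Rightarrow> 'a set" where
  "supp f \<equiv> closure {z. f z \<noteq> 0}"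

lemma notin_supp: "z \<notin> supp f \<Longrightarrow> f z = 0"
  using subsetD[OF closure_subset[of "{z. f z \<noteq> 0}"], of z] by auto

text \<open>With e = \<open>expbump\<close> and h the sum of the bumps, \<kappa> is e(h) / (e(h) +
  e(c - h)). The denominator never vanishes as c > 0; the quotient is 0 where h \<le> 0 and 1 where
  h > c. Equality with 1 on an open set \<open>W\<close>, not just on \<open>K\<close>, is what
  makes the derivatives of \<kappa> vanish near \<open>K\<close>.\<close>

lemma smooth_cutoff:
  fixes K :: "'a::euclidean_space set"
  assumes K: "compact K" and \<Omega>: "open \<Omega>" "K \<subseteq> \<Omega>"
  obtains \<kappa> :: "'a \<Rightarrow> real" and W where "smooth_on UNIV \<kappa>" "\<And>z. 0 \<le> \<kappa> z" "\<And>z. \<kappa> z \<le> 1"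
    "compact (supp \<kappa>)" "supp \<kappa> \<subseteq> \<Omega>" "open W" "K \<subseteq> W" "W \<subseteq> \<Omega>" "\<And>z. z \<in> W \<Longrightarrow> \<kappa> z = 1"
proof -
  have "\<forall>x\<in>K. \<exists>r. 0 < r \<and> cball x r \<subseteq> \<Omega>"
    using \<Omega> open_contains_cball by blast
  from bchoice[OF this] obtain r where r: "\<And>x. x \<in> K \<Longrightarrow> 0 < r x" "\<And>x. x \<in> K \<Longrightarrow> cball x (r x) \<subseteq> \<Omega>"
    by blast
  obtain X \<rho> where X: "finite X" "X \<subseteq> K"
    and \<rho>: "\<And>x. smooth_on UNIV (\<rho> x :: 'a \<Rightarrow> real)" "\<And>x z. 0 \<le> \<rho> x z"
      "\<And>x z. 0 < \<rho> x z \<longleftrightarrow> dist x z < r x" "\<And>z. z \<in> K \<Longrightarrow> 0 < (\<Sum>x\<in>X. \<rho> x z)"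
    by (rule finite_bump_cover[OF K, of r], erule r(1)) (rule that; assumption)
  define h where "h z = (\<Sum>x\<in>X. \<rho> x z)" for z
  have hs: "smooth_on UNIV h" unfolding h_def[abs_def] by (intro smooth_on_sum \<rho>(1)) auto
  have hcont: "continuous_on A h" for A
    using smooth_on_continuous[OF hs] continuous_on_subset by blast
  \<comment> \<open>Half the minimum of h over \<open>K\<close>, so that \<open>K\<close> lies in
    the open set where c < h.\<close>
  have "\<exists>c>0. \<forall>z\<in>K. c < h z"
  proof (cases "K = {}")
    case False
    then obtain y where y: "y \<in> K" "\<forall>z\<in>K. h y \<le> h z"
      using continuous_attains_inf[OF K False hcont] by blast
    then show ?thesis using \<rho>(4)[OF y(1)] by (intro exI[of _ "h y / 2"]) (force simp: h_def)
  qed (auto intro: exI[of _ 1])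
  then obtain c where c: "c > 0" "\<And>z. z \<in> K \<Longrightarrow> c < h z" by blast
  define d where "d z = expbump (h z) + expbump (c - h z)" for z
  define \<kappa> where "\<kappa> z = expbump (h z) * d z powr (-1)" for z
  have dpos: "0 < d z" for z
  proof (cases "0 < h z")
    case True
    then show ?thesis unfolding d_def using expbump_pos_iff expbump_nonneg add_pos_nonneg by blast
  next
    case False
    then have "0 < expbump (c - h z)" using c expbump_pos_iff by simp
    then show ?thesis unfolding d_def using expbump_nonneg add_nonneg_pos by blast
  qed
  have ds: "smooth_on UNIV d"
    unfolding d_def[abs_def] by (intro smooth_on_add smooth_on_expbump smooth_on_diff smooth_on_const hs) auto
  have "smooth_on UNIV \<kappa>"
    unfolding \<kappa>_def[abs_def]
    by (intro smooth_on_mult smooth_on_powr smooth_on_expbump hs ds) (use dpos in auto)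
  moreover have "0 \<le> \<kappa> z" for z by (simp add: \<kappa>_def expbump_nonneg)
  moreover have "\<kappa> z \<le> 1" for z
  proof -
    have "expbump (h z) \<le> d z" by (simp add: d_def expbump_nonneg)
    then show ?thesis using dpos[of z] by (simp add: \<kappa>_def powr_minus field_simps)
  qed
  moreover have sub: "supp \<kappa> \<subseteq> (\<Union>x\<in>X. cball x (r x))"
  proof (rule closure_minimal)
    show "{z. \<kappa> z \<noteq> 0} \<subseteq> (\<Union>x\<in>X. cball x (r x))"
    proof
      fix z assume "z \<in> {z. \<kappa> z \<noteq> 0}"
      then have "expbump (h z) \<noteq> 0" by (auto simp: \<kappa>_def)
      then have "(\<Sum>x\<in>X. \<rho> x z) > 0" by (auto simp: expbump_def h_def split: if_splits)
      then obtain x where "x \<in> X" "\<rho> x z > 0"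
        by (meson leD not_le_imp_less sum_nonpos)
      then show "z \<in> (\<Union>x\<in>X. cball x (r x))" using \<rho>(3) by force
    qed
    show "closed (\<Union>x\<in>X. cball x (r x))" using X by (intro closed_UN) auto
  qed
  moreover have "compact (supp \<kappa>)"
  proof -
    have "compact (\<Union>x\<in>X. cball x (r x))" using X(1) by (intro compact_UN) auto
    from compact_Int_closed[OF this, of "supp \<kappa>"] show ?thesis
      using sub by (simp add: Int_absorb1)
  qed
  moreover have "supp \<kappa> \<subseteq> \<Omega>" using sub r(2) X(2) by blast
  moreover have "open ({z. c < h z} \<inter> \<Omega>)"
    using \<Omega>(1) open_Collect_less[OF continuous_on_const hcont] by blast
  moreover have "K \<subseteq> {z. c < h z} \<inter> \<Omega>" using c \<Omega> by auto
  moreover have "\<kappa> z = 1" if "z \<in> {z. c < h z} \<inter> \<Omega>" for z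
  proof -
    have "expbump (c - h z) = 0" using that by (simp add: expbump_def)
    then have "d z = expbump (h z)" by (simp add: d_def)
    then show ?thesis using dpos[of z] by (simp add: \<kappa>_def powr_minus)
  qed
  ultimately show ?thesis using that[of \<kappa> "{z. c < h z} \<inter> \<Omega>"] by blast
qed

section \<open>Operations on test functions\<close>

lemma Dtest_subset_Cc: "\<phi> \<in> Dtest \<Omega> \<Longrightarrow> \<phi> \<in> Cc \<Omega>" by (simp add: Dtest_def)

lemma Cc_supp: "\<phi> \<in> Cc \<Omega> \<Longrightarrow> compact (supp \<phi>)" "\<phi> \<in> Cc \<Omega> \<Longrightarrow> supp \<phi> \<subseteq> \<Omega>"
  by (simp_all add: Cc_def)

lemma compact_supp_mono:
  assumes "compact (supp f)" "\<And>z. f z = 0 \<Longrightarrow> g z = 0"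
  shows "compact (supp g)" "supp g \<subseteq> supp f"
proof -
  show s: "supp g \<subseteq> supp f" using assms(2) by (intro closure_mono) auto
  then show "compact (supp g)"
    using compact_Int_closed[OF assms(1), of "supp g"] by (simp add: Int_absorb1)
qed

text \<open>\<open>V\<close> and the complement of the support of \<phi> are open, they cover the
  space, and \<open>f\<close> is zero on the second. In this way functions that are smooth only on
  part of the space, such as the weight, become test functions after multiplication with a
  cutoff.\<close>

lemma Dtest_local:
  assumes \<phi>: "\<phi> \<in> Cc \<Omega>" and V: "open V" "supp \<phi> \<subseteq> V" and f: "smooth_on V f"
    and z: "\<And>z. \<phi> z = 0 \<Longrightarrow> f z = 0"
  shows "f \<in> Dtest \<Omega>"
proof -
  have "smooth_on (- supp \<phi>) f"
  proof (rule smooth_on_cong)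
    show "smooth_on (- supp \<phi>) (\<lambda>_. 0::complex)" by (rule smooth_on_const)
    show "0 = f x" if "x \<in> - supp \<phi>" for x
      using z[of x] notin_supp[of x \<phi>] that by simp
  qed (simp add: open_Compl)
  then have "smooth_on (V \<union> - supp \<phi>) f" using V f by (intro smooth_on_Un) auto
  moreover have "V \<union> - supp \<phi> = UNIV" using V(2) by auto
  ultimately have "smooth_on UNIV f" by simp
  moreover have "supp f \<subseteq> \<Omega>"
    by (rule subset_trans[OF compact_supp_mono(2)[OF Cc_supp(1)[OF \<phi>] z] Cc_supp(2)[OF \<phi>]])
  moreover have "compact (supp f)" by (rule compact_supp_mono(1)[OF Cc_supp(1)[OF \<phi>] z])
  ultimately show ?thesis using smooth_on_continuous[of UNIV f] by (simp add: Dtest_def Cc_def)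
qed

lemma Dtest_mult:
  assumes "\<phi> \<in> Dtest \<Omega>" "open V" "supp \<phi> \<subseteq> V" "smooth_on V f"
  shows "(\<lambda>z. \<phi> z * f z) \<in> Dtest \<Omega>"
proof (rule Dtest_local[OF Dtest_subset_Cc[OF assms(1)] assms(2,3)])
  have "smooth_on V \<phi>" using assms(1) smooth_on_subset unfolding Dtest_def by blast
  then show "smooth_on V (\<lambda>z. \<phi> z * f z)" using assms by (intro smooth_on_mult)
qed auto

lemma Cc_mult:
  assumes \<phi>: "\<phi> \<in> Cc \<Omega>" and V: "open V" "supp \<phi> \<subseteq> V" and f: "continuous_on V f"
  shows "(\<lambda>z. \<phi> z * f z) \<in> Cc \<Omega>"
proof -
  have c: "continuous_on UNIV \<phi>" using \<phi> by (simp add: Cc_def)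
  have "isCont (\<lambda>z. \<phi> z * f z) x" for x
  proof (cases "x \<in> V")
    case True
    then show ?thesis using c f V(1)
      by (intro continuous_mult) (auto simp: continuous_on_eq_continuous_at)
  next
    case False
    have "continuous_on (- supp \<phi>) (\<lambda>z. \<phi> z * f z) \<longleftrightarrow> continuous_on (- supp \<phi>) (\<lambda>z. 0::complex)"
    proof (intro continuous_on_cong refl)
      fix y assume "y \<in> - supp \<phi>"
      then have "\<phi> y = 0" using notin_supp[of y \<phi>] by blast
      then show "\<phi> y * f y = 0" by simp
    qed
    then have "continuous_on (- supp \<phi>) (\<lambda>z. \<phi> z * f z)" by simp
    moreover have "open (- supp \<phi>)" by (simp add: open_Compl)
    moreover have "x \<in> - supp \<phi>" using False V(2) by blast
    ultimately show ?thesis using continuous_on_eq_continuous_at by blast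
  qed
  then have "continuous_on UNIV (\<lambda>z. \<phi> z * f z)" by (simp add: continuous_at_imp_continuous_on)
  moreover have "supp (\<lambda>z. \<phi> z * f z) \<subseteq> \<Omega>"
    by (rule subset_trans[OF compact_supp_mono(2)[OF Cc_supp(1)[OF \<phi>]] Cc_supp(2)[OF \<phi>]]) simp
  moreover have "compact (supp (\<lambda>z. \<phi> z * f z))"
    by (rule compact_supp_mono(1)[OF Cc_supp(1)[OF \<phi>]]) simp
  ultimately show ?thesis by (simp add: Cc_def)
qed

lemma Cc_add:
  assumes "\<phi> \<in> Cc \<Omega>" "\<psi> \<in> Cc \<Omega>"
  shows "(\<lambda>z. \<phi> z + \<psi> z) \<in> Cc \<Omega>"
proof -
  have sub: "supp (\<lambda>z. \<phi> z + \<psi> z) \<subseteq> supp \<phi> \<union> supp \<psi>"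
    unfolding closure_Un[symmetric] by (intro closure_mono) auto
  have "compact (supp \<phi> \<union> supp \<psi>)"
    by (rule compact_Un[OF Cc_supp(1)[OF assms(1)] Cc_supp(1)[OF assms(2)]])
  from compact_Int_closed[OF this closed_closure, of "{z. \<phi> z + \<psi> z \<noteq> 0}"] have "compact (supp (\<lambda>z. \<phi> z + \<psi> z))"
    unfolding Int_absorb1[OF sub] .
  moreover have "supp (\<lambda>z. \<phi> z + \<psi> z) \<subseteq> \<Omega>"
    by (rule subset_trans[OF sub Un_least[OF Cc_supp(2)[OF assms(1)] Cc_supp(2)[OF assms(2)]]])
  moreover have "continuous_on UNIV (\<lambda>z. \<phi> z + \<psi> z)"
    using assms by (intro continuous_on_add) (simp_all add: Cc_def)
  ultimately show ?thesis by (simp add: Cc_def)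
qed

lemma Dtest_add: "\<phi> \<in> Dtest \<Omega> \<Longrightarrow> \<psi> \<in> Dtest \<Omega> \<Longrightarrow> (\<lambda>z. \<phi> z + \<psi> z) \<in> Dtest \<Omega>"
  using Cc_add smooth_on_add[OF open_UNIV] by (auto simp: Dtest_def)

lemma Dtest_zero: "(\<lambda>z. 0) \<in> Dtest \<Omega>"
  by (simp add: Dtest_def Cc_def smooth_on_const)

lemma Dtest_sum: "(\<And>i. i \<in> I \<Longrightarrow> \<phi> i \<in> Dtest \<Omega>) \<Longrightarrow> (\<lambda>z. \<Sum>i\<in>I. \<phi> i z) \<in> Dtest \<Omega>"
  by (induction I rule: infinite_finite_induct) (auto simp: Dtest_zero intro!: Dtest_add)

lemma Dtest_scale: "\<phi> \<in> Dtest \<Omega> \<Longrightarrow> (\<lambda>z. c * \<phi> z) \<in> Dtest \<Omega>"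
  using Dtest_mult[of \<phi> \<Omega> UNIV "\<lambda>_. c"] by (simp add: smooth_on_const mult.commute)

text \<open>The bumps are divided by their sum, which is positive on a neighbourhood of the support
  of \<phi>. The radii depend on the point, so each piece can be made to live where a given
  continuous object is nearly constant.\<close>

lemma Dtest_partition:
  assumes \<phi>: "\<phi> \<in> Dtest \<Omega>" "nonneg_fun \<phi>" and r: "\<And>x. x \<in> supp \<phi> \<Longrightarrow> 0 < r x"
  obtains X \<phi>s where "finite X" "X \<subseteq> supp \<phi>" "\<And>x. x \<in> X \<Longrightarrow> \<phi>s x \<in> Dtest \<Omega>"
    "\<And>x. nonneg_fun (\<phi>s x)" "\<And>x z. \<phi>s x z \<noteq> 0 \<Longrightarrow> dist x z < r x \<and> \<phi> z \<noteq> 0"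
    "\<And>z. \<phi> z = (\<Sum>x\<in>X. \<phi>s x z)"
proof -
  obtain X \<rho> where X: "finite X" "X \<subseteq> supp \<phi>"
    and \<rho>: "\<And>x. smooth_on UNIV (\<rho> x :: _ \<Rightarrow> real)" "\<And>x z. 0 \<le> \<rho> x z"
      "\<And>x z. 0 < \<rho> x z \<longleftrightarrow> dist x z < r x" "\<And>z. z \<in> supp \<phi> \<Longrightarrow> 0 < (\<Sum>x\<in>X. \<rho> x z)"
    by (rule finite_bump_cover[OF Cc_supp(1)[OF Dtest_subset_Cc[OF \<phi>(1)]], of r], erule r)
      (rule that; assumption)
  define s where "s z = (\<Sum>x\<in>X. \<rho> x z)" for z
  have ss: "smooth_on UNIV s" unfolding s_def[abs_def] by (intro smooth_on_sum \<rho>(1)) auto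
  define \<phi>s where "\<phi>s x z = \<phi> z * complex_of_real (\<rho> x z * s z powr (-1))" for x z
  let ?V = "{z. 0 < s z}"
  have V: "open ?V" using open_Collect_less[OF continuous_on_const smooth_on_continuous[OF ss]] .
  have V': "supp \<phi> \<subseteq> ?V" using \<rho>(4) by (auto simp: s_def)
  have D: "\<phi>s x \<in> Dtest \<Omega>" for x
    unfolding \<phi>s_def[abs_def]
    by (rule Dtest_mult[OF \<phi>(1) V V']; intro smooth_on_of_real smooth_on_mult smooth_on_powr V)
       (use smooth_on_subset[OF ss] smooth_on_subset[OF \<rho>(1)] in auto)
  have "\<phi> z = (\<Sum>x\<in>X. \<phi>s x z)" for z
  proof (cases "\<phi> z = 0")
    case False
    then have "0 < s z" using V' notin_supp[of z \<phi>] by auto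
    then have "(\<Sum>x\<in>X. \<rho> x z * s z powr (-1)) = 1"
      by (simp add: sum_distrib_right[symmetric] s_def[symmetric] powr_minus)
    then have "(\<Sum>x\<in>X. \<phi>s x z) = \<phi> z * complex_of_real 1"
      unfolding \<phi>s_def sum_distrib_left[symmetric] of_real_sum[symmetric] by simp
    then show ?thesis by simp
  qed (simp add: \<phi>s_def)
  moreover have "nonneg_fun (\<phi>s x)" for x
    using \<phi>(2) \<rho>(2) by (auto simp: nonneg_fun_def \<phi>s_def)
  moreover have "dist x z < r x \<and> \<phi> z \<noteq> 0" if "\<phi>s x z \<noteq> 0" for x z
    using that \<rho>(2,3)[of x z] by (auto simp: \<phi>s_def less_le)
  ultimately show ?thesis using that[OF X, of \<phi>s] D by blast
qed

section \<open>Wirtinger derivatives and positive forms\<close>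

lemma axis_in_Basis [simp]: "axis k 1 \<in> (Basis :: (complex^'n) set)" "axis k \<i> \<in> (Basis :: (complex^'n) set)"
  by (simp_all add: axis_in_Basis_iff Basis_complex_def)

text \<open>One operator for both Wirtinger derivatives: c = -\<i> gives the derivative in z_k, c =
  \<i> the one in its conjugate. The rules are thus proved once, and conjugating the derivative of a
  real function amounts to conjugating c.\<close>

definition wirt :: "complex \<Rightarrow> 'n::finite \<Rightarrow> (complex^'n \<Rightarrow> complex) \<Rightarrow> complex^'n \<Rightarrow> complex" where
  "wirt c k f z = (dirderiv f (axis k 1) z + c * dirderiv f (axis k \<i>) z) / 2"

lemma dz_eq_wirt: "dz k f = wirt (- \<i>) k f" and dzbar_eq_wirt: "dzbar k f = wirt \<i> k f"
  by (simp_all add: fun_eq_iff dz_def dzbar_def wirt_def)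

lemma wirt_cong:
  assumes "open U" "z \<in> U" "\<And>y. y \<in> U \<Longrightarrow> f y = g y"
  shows "wirt c k f z = wirt c k g z"
  unfolding wirt_def using dirderiv_cong[OF assms] by simp

lemma smooth_on_wirt:
  assumes "open U" "smooth_on U f"
  shows "smooth_on U (wirt c k f)"
proof -
  have "smooth_on U (\<lambda>z. (1/2) * (dirderiv f (axis k 1) z + c * dirderiv f (axis k \<i>) z))"
    using assms by (intro smooth_on_mult smooth_on_add smooth_on_const smooth_on_dirderiv) auto
  then show ?thesis by (rule smooth_on_cong[OF assms(1), rotated]) (simp add: wirt_def)
qed

lemma has_derivative_dirderiv:
  assumes "f differentiable (at x)"
  shows "(f has_derivative (\<lambda>v. dirderiv f v x)) (at x)"
proof -
  obtain f' where f': "(f has_derivative f') (at x)"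
    using assms unfolding differentiable_def by blast
  have "f' = (\<lambda>v. dirderiv f v x)" using dirderiv_eq[OF f'] by (simp add: fun_eq_iff)
  then show ?thesis using f' by simp
qed

lemma dirderiv_lincomb:
  fixes f g :: "'a::real_normed_vector \<Rightarrow> complex"
  assumes "f differentiable (at z)" "g differentiable (at z)"
  shows "dirderiv (\<lambda>x. (f x + c * g x) / 2) v z = (dirderiv f v z + c * dirderiv g v z) / 2"
proof -
  have "((\<lambda>x. (f x + c * g x) / 2) has_derivative (\<lambda>v. (dirderiv f v z + c * dirderiv g v z) / 2)) (at z)"
    using has_derivative_dirderiv[OF assms(1)] has_derivative_dirderiv[OF assms(2)]
    by (auto intro!: derivative_eq_intros)
  from dirderiv_eq[OF this] show ?thesis .
qed

lemma wirt_add: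
  assumes "f differentiable (at z)" "g differentiable (at z)"
  shows "wirt c k (\<lambda>z. f z + g z) z = wirt c k f z + wirt c k g z"
proof -
  have "dirderiv (\<lambda>z. f z + g z) v z = dirderiv f v z + dirderiv g v z" for v
    by (rule dirderiv_eq[OF has_derivative_add[OF has_derivative_dirderiv has_derivative_dirderiv]]) (fact assms)+
  then show ?thesis by (simp add: wirt_def field_simps)
qed

lemma wirt_mult:
  assumes "f differentiable (at z)" "g differentiable (at z)"
  shows "wirt c k (\<lambda>z. f z * g z) z = f z * wirt c k g z + wirt c k f z * g z"
proof -
  have "dirderiv (\<lambda>z. f z * g z) v z = f z * dirderiv g v z + dirderiv f v z * g z" for v
    by (rule dirderiv_eq[OF has_derivative_mult[OF has_derivative_dirderiv has_derivative_dirderiv]]) (fact assms)+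
  then show ?thesis by (simp add: wirt_def field_simps)
qed

lemma wirt_const [simp]: "wirt c k (\<lambda>z. d) z = 0"
proof -
  have "dirderiv (\<lambda>z. d) v z = 0" for v :: "complex^'a" by (rule dirderiv_eq[OF has_derivative_const])
  then show ?thesis by (simp add: wirt_def)
qed

lemma wirt_cmult:
  assumes "f differentiable (at z)"
  shows "wirt c k (\<lambda>z. d * f z) z = d * wirt c k f z"
  using wirt_mult[of "\<lambda>_. d" z f c k] assms by simp

lemma wirt_commute:
  assumes U: "open U" "z \<in> U" and f: "smooth_on U f"
  shows "wirt c k (wirt d l f) z = wirt d l (wirt c k f) z"
proof -
  have D: "dirderiv (wirt d l f) v z
     = (dirderiv (dirderiv f (axis l 1)) v z + d * dirderiv (dirderiv f (axis l \<i>)) v z) / 2" for d l v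
    unfolding wirt_def[abs_def]
    by (rule dirderiv_lincomb; rule smooth_on_differentiable[OF smooth_on_dirderiv[OF f] U(2)]; simp)
  have C: "dirderiv (dirderiv f (axis k a)) (axis l b) z = dirderiv (dirderiv f (axis l b)) (axis k a) z"
    if "a \<in> {1, \<i>}" "b \<in> {1, \<i>}" for a b
    using that by (intro dirderiv_commute[OF U f]) auto
  show ?thesis
    unfolding wirt_def[of c k "wirt d l f"] wirt_def[of d l "wirt c k f"] D
    by (simp add: C field_simps)
qed

lemma wirt_cnj:
  assumes "f differentiable (at z)"
  shows "wirt c k (\<lambda>z. cnj (f z)) z = cnj (wirt (cnj c) k f z)"
  unfolding wirt_def dirderiv_bounded_linear[OF bounded_linear_cnj assms] by simp

lemma wirt_of_real:
  assumes "s differentiable (at z)"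
  shows "wirt c k (\<lambda>z. complex_of_real (s z)) z
    = (of_real (dirderiv s (axis k 1) z) + c * of_real (dirderiv s (axis k \<i>) z)) / 2"
  unfolding wirt_def dirderiv_bounded_linear[OF bounded_linear_of_real assms] ..

lemma cnj_wirt_of_real:
  assumes "s differentiable (at z)"
  shows "cnj (wirt c k (\<lambda>z. complex_of_real (s z)) z) = wirt (cnj c) k (\<lambda>z. of_real (s z)) z"
  unfolding wirt_of_real[OF assms] by simp

lemma cmod_wirt_of_real_le:
  assumes "s differentiable (at z)" "cmod c \<le> 1"
    "\<bar>dirderiv s (axis k 1) z\<bar> \<le> B" "\<bar>dirderiv s (axis k \<i>) z\<bar> \<le> B"
  shows "cmod (wirt c k (\<lambda>z. complex_of_real (s z)) z) \<le> B"
proof -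
  have "cmod (of_real (dirderiv s (axis k 1) z) + c * of_real (dirderiv s (axis k \<i>) z))
     \<le> \<bar>dirderiv s (axis k 1) z\<bar> + cmod c * \<bar>dirderiv s (axis k \<i>) z\<bar>"
    using norm_triangle_ineq[of "complex_of_real (dirderiv s (axis k 1) z)" "c * of_real (dirderiv s (axis k \<i>) z)"]
    by (simp add: norm_mult)
  also have "\<dots> \<le> B + 1 * B" using assms by (intro add_mono mult_mono) auto
  finally show ?thesis unfolding wirt_of_real[OF assms(1)] by (simp add: norm_divide)
qed

text \<open>This is the source of the Hermitian symmetry of complex Hessians: for c = -\<i> and d =
  \<i>, conjugation exchanges the two indices.\<close>

lemma cnj_wirt2_of_real:
  assumes U: "open U" "z \<in> U" and s: "smooth_on U s"
  shows "cnj (wirt c k (wirt d l (\<lambda>z. complex_of_real (s z))) z)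
      = wirt (cnj d) l (wirt (cnj c) k (\<lambda>z. of_real (s z))) z"
proof -
  let ?s = "\<lambda>z. complex_of_real (s z)"
  have s': "smooth_on U ?s" by (rule smooth_on_of_real[OF U(1) s])
  have "cnj (wirt c k (wirt d l ?s) z) = wirt (cnj c) k (\<lambda>z. cnj (wirt d l ?s z)) z"
    using wirt_cnj[OF smooth_on_differentiable[OF smooth_on_wirt[OF U(1) s'] U(2)]] by simp
  also have "\<dots> = wirt (cnj c) k (wirt (cnj d) l ?s) z"
    by (rule wirt_cong[OF U cnj_wirt_of_real[OF smooth_on_differentiable[OF s]]])
  finally show ?thesis using wirt_commute[OF U s'] by simp
qed

lemma wirt2_mult:
  assumes U: "open U" "z \<in> U" and f: "smooth_on U f" and g: "smooth_on U g"
  shows "wirt c k (wirt d l (\<lambda>z. f z * g z)) z = f z * wirt c k (wirt d l g) z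
     + wirt c k f z * wirt d l g z + wirt d l f z * wirt c k g z + wirt c k (wirt d l f) z * g z"
proof -
  note sm = f g smooth_on_wirt[OF U(1) f] smooth_on_wirt[OF U(1) g]
  note df = sm[THEN smooth_on_differentiable, OF U(2)]
  have "wirt c k (wirt d l (\<lambda>z. f z * g z)) z = wirt c k (\<lambda>z. f z * wirt d l g z + wirt d l f z * g z) z"
    by (rule wirt_cong[OF U]) (rule wirt_mult[OF smooth_on_differentiable[OF f] smooth_on_differentiable[OF g]])
  also have "\<dots> = wirt c k (\<lambda>z. f z * wirt d l g z) z + wirt c k (\<lambda>z. wirt d l f z * g z) z"
    by (rule wirt_add) (intro differentiable_mult df)+
  also have "\<dots> = f z * wirt c k (wirt d l g) z
     + wirt c k f z * wirt d l g z + wirt d l f z * wirt c k g z + wirt c k (wirt d l f) z * g z"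
    by (subst (1 2) wirt_mult) (simp_all add: df)
  finally show ?thesis .
qed

lemma wirt_powr:
  fixes s :: "complex^'n::finite \<Rightarrow> real"
  assumes "s differentiable (at z)" "0 < s z"
  shows "wirt c k (\<lambda>z. complex_of_real (s z powr q)) z
    = of_real (q * s z powr (q - 1)) * wirt c k (\<lambda>z. of_real (s z)) z"
proof -
  have "((\<lambda>x. s x powr q) has_derivative (\<lambda>v. dirderiv s v z * (q * s z powr (q - 1)))) (at z)"
    using has_derivative_compose[OF has_derivative_dirderiv[OF assms(1)]
        has_real_derivative_powr[OF assms(2), of q, unfolded has_field_derivative_def]]
    by (simp add: mult.commute)
  note D = differentiableI[OF this] dirderiv_eq[OF this]
  show ?thesis unfolding wirt_of_real[OF D(1)] wirt_of_real[OF assms(1)] D(2) by (simp add: algebra_simps)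
qed

lemma wirt2_powr:
  fixes s :: "complex^'n::finite \<Rightarrow> real"
  assumes U: "open U" "z \<in> U" and s: "smooth_on U s" and pos: "\<And>y. y \<in> U \<Longrightarrow> 0 < s y"
  shows "wirt c k (wirt d l (\<lambda>z. complex_of_real (s z powr q))) z
    = of_real (q * s z powr (q - 1)) * wirt c k (wirt d l (\<lambda>z. of_real (s z))) z
    + of_real (q * (q - 1) * s z powr (q - 2)) * wirt c k (\<lambda>z. of_real (s z)) z * wirt d l (\<lambda>z. of_real (s z)) z"
proof -
  let ?s = "\<lambda>z. complex_of_real (s z)"
  have s': "smooth_on U ?s" by (rule smooth_on_of_real[OF U(1) s])
  have p: "smooth_on U (\<lambda>z. s z powr (q - 1))" by (rule smooth_on_powr[OF U(1) s pos])
  have p': "smooth_on U (\<lambda>z. complex_of_real (s z powr (q - 1)))" by (rule smooth_on_of_real[OF U(1) p])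
  have "wirt c k (wirt d l (\<lambda>z. complex_of_real (s z powr q))) z
     = wirt c k (\<lambda>z. of_real q * (of_real (s z powr (q - 1)) * wirt d l ?s z)) z"
    by (rule wirt_cong[OF U]) (simp add: wirt_powr[OF smooth_on_differentiable[OF s] pos])
  also have "\<dots> = of_real q * wirt c k (\<lambda>z. of_real (s z powr (q - 1)) * wirt d l ?s z) z"
    by (intro wirt_cmult differentiable_mult smooth_on_differentiable[OF p' U(2)]
        smooth_on_differentiable[OF smooth_on_wirt[OF U(1) s'] U(2)])
  also have "wirt c k (\<lambda>z. of_real (s z powr (q - 1)) * wirt d l ?s z) z
     = of_real (s z powr (q - 1)) * wirt c k (wirt d l ?s) z
      + wirt c k (\<lambda>z. of_real (s z powr (q - 1))) z * wirt d l ?s z"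
    by (rule wirt_mult[OF smooth_on_differentiable[OF p' U(2)]
        smooth_on_differentiable[OF smooth_on_wirt[OF U(1) s'] U(2)]])
  also have "wirt c k (\<lambda>z. complex_of_real (s z powr (q - 1))) z
      = of_real ((q - 1) * s z powr (q - 2)) * wirt c k ?s z"
    using wirt_powr[OF smooth_on_differentiable[OF s U(2)] pos[OF U(2)], of c k "q - 1"] by simp
  finally show ?thesis by (simp add: algebra_simps)
qed

section \<open>Positive semidefinite matrices and positive forms\<close>

definition psd :: "('n::finite \<Rightarrow> 'n \<Rightarrow> complex) \<Rightarrow> bool" where
  "psd H \<longleftrightarrow> (\<forall>k l. H l k = cnj (H k l)) \<and> (\<forall>v. 0 \<le> Re (\<Sum>k\<in>UNIV. \<Sum>l\<in>UNIV. H k l * v k * cnj (v l)))"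

lemma psd_herm: "psd H \<Longrightarrow> H l k = cnj (H k l)"
  unfolding psd_def by (drule conjunct1) (drule spec, erule spec)

lemma psd_form: "psd H \<Longrightarrow> 0 \<le> Re (\<Sum>k\<in>UNIV. \<Sum>l\<in>UNIV. H k l * v k * cnj (v l))"
  unfolding psd_def by (drule conjunct2) (erule spec)

text \<open>Only the coordinate m of v is changed, by t, and the form is expanded in t. With v = 0
  this evaluates diagonal entries, and with a suitable t it completes the square.\<close>

lemma hermitian_form_shift:
  fixes H :: "'n::finite \<Rightarrow> 'n \<Rightarrow> complex"
  shows "(\<Sum>k\<in>UNIV. \<Sum>l\<in>UNIV. H k l * (v k + t * of_bool (k = m)) * cnj (v l + t * of_bool (l = m)))
    = (\<Sum>k\<in>UNIV. \<Sum>l\<in>UNIV. H k l * v k * cnj (v l)) + cnj t * (\<Sum>k\<in>UNIV. H k m * v k)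
     + t * (\<Sum>l\<in>UNIV. H m l * cnj (v l)) + t * cnj t * H m m"
proof -
  have 1: "(\<Sum>l\<in>UNIV. f l * cnj (of_bool (l = m))) = f m" "(\<Sum>l\<in>UNIV. f l * of_bool (l = m)) = f m" for f :: "'n \<Rightarrow> complex"
    by (simp_all add: of_bool_def if_distrib if_distribR sum.delta cong: if_cong)
  have "(\<Sum>l\<in>UNIV. H k l * (v k + t * of_bool (k = m)) * cnj (v l + t * of_bool (l = m)))
    = (\<Sum>l\<in>UNIV. H k l * v k * cnj (v l)) + (\<Sum>l\<in>UNIV. (cnj t * H k l * v k) * cnj (of_bool (l = m)))
     + (t * (\<Sum>l\<in>UNIV. H k l * cnj (v l)) + t * cnj t * (\<Sum>l\<in>UNIV. H k l * cnj (of_bool (l = m)))) * of_bool (k = m)" for k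
    unfolding sum_distrib_left sum_distrib_right sum.distrib[symmetric]
    by (rule sum.cong) (auto simp: algebra_simps)
  then show ?thesis
    by (simp only: 1 sum.distrib) (simp add: sum_distrib_left mult.assoc)
qed

lemma psd_diag:
  assumes "psd H"
  shows "Im (H k k) = 0" "0 \<le> Re (H k k)"
proof -
  have "H k k = cnj (H k k)" by (rule psd_herm[OF assms])
  then show "Im (H k k) = 0" by (simp add: complex_eq_iff)
  have "0 \<le> Re (\<Sum>i\<in>UNIV. \<Sum>l\<in>UNIV. H i l * (0 + 1 * of_bool (i = k)) * cnj (0 + 1 * of_bool (l = k)))"
    by (rule psd_form[OF assms, of "\<lambda>i. 0 + 1 * of_bool (i = k)"])
  then show "0 \<le> Re (H k k)" unfolding hermitian_form_shift by simp
qed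

lemma psd_zero_diag:
  assumes H: "psd H" and m: "H m m = 0"
  shows "H k m = 0"
proof (rule ccontr)
  assume ne: "H k m \<noteq> 0"
  \<comment> \<open>On e_k - s H_km e_m the form equals H_kk - 2 s |H_km|^2, because H_mm = 0; this
    s makes it -1.\<close>
  define s where "s = (Re (H k k) + 1) / (2 * (cmod (H k m))\<^sup>2)"
  define v where "v i = 0 + (1::complex) * of_bool (i = k)" for i :: 'a
  have "0 \<le> Re (\<Sum>i\<in>UNIV. \<Sum>l\<in>UNIV. H i l * (v i + (- of_real s * H k m) * of_bool (i = m))
       * cnj (v l + (- of_real s * H k m) * of_bool (l = m)))"
    by (rule psd_form[OF H, of "\<lambda>i. v i + (- of_real s * H k m) * of_bool (i = m)"])
  also have "(\<Sum>i\<in>UNIV. \<Sum>l\<in>UNIV. H i l * (v i + (- of_real s * H k m) * of_bool (i = m))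
       * cnj (v l + (- of_real s * H k m) * of_bool (l = m)))
     = H k k - of_real s * cnj (H k m) * H k m - of_real s * H k m * H m k"
    unfolding hermitian_form_shift v_def
    by (simp add: m of_bool_def if_distrib if_distribR sum.delta cong: if_cong)
  also have "H m k = cnj (H k m)" by (rule psd_herm[OF H])
  also have "Re (H k k - of_real s * cnj (H k m) * H k m - of_real s * H k m * cnj (H k m))
     = Re (H k k) - 2 * s * (cmod (H k m))\<^sup>2"
    unfolding cmod_power2 by (simp add: power2_eq_square algebra_simps)
  also have "\<dots> = - 1" using ne by (simp add: s_def field_simps)
  finally show False by simp
qed

text \<open>\<open>H\<close> is written as a sum of rank one matrices, each a vector times its
  conjugate transpose, and on these \<open>A\<close> is nonnegative by hypothesis. One step of
  Cholesky elimination at a nonzero diagonal entry splits off such a matrix. It leaves the Schur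
  complement, which is again positive semidefinite and has fewer nonzero diagonal entries.\<close>

lemma psd_trace_nonneg:
  fixes A :: "'n::finite \<Rightarrow> 'n \<Rightarrow> complex"
  assumes A: "\<And>v. 0 \<le> Re (\<Sum>k\<in>UNIV. \<Sum>l\<in>UNIV. v k * cnj (v l) * A k l)"
    and "psd H"
  shows "0 \<le> Re (\<Sum>k\<in>UNIV. \<Sum>l\<in>UNIV. H k l * A k l)"
  using assms(2)
proof (induction "card {k. H k k \<noteq> 0}" arbitrary: H rule: less_induct)
  case less
  note H = less.prems
  show ?case
  proof (cases "\<exists>m. H m m \<noteq> 0")
    case False
    then have "H k l = 0" for k l using psd_zero_diag[OF H] by simp
    then show ?thesis by simp
  next
    case True
    then obtain m where m: "H m m \<noteq> 0" by blast
    define h where "h = Re (H m m)"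
    have h: "h > 0" "H m m = of_real h"
      using psd_diag[OF H, of m] m by (auto simp: h_def complex_eq_iff)
    have herm: "H l k = cnj (H k l)" for k l by (rule psd_herm[OF H])
    define b where "b k = H k m / of_real (sqrt h)" for k
    define H' where "H' k l = H k l - b k * cnj (b l)" for k l
    have bb: "b k * cnj (b l) = H k m * H m l / of_real h" for k l
    proof -
      have "complex_of_real (sqrt h) * of_real (sqrt h) = of_real h"
        using h by (simp flip: of_real_mult)
      then show ?thesis by (simp add: b_def herm[of m l])
    qed
    have "psd H'"
      unfolding psd_def
    proof (intro conjI allI)
      show "H' l k = cnj (H' k l)" for k l by (simp add: H'_def herm[of k l] mult.commute)
      fix v :: "'n \<Rightarrow> complex"
      define \<beta> where "\<beta> = (\<Sum>k\<in>UNIV. H k m * v k)"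
      \<comment> \<open>The minimizer of the form of \<open>H\<close> along e_m: the form of
        \<open>H'\<close> at v is that of \<open>H\<close> at v + t e_m, hence nonnegative.\<close>
      define t where "t = - \<beta> / of_real h"
      have c: "(\<Sum>l\<in>UNIV. H m l * cnj (v l)) = cnj \<beta>" by (simp add: \<beta>_def herm[of _ m])
      have "(\<Sum>k\<in>UNIV. \<Sum>l\<in>UNIV. H' k l * v k * cnj (v l))
        = (\<Sum>k\<in>UNIV. \<Sum>l\<in>UNIV. H k l * v k * cnj (v l)) - \<beta> * cnj \<beta> / of_real h"
      proof -
        have "\<beta> * cnj \<beta> / of_real h
            = (\<Sum>k\<in>UNIV. H k m * v k) * (\<Sum>l\<in>UNIV. H m l * cnj (v l)) / of_real h"
          unfolding c \<beta>_def[symmetric] ..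
        also have "\<dots> = (\<Sum>k\<in>UNIV. \<Sum>l\<in>UNIV. (H k m * v k) * (H m l * cnj (v l)) / of_real h)"
          unfolding sum_product sum_divide_distrib ..
        finally have e: "\<beta> * cnj \<beta> / of_real h
            = (\<Sum>k\<in>UNIV. \<Sum>l\<in>UNIV. (H k m * v k) * (H m l * cnj (v l)) / of_real h)" .
        show ?thesis
          unfolding e H'_def bb sum_subtractf[symmetric]
          by (intro sum.cong refl) (simp add: algebra_simps)
      qed
      also have "\<dots> = (\<Sum>k\<in>UNIV. \<Sum>l\<in>UNIV. H k l * (v k + t * of_bool (k = m)) * cnj (v l + t * of_bool (l = m)))"
        unfolding hermitian_form_shift c \<beta>_def[symmetric] t_def h(2) using h(1)
        by (simp add: field_simps)
      finally show "0 \<le> Re (\<Sum>k\<in>UNIV. \<Sum>l\<in>UNIV. H' k l * v k * cnj (v l))"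
        using psd_form[OF H, of "\<lambda>k. v k + t * of_bool (k = m)"] by simp
    qed
    moreover have "card {k. H' k k \<noteq> 0} < card {k. H k k \<noteq> 0}"
    proof (rule psubset_card_mono)
      have "H' m m = 0" using h by (simp add: H'_def bb)
      moreover have "H' k k = 0" if "H k k = 0" for k
        using psd_zero_diag[OF H that, of m] herm[of m k] that by (simp add: H'_def bb)
      ultimately show "{k. H' k k \<noteq> 0} \<subset> {k. H k k \<noteq> 0}" using m by blast
    qed simp
    ultimately have "0 \<le> Re (\<Sum>k\<in>UNIV. \<Sum>l\<in>UNIV. H' k l * A k l)" using less.hyps by blast
    moreover have "(\<Sum>k\<in>UNIV. \<Sum>l\<in>UNIV. H k l * A k l)
       = (\<Sum>k\<in>UNIV. \<Sum>l\<in>UNIV. H' k l * A k l) + (\<Sum>k\<in>UNIV. \<Sum>l\<in>UNIV. b k * cnj (b l) * A k l)"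
      by (simp add: H'_def left_diff_distrib sum_subtractf)
    ultimately show ?thesis using A[of b] by simp
  qed
qed

text \<open>\<open>M \<phi> k l\<close> stands for the value of a current of bidimension (1,1) on
  \<phi> times the form built from dz_k and the conjugate of dz_l. Such an \<open>M\<close> arises
  from \<open>T\<close> by fixing all arguments except one pair. Positivity is demanded on constant
  vectors v only; variable coefficients are the subject of \<open>pos_form_psd\<close>.\<close>

definition pos_form :: "(complex^'n::finite) set \<Rightarrow> ((complex^'n \<Rightarrow> complex) \<Rightarrow> 'n \<Rightarrow> 'n \<Rightarrow> complex) \<Rightarrow> bool" where
  "pos_form \<Omega> M \<longleftrightarrow>
     (\<forall>\<phi>\<in>Dtest \<Omega>. \<forall>\<psi>\<in>Dtest \<Omega>. \<forall>c k l. M (\<lambda>z. c * \<phi> z + \<psi> z) k l = c * M \<phi> k l + M \<psi> k l) \<and>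
     (\<forall>\<phi>\<in>Dtest \<Omega>. \<forall>v. nonneg_fun \<phi> \<longrightarrow> 0 \<le> Re (\<Sum>k\<in>UNIV. \<Sum>l\<in>UNIV. v k * cnj (v l) * M \<phi> k l))"

lemma pos_formD:
  assumes "pos_form \<Omega> M" "\<phi> \<in> Dtest \<Omega>"
  shows pos_form_add: "\<psi> \<in> Dtest \<Omega> \<Longrightarrow> M (\<lambda>z. \<phi> z + \<psi> z) k l = M \<phi> k l + M \<psi> k l"
    and pos_form_scale: "M (\<lambda>z. c * \<phi> z) k l = c * M \<phi> k l"
    and pos_form_pos: "nonneg_fun \<phi> \<Longrightarrow> 0 \<le> Re (\<Sum>k\<in>UNIV. \<Sum>l\<in>UNIV. v k * cnj (v l) * M \<phi> k l)"
proof -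
  have lin: "M (\<lambda>z. c * \<phi> z + \<psi> z) k l = c * M \<phi> k l + M \<psi> k l"
    if "\<phi> \<in> Dtest \<Omega>" "\<psi> \<in> Dtest \<Omega>" for \<phi> \<psi> c using assms(1) that unfolding pos_form_def by blast
  have zero: "M (\<lambda>z. 0) k l = 0" using lin[OF Dtest_zero Dtest_zero, of 1] by simp
  show "M (\<lambda>z. \<phi> z + \<psi> z) k l = M \<phi> k l + M \<psi> k l" if "\<psi> \<in> Dtest \<Omega>"
    using lin[OF assms(2) that, of 1] by simp
  show "M (\<lambda>z. c * \<phi> z) k l = c * M \<phi> k l"
    using lin[OF assms(2) Dtest_zero, of c] zero by simp
  show "0 \<le> Re (\<Sum>k\<in>UNIV. \<Sum>l\<in>UNIV. v k * cnj (v l) * M \<phi> k l)" if "nonneg_fun \<phi>"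
    using assms that unfolding pos_form_def by blast
qed

lemma pos_form_sum:
  assumes M: "pos_form \<Omega> M" and "finite I" "\<And>i. i \<in> I \<Longrightarrow> \<phi> i \<in> Dtest \<Omega>"
  shows "M (\<lambda>z. \<Sum>i\<in>I. \<phi> i z) k l = (\<Sum>i\<in>I. M (\<phi> i) k l)"
  using assms(2,3)
proof (induction I)
  case empty
  have "M (\<lambda>z. 0 * 0) k l = 0 * M (\<lambda>z. 0) k l" by (rule pos_form_scale[OF M Dtest_zero])
  then show ?case by simp
next
  case (insert i I)
  then have "M (\<lambda>z. \<phi> i z + (\<Sum>i\<in>I. \<phi> i z)) k l = M (\<phi> i) k l + M (\<lambda>z. \<Sum>i\<in>I. \<phi> i z) k l"
    by (intro pos_form_add[OF M] Dtest_sum) auto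
  with insert show ?case by simp
qed

text \<open>A Hermitian matrix field with small entries, plus a small multiple of the identity, is a
  combination with nonnegative coefficients of the rank one matrices
  \<open>(e\<^sub>a + \<zeta> e\<^sub>b) (e\<^sub>a + \<zeta> e\<^sub>b)\<^sup>*\<close> with \<open>\<zeta> \<in> {1, \<i>, -1, -\<i>}\<close>.\<close>

lemma pos_form_diagonally_dominant:
  fixes M :: "(complex^'n::finite \<Rightarrow> complex) \<Rightarrow> 'n \<Rightarrow> 'n \<Rightarrow> complex"
  assumes M: "pos_form \<Omega> M" and \<phi>: "\<phi> \<in> Dtest \<Omega>" "nonneg_fun \<phi>"
    and V: "open V" "supp \<phi> \<subseteq> V" and E: "\<And>a b. smooth_on V (\<lambda>z. E z a b)"
    and herm: "\<And>z a b. E z b a = cnj (E z a b)"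
    and small: "\<And>z a b. \<phi> z \<noteq> 0 \<Longrightarrow> cmod (E z a b) \<le> \<eta>"
  shows "0 \<le> Re (\<Sum>a\<in>UNIV. \<Sum>b\<in>UNIV. M (\<lambda>z. \<phi> z * E z a b) a b)
        + 2 * real CARD('n) * \<eta> * Re (\<Sum>a\<in>UNIV. M \<phi> a a)"
proof -
  \<comment> \<open>The coefficient of the matrix with \<zeta> = \<i>^i. Summed over i < 4 these
    functions give \<eta> \<phi>, and summed with the factor conj \<zeta> they give \<phi> E_ab / 2.
    Their nonnegativity is the smallness of \<open>E\<close>.\<close>
  define co where "co a b i z = \<phi> z * (complex_of_real (\<eta> + Re (\<i> ^ i * E z a b)) / 4)" for a b i z
  have coD: "co a b i \<in> Dtest \<Omega>" for a b i
  proof -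
    have "smooth_on V (\<lambda>z. complex_of_real (\<eta> + Re (\<i> ^ i * E z a b)) * (1 / 4))"
      by (intro smooth_on_mult smooth_on_of_real smooth_on_add smooth_on_const V
         smooth_on_bounded_linear[OF bounded_linear_Re] E)
    from Dtest_mult[OF \<phi>(1) V this] show ?thesis by (simp add: co_def[abs_def])
  qed
  have conn: "nonneg_fun (co a b i)" for a b i
  proof -
    have "0 \<le> Re (co a b i z) \<and> Im (co a b i z) = 0" for z
    proof (cases "\<phi> z = 0")
      case False
      have "\<bar>Re (\<i> ^ i * E z a b)\<bar> \<le> cmod (\<i> ^ i * E z a b)" by (rule abs_Re_le_cmod)
      also have "\<dots> \<le> \<eta>" using small[OF False] by (simp add: norm_mult norm_power)
      finally have "0 \<le> \<eta> + Re (\<i> ^ i * E z a b)" by linarith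
      then show ?thesis using \<phi>(2) by (simp add: co_def nonneg_fun_def)
    qed (simp add: co_def)
    then show ?thesis by (simp add: nonneg_fun_def)
  qed
  have phE: "(\<lambda>z. \<phi> z * E z a b) \<in> Dtest \<Omega>" for a b by (rule Dtest_mult[OF \<phi>(1) V E])
  have pair: "0 \<le> Re (\<eta> * (M \<phi> a a + M \<phi> b b)
      + (M (\<lambda>z. \<phi> z * E z a b) a b + M (\<lambda>z. \<phi> z * E z b a) b a) / 2)" for a b
  proof -
    define v where "v i k = of_bool (k = a) + \<i> ^ i * of_bool (k = b)" for i and k :: 'n
    have exp: "(\<Sum>k\<in>UNIV. \<Sum>l\<in>UNIV. v i k * cnj (v i l) * M (co a b i) k l)
      = M (co a b i) a a + M (co a b i) b b + cnj (\<i> ^ i) * M (co a b i) a b + \<i> ^ i * M (co a b i) b a"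
      (is "_ = ?R i") for i
    proof -
      have u: "\<i> ^ i * cnj (\<i> ^ i) = 1"
        using complex_norm_square[of "\<i> ^ i"] by (simp add: norm_power)
      have 1: "(\<Sum>l\<in>UNIV. of_bool (l = c) * f l) = (f c :: complex)" for c :: 'n and f
        by (simp add: of_bool_def if_distrib if_distribR sum.delta cong: if_cong)
      have "(\<Sum>k\<in>UNIV. \<Sum>l\<in>UNIV. v i k * cnj (v i l) * M (co a b i) k l)
        = (\<Sum>k\<in>UNIV. of_bool (k = a) * (\<Sum>l\<in>UNIV. of_bool (l = a) * M (co a b i) k l))
         + (\<Sum>k\<in>UNIV. of_bool (k = b) * (\<Sum>l\<in>UNIV. of_bool (l = b) * ((\<i> ^ i * cnj (\<i> ^ i)) * M (co a b i) k l)))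
         + (\<Sum>k\<in>UNIV. of_bool (k = a) * (\<Sum>l\<in>UNIV. of_bool (l = b) * (cnj (\<i> ^ i) * M (co a b i) k l)))
         + (\<Sum>k\<in>UNIV. of_bool (k = b) * (\<Sum>l\<in>UNIV. of_bool (l = a) * (\<i> ^ i * M (co a b i) k l)))"
        unfolding sum_distrib_left sum.distrib[symmetric] v_def
        by (intro sum.cong refl) (simp add: of_bool_def algebra_simps)
      then show ?thesis unfolding 1 u by simp
    qed
    have diag: "(\<Sum>i<4::nat. M (co a b i) c c) = \<eta> * M \<phi> c c" for c
    proof -
      have "(\<Sum>i<4::nat. M (co a b i) c c) = M (\<lambda>z. \<Sum>i<4::nat. co a b i z) c c"
        by (rule pos_form_sum[OF M, symmetric]) (auto simp: coD)
      also have "(\<lambda>z. \<Sum>i<4::nat. co a b i z) = (\<lambda>z. \<eta> * \<phi> z)"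
        by (rule ext) (simp add: co_def eval_nat_numeral complex_eq_iff field_simps)
      also have "M \<dots> c c = \<eta> * M \<phi> c c" by (rule pos_form_scale[OF M \<phi>(1)])
      finally show ?thesis .
    qed
    have "0 \<le> (\<Sum>i<4::nat. Re (?R i))"
      unfolding exp[symmetric] by (intro sum_nonneg pos_form_pos[OF M coD conn])
    also have "\<dots> = Re (\<Sum>i<4::nat. ?R i)" by simp
    also have "(\<Sum>i<4::nat. ?R i) = (\<Sum>i<4::nat. M (co a b i) a a) + (\<Sum>i<4::nat. M (co a b i) b b)
       + (\<Sum>i<4::nat. cnj (\<i> ^ i) * M (co a b i) a b) + (\<Sum>i<4::nat. \<i> ^ i * M (co a b i) b a)"
      by (simp add: sum.distrib)
    also have "(\<Sum>i<4::nat. M (co a b i) a a) = \<eta> * M \<phi> a a" by (rule diag)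
    also have "(\<Sum>i<4::nat. M (co a b i) b b) = \<eta> * M \<phi> b b" by (rule diag)
    also have "(\<Sum>i<4::nat. cnj (\<i> ^ i) * M (co a b i) a b) = (1/2) * M (\<lambda>z. \<phi> z * E z a b) a b"
    proof -
      have "(\<Sum>i<4::nat. cnj (\<i> ^ i) * M (co a b i) a b) = M (\<lambda>z. \<Sum>i<4::nat. cnj (\<i> ^ i) * co a b i z) a b"
        unfolding pos_form_scale[OF M coD, symmetric]
        by (rule pos_form_sum[OF M, symmetric]) (auto intro: Dtest_scale coD)
      also have "(\<lambda>z. \<Sum>i<4::nat. cnj (\<i> ^ i) * co a b i z) = (\<lambda>z. (1/2) * (\<phi> z * E z a b))"
        by (rule ext) (simp add: co_def eval_nat_numeral complex_eq_iff field_simps)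
      also have "M \<dots> a b = (1/2) * M (\<lambda>z. \<phi> z * E z a b) a b" by (rule pos_form_scale[OF M phE])
      finally show ?thesis .
    qed
    also have "(\<Sum>i<4::nat. \<i> ^ i * M (co a b i) b a) = (1/2) * M (\<lambda>z. \<phi> z * E z b a) b a"
    proof -
      have "(\<Sum>i<4::nat. \<i> ^ i * M (co a b i) b a) = M (\<lambda>z. \<Sum>i<4::nat. \<i> ^ i * co a b i z) b a"
        unfolding pos_form_scale[OF M coD, symmetric]
        by (rule pos_form_sum[OF M, symmetric]) (auto intro: Dtest_scale coD)
      also have "(\<lambda>z. \<Sum>i<4::nat. \<i> ^ i * co a b i z) = (\<lambda>z. (1/2) * (\<phi> z * E z b a))"
        by (rule ext) (simp add: co_def herm[of _ b a] eval_nat_numeral complex_eq_iff field_simps)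
      also have "M \<dots> b a = (1/2) * M (\<lambda>z. \<phi> z * E z b a) b a" by (rule pos_form_scale[OF M phE])
      finally show ?thesis .
    qed
    finally show ?thesis by (simp add: algebra_simps add_divide_distrib)
  qed
  have "0 \<le> (\<Sum>a\<in>UNIV. \<Sum>b\<in>UNIV. Re (\<eta> * (M \<phi> a a + M \<phi> b b)
      + (M (\<lambda>z. \<phi> z * E z a b) a b + M (\<lambda>z. \<phi> z * E z b a) b a) / 2))"
    by (intro sum_nonneg pair)
  also have "\<dots> = Re ((\<Sum>a\<in>(UNIV::'n set). \<Sum>b\<in>(UNIV::'n set). of_real \<eta> * M \<phi> a a) + (\<Sum>a\<in>(UNIV::'n set). \<Sum>b\<in>(UNIV::'n set). of_real \<eta> * M \<phi> b b)
      + ((\<Sum>a\<in>UNIV. \<Sum>b\<in>UNIV. M (\<lambda>z. \<phi> z * E z a b) a b) + (\<Sum>a\<in>UNIV. \<Sum>b\<in>UNIV. M (\<lambda>z. \<phi> z * E z b a) b a)) / 2)"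
    by (simp add: sum.distrib sum_divide_distrib algebra_simps add_divide_distrib)
  also have "(\<Sum>a\<in>UNIV. \<Sum>b\<in>UNIV. M (\<lambda>z. \<phi> z * E z b a) b a) = (\<Sum>a\<in>UNIV. \<Sum>b\<in>UNIV. M (\<lambda>z. \<phi> z * E z a b) a b)"
    by (rule sum.swap)
  also have "(\<Sum>a\<in>(UNIV::'n set). \<Sum>b\<in>(UNIV::'n set). of_real \<eta> * M \<phi> b b)
      = of_real (real CARD('n) * \<eta>) * (\<Sum>a\<in>UNIV. M \<phi> a a)"
    by (simp add: sum_distrib_left mult.assoc)
  also have "(\<Sum>a\<in>(UNIV::'n set). \<Sum>b\<in>(UNIV::'n set). of_real \<eta> * M \<phi> a a)
      = of_real (real CARD('n) * \<eta>) * (\<Sum>a\<in>UNIV. M \<phi> a a)"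
    by (simp add: sum_distrib_left mult.assoc)
  finally show ?thesis by (simp add: algebra_simps)
qed

lemma pos_form_psd:
  fixes M :: "(complex^'n::finite \<Rightarrow> complex) \<Rightarrow> 'n \<Rightarrow> 'n \<Rightarrow> complex"
  assumes M: "pos_form \<Omega> M" and \<phi>: "\<phi> \<in> Dtest \<Omega>" "nonneg_fun \<phi>"
    and V: "open V" "supp \<phi> \<subseteq> V" and H: "\<And>k l. smooth_on V (\<lambda>z. H z k l)"
    and psd: "\<And>z. z \<in> V \<Longrightarrow> psd (H z)"
  shows "0 \<le> Re (\<Sum>k\<in>UNIV. \<Sum>l\<in>UNIV. M (\<lambda>z. \<phi> z * H z k l) k l)"
proof -
  let ?tr = "Re (\<Sum>k\<in>UNIV. M \<phi> k k)"
  have main: "0 \<le> Re (\<Sum>k\<in>UNIV. \<Sum>l\<in>UNIV. M (\<lambda>z. \<phi> z * H z k l) k l) + 2 * real CARD('n) * \<eta> * ?tr"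
    if \<eta>: "0 < \<eta>" for \<eta>
  proof -
    have "\<exists>r. 0 < r \<and> (\<forall>z. dist x z < r \<longrightarrow> z \<in> V \<and> (\<forall>k l. cmod (H z k l - H x k l) \<le> \<eta>))"
      if x: "x \<in> V" for x
    proof -
      have "isCont (\<lambda>z. H z k l) x" for k l
        using smooth_on_continuous[OF H] V(1) x continuous_on_eq_continuous_at by blast
      then have "((\<lambda>z. H z k l) \<longlongrightarrow> H x k l) (nhds x)" for k l
        unfolding isCont_def by (rule tendsto_at_iff_tendsto_nhds[THEN iffD1])
      then have "\<forall>\<^sub>F z in nhds x. dist (H z k l) (H x k l) < \<eta>" for k l
        using \<eta> by (rule tendstoD)
      then have "\<forall>\<^sub>F z in nhds x. \<forall>k\<in>UNIV. \<forall>l\<in>UNIV. dist (H z k l) (H x k l) < \<eta>"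
        by (intro eventually_ball_finite ballI) simp_all
      moreover have "\<forall>\<^sub>F z in nhds x. z \<in> V" using V(1) x by (rule eventually_nhds_in_open)
      ultimately have "\<forall>\<^sub>F z in nhds x. z \<in> V \<and> (\<forall>k l. cmod (H z k l - H x k l) \<le> \<eta>)"
        by eventually_elim (auto simp: dist_norm less_imp_le)
      then show ?thesis unfolding eventually_nhds_metric by (simp add: dist_commute)
    qed
    then have "\<forall>x\<in>supp \<phi>. \<exists>r. 0 < r \<and> (\<forall>z. dist x z < r \<longrightarrow> z \<in> V \<and> (\<forall>k l. cmod (H z k l - H x k l) \<le> \<eta>))"
      using V(2) by (meson subsetD)
    from bchoice[OF this] obtain r where r: "\<And>x. x \<in> supp \<phi> \<Longrightarrow> 0 < r x"
      "\<And>x z k l. x \<in> supp \<phi> \<Longrightarrow> dist x z < r x \<Longrightarrow> cmod (H z k l - H x k l) \<le> \<eta>" by meson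
    obtain X \<phi>s where X: "finite X" "X \<subseteq> supp \<phi>" and \<phi>s: "\<And>x. x \<in> X \<Longrightarrow> \<phi>s x \<in> Dtest \<Omega>"
      "\<And>x. nonneg_fun (\<phi>s x)" "\<And>x z. \<phi>s x z \<noteq> 0 \<Longrightarrow> dist x z < r x \<and> \<phi> z \<noteq> 0"
      "\<And>z. \<phi> z = (\<Sum>x\<in>X. \<phi>s x z)"
      by (rule Dtest_partition[OF \<phi>, of r], erule r(1)) (rule that; assumption)
    have local: "0 \<le> Re (\<Sum>k\<in>UNIV. \<Sum>l\<in>UNIV. M (\<lambda>z. \<phi>s x z * H z k l) k l)
       + 2 * real CARD('n) * \<eta> * Re (\<Sum>k\<in>UNIV. M (\<phi>s x) k k)" if x: "x \<in> X" for x
    proof -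
      have xV: "x \<in> V" and xs: "x \<in> supp \<phi>" using x X(2) V(2) by auto
      \<comment> \<open>Set to 0 off \<open>V\<close>, where \<open>H\<close> need not be Hermitian,
        since the symmetry of the error matrix is required at all points.\<close>
      define E where "E z k l = (if z \<in> V then H z k l - H x k l else 0)" for z k l
      have sV: "supp (\<phi>s x) \<subseteq> V"
      proof (rule subset_trans[OF compact_supp_mono(2) V(2)])
        show "compact (supp \<phi>)" by (rule Cc_supp(1)[OF Dtest_subset_Cc[OF \<phi>(1)]])
        show "\<phi> z = 0 \<Longrightarrow> \<phi>s x z = 0" for z using \<phi>s(3)[of x z] by blast
      qed
      have Es: "smooth_on V (\<lambda>z. E z k l)" for k l
        by (rule smooth_on_cong[OF V(1) _ smooth_on_diff[OF V(1) H[of k l] smooth_on_const[of V "H x k l"]]])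
           (simp add: E_def)
      have ED: "(\<lambda>z. \<phi>s x z * E z k l) \<in> Dtest \<Omega>" for k l by (rule Dtest_mult[OF \<phi>s(1)[OF x] V(1) sV Es])
      have 1: "0 \<le> Re (\<Sum>k\<in>UNIV. \<Sum>l\<in>UNIV. M (\<lambda>z. \<phi>s x z * E z k l) k l)
         + 2 * real CARD('n) * \<eta> * Re (\<Sum>k\<in>UNIV. M (\<phi>s x) k k)"
      proof (rule pos_form_diagonally_dominant[OF M \<phi>s(1)[OF x] \<phi>s(2) V(1) sV Es])
        show "E z l k = cnj (E z k l)" for z k l
          using psd_herm[OF psd[of z], of l k] psd_herm[OF psd[OF xV], of l k] by (simp add: E_def)
        show "cmod (E z k l) \<le> \<eta>" if "\<phi>s x z \<noteq> 0" for z k l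
          using r(2)[OF xs] \<phi>s(3)[OF that] \<eta> by (simp add: E_def)
      qed
      have 2: "0 \<le> Re (\<Sum>k\<in>UNIV. \<Sum>l\<in>UNIV. H x k l * M (\<phi>s x) k l)"
        by (rule psd_trace_nonneg[OF pos_form_pos[OF M \<phi>s(1)[OF x] \<phi>s(2)] psd[OF xV]])
      have "M (\<lambda>z. \<phi>s x z * H z k l) k l = H x k l * M (\<phi>s x) k l + M (\<lambda>z. \<phi>s x z * E z k l) k l" for k l
      proof -
        have "(\<lambda>z. \<phi>s x z * H z k l) = (\<lambda>z. H x k l * \<phi>s x z + \<phi>s x z * E z k l)"
        proof
          fix z show "\<phi>s x z * H z k l = H x k l * \<phi>s x z + \<phi>s x z * E z k l"
            using notin_supp[of z "\<phi>s x"] sV by (cases "z \<in> V") (auto simp: E_def algebra_simps)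
        qed
        then show ?thesis
          using pos_form_add[OF M Dtest_scale[OF \<phi>s(1)[OF x]] ED] pos_form_scale[OF M \<phi>s(1)[OF x]] by simp
      qed
      then show ?thesis using 1 2 by (simp add: sum.distrib)
    qed
    have "M (\<lambda>z. \<phi> z * H z k l) k l = (\<Sum>x\<in>X. M (\<lambda>z. \<phi>s x z * H z k l) k l)" for k l
    proof -
      have "(\<lambda>z. \<phi> z * H z k l) = (\<lambda>z. \<Sum>x\<in>X. \<phi>s x z * H z k l)"
        by (rule ext) (subst \<phi>s(4), simp add: sum_distrib_right)
      moreover have "(\<lambda>z. \<phi>s x z * H z k l) \<in> Dtest \<Omega>" if x: "x \<in> X" for x
      proof (rule Dtest_mult[OF \<phi>s(1)[OF x] V(1) _ H])
        show "supp (\<phi>s x) \<subseteq> V"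
        proof (rule subset_trans[OF compact_supp_mono(2) V(2)])
          show "compact (supp \<phi>)" by (rule Cc_supp(1)[OF Dtest_subset_Cc[OF \<phi>(1)]])
          show "\<phi> z = 0 \<Longrightarrow> \<phi>s x z = 0" for z using \<phi>s(3)[of x z] by blast
        qed
      qed
      ultimately show ?thesis using pos_form_sum[OF M X(1)] by simp
    qed
    then have e1: "(\<Sum>k\<in>UNIV. \<Sum>l\<in>UNIV. M (\<lambda>z. \<phi> z * H z k l) k l)
       = (\<Sum>x\<in>X. \<Sum>k\<in>UNIV. \<Sum>l\<in>UNIV. M (\<lambda>z. \<phi>s x z * H z k l) k l)"
      by (simp add: sum.swap[of _ X])
    have "M \<phi> k k = (\<Sum>x\<in>X. M (\<phi>s x) k k)" for k
    proof -
      have "\<phi> = (\<lambda>z. \<Sum>x\<in>X. \<phi>s x z)" by (rule ext) (rule \<phi>s(4))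
      then show ?thesis using pos_form_sum[OF M X(1) \<phi>s(1)] by simp
    qed
    then have e2: "(\<Sum>k\<in>UNIV. M \<phi> k k) = (\<Sum>x\<in>X. \<Sum>k\<in>UNIV. M (\<phi>s x) k k)"
      by (simp add: sum.swap[of _ X])
    have "0 \<le> (\<Sum>x\<in>X. Re (\<Sum>k\<in>UNIV. \<Sum>l\<in>UNIV. M (\<lambda>z. \<phi>s x z * H z k l) k l)
       + 2 * real CARD('n) * \<eta> * Re (\<Sum>k\<in>UNIV. M (\<phi>s x) k k))"
      by (rule sum_nonneg) (rule local)
    then show ?thesis unfolding e1 e2 by (simp add: sum.distrib sum_distrib_left)
  qed
  show ?thesis
  proof (rule ccontr)
    let ?a = "Re (\<Sum>k\<in>UNIV. \<Sum>l\<in>UNIV. M (\<lambda>z. \<phi> z * H z k l) k l)"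
    assume "\<not> 0 \<le> ?a"
    then have a: "?a < 0" by linarith
    define c where "c = 2 * real CARD('n) * (\<bar>?tr\<bar> + 1)"
    have c: "c > 0" "2 * real CARD('n) * ?tr \<le> c" by (auto simp: c_def intro!: mult_left_mono)
    \<comment> \<open>Here \<eta> = - a / (2 c), so small that the error term is at most half of -
      a.\<close>
    have "0 \<le> ?a + 2 * real CARD('n) * (- ?a / (2 * c)) * ?tr"
      by (rule main) (use a c in \<open>simp add: divide_neg_pos\<close>)
    also have "2 * real CARD('n) * (- ?a / (2 * c)) * ?tr = (2 * real CARD('n) * ?tr) * (- ?a / (2 * c))"
      by simp
    also have "\<dots> \<le> c * (- ?a / (2 * c))"
      by (intro mult_right_mono c(2) divide_nonneg_pos) (use a c(1) in linarith)+
    also have "\<dots> = - ?a / 2" using c by simp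
    finally show False using a by simp
  qed
qed

section \<open>The complex Hessian of a smooth plurisubharmonic function\<close>

text \<open>\<open>circle_mean\<close> subtracts the integral of the negative part from that of the
  positive part in the extended reals. For continuous \<open>u\<close> both are finite and the
  difference is an ordinary integral, which is compared with a majorant \<open>f\<close> whose
  primitive \<open>F\<close> is known explicitly.\<close>

lemma circle_mean_le:
  fixes u :: "complex^'n::finite \<Rightarrow> real"
  assumes u: "continuous_on {0..2*pi} (\<lambda>\<theta>. u (a + cis \<theta> *s b))"
    and f: "continuous_on {0..2*pi} f" and F: "\<And>\<theta>. (F has_real_derivative f \<theta>) (at \<theta>)"
    and le: "\<And>\<theta>. u (a + cis \<theta> *s b) \<le> f \<theta>"
  shows "circle_mean (\<lambda>z. ereal (u z)) a b \<le> ereal ((F (2*pi) - F 0) / (2*pi))"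
proof -
  let ?I = "{0..2*pi} :: real set"
  define h where "h \<theta> = indicator ?I \<theta> *\<^sub>R u (a + cis \<theta> *s b)" for \<theta> :: real
  have ih: "integrable lborel h"
    unfolding h_def[abs_def] by (rule borel_integrable_compact[OF _ u]) simp
  have eqs: "e2ennreal (max 0 (ereal (u (a + cis \<theta> *s b)))) * indicator ?I \<theta> = ennreal (h \<theta>)"
    "e2ennreal (max 0 (- ereal (u (a + cis \<theta> *s b)))) * indicator ?I \<theta> = ennreal (- h \<theta>)" for \<theta>
  proof -
    have m: "e2ennreal (max 0 (ereal x)) = ennreal x" for x
      by (cases "0 \<le> x") (auto simp: max_def ennreal_neg e2ennreal_neg)
    show "e2ennreal (max 0 (ereal (u (a + cis \<theta> *s b)))) * indicator ?I \<theta> = ennreal (h \<theta>)"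
      "e2ennreal (max 0 (- ereal (u (a + cis \<theta> *s b)))) * indicator ?I \<theta> = ennreal (- h \<theta>)"
      unfolding m uminus_ereal.simps by (auto simp: h_def indicator_def)
  qed
  obtain r q where rq: "0 \<le> r" "0 \<le> q" "(\<integral>\<^sup>+ \<theta>. ennreal (h \<theta>) \<partial>lborel) = ennreal r"
    "(\<integral>\<^sup>+ \<theta>. ennreal (- h \<theta>) \<partial>lborel) = ennreal q" "integral\<^sup>L lborel h = r - q"
    using ih by (elim integrableE) simp
  have cm: "circle_mean (\<lambda>z. ereal (u z)) a b = ereal (integral\<^sup>L lborel h / (2*pi))"
    unfolding circle_mean_def eqs rq(3,4) rq(5) using rq(1,2) by (simp add: ennreal_neg)
  have "integral\<^sup>L lborel h \<le> integral\<^sup>L lborel (\<lambda>\<theta>. indicator ?I \<theta> *\<^sub>R f \<theta>)"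
    by (rule integral_mono[OF ih borel_integrable_compact[OF _ f]])
       (auto simp: h_def intro!: mult_left_mono le)
  also have "\<dots> = F (2*pi) - F 0"
    by (rule integral_FTC_atLeastAtMost[OF _ _ f])
       (auto simp: F has_real_derivative_iff_has_vector_derivative[symmetric] has_field_derivative_at_within)
  finally show ?thesis unfolding cm by (simp add: divide_right_mono)
qed

lemma dirderiv_expand:
  fixes f :: "complex^'n::finite \<Rightarrow> 'b::real_normed_vector"
  assumes "f differentiable (at x)"
  shows "dirderiv f w x = (\<Sum>k\<in>UNIV. Re (w $ k) *\<^sub>R dirderiv f (axis k 1) x + Im (w $ k) *\<^sub>R dirderiv f (axis k \<i>) x)"
proof -
  have l: "linear (\<lambda>v. dirderiv f v x)"
    using has_derivative_dirderiv[OF assms] has_derivative_linear by blast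
  have "w = (\<Sum>k\<in>UNIV. Re (w $ k) *\<^sub>R axis k 1 + Im (w $ k) *\<^sub>R axis k \<i>)"
    by (simp add: vec_eq_iff axis_def if_distrib sum.delta sum.distrib complex_eq_iff cong: if_cong)
  then have "dirderiv f w x = dirderiv f (\<Sum>k\<in>UNIV. Re (w $ k) *\<^sub>R axis k 1 + Im (w $ k) *\<^sub>R axis k \<i>) x"
    by simp
  also have "\<dots> = (\<Sum>k\<in>UNIV. Re (w $ k) *\<^sub>R dirderiv f (axis k 1) x + Im (w $ k) *\<^sub>R dirderiv f (axis k \<i>) x)"
    unfolding linear_sum[OF l] linear_add[OF l] linear_scale[OF l] ..
  finally show ?thesis .
qed

lemma dirderiv_wirt:
  fixes f :: "complex^'n::finite \<Rightarrow> complex"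
  assumes "f differentiable (at x)"
  shows "dirderiv f w x = (\<Sum>k\<in>UNIV. w $ k * wirt (- \<i>) k f x + cnj (w $ k) * wirt \<i> k f x)"
proof -
  have e: "Re c *\<^sub>R A + Im c *\<^sub>R B = c * ((A + (- \<i>) * B) / 2) + cnj c * ((A + \<i> * B) / 2)" for c A B :: complex
  proof -
    have "c * ((A + (- \<i>) * B) / 2) + cnj c * ((A + \<i> * B) / 2) = (c + cnj c) * A / 2 - \<i> * (c - cnj c) * B / 2"
      by (simp add: algebra_simps add_divide_distrib diff_divide_distrib)
    also have "\<dots> = Re c *\<^sub>R A + Im c *\<^sub>R B"
    proof -
      have "\<i> * (x * (\<i> * B)) = - (x * B)" for x by (simp add: complex_eq_iff)
      then show ?thesis unfolding complex_add_cnj complex_diff_cnj by (simp add: scaleR_conv_of_real)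
    qed
    finally show ?thesis ..
  qed
  show ?thesis unfolding wirt_def by (rule trans[OF dirderiv_expand[OF assms] sum.cong[OF refl e]])
qed

lemma smooth_on_dirderiv':
  fixes f :: "complex^'n::finite \<Rightarrow> complex"
  assumes "open U" "smooth_on U f"
  shows "smooth_on U (dirderiv f w)"
proof (rule smooth_on_cong[OF assms(1)])
  show "smooth_on U (\<lambda>x. \<Sum>k\<in>UNIV. w $ k * wirt (- \<i>) k f x + cnj (w $ k) * wirt \<i> k f x)"
    by (intro smooth_on_sum smooth_on_add smooth_on_mult smooth_on_const smooth_on_wirt assms)
  show "(\<Sum>k\<in>UNIV. w $ k * wirt (- \<i>) k f x + cnj (w $ k) * wirt \<i> k f x) = dirderiv f w x" if "x \<in> U" for x
    by (rule dirderiv_wirt[OF smooth_on_differentiable[OF assms(2) that], symmetric])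
qed

text \<open>The pure second derivatives in z and in its conjugate are kept apart from the Levi form:
  when w is rotated by exp(\<i> \<theta>), they pick up exp(2 \<i> \<theta>) and its conjugate, and
  so have mean zero over a circle. The two mixed sums agree by commutation, hence the factor
  2.\<close>

lemma dirderiv2_wirt:
  fixes f :: "complex^'n::finite \<Rightarrow> complex"
  assumes U: "open U" "x \<in> U" and f: "smooth_on U f"
  shows "dirderiv (dirderiv f w) w x
    = (\<Sum>k\<in>UNIV. \<Sum>l\<in>UNIV. w $ k * w $ l * wirt (- \<i>) k (wirt (- \<i>) l f) x)
    + (\<Sum>k\<in>UNIV. \<Sum>l\<in>UNIV. cnj (w $ k) * cnj (w $ l) * wirt \<i> k (wirt \<i> l f) x)
    + 2 * (\<Sum>k\<in>UNIV. \<Sum>l\<in>UNIV. w $ k * cnj (w $ l) * wirt (- \<i>) k (wirt \<i> l f) x)"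
proof -
  note sw = smooth_on_wirt[OF U(1) f]
  have sd: "smooth_on U (\<lambda>x. w $ l * wirt (- \<i>) l f x + cnj (w $ l) * wirt \<i> l f x)" for l
    by (intro smooth_on_add smooth_on_mult smooth_on_const smooth_on_wirt U f)
  have W: "wirt c k (dirderiv f w) x
     = (\<Sum>l\<in>UNIV. w $ l * wirt c k (wirt (- \<i>) l f) x + cnj (w $ l) * wirt c k (wirt \<i> l f) x)" for c k
  proof -
    have *: "wirt c k (\<lambda>x. \<Sum>l\<in>I. w $ l * wirt (- \<i>) l f x + cnj (w $ l) * wirt \<i> l f x) x
       = (\<Sum>l\<in>I. w $ l * wirt c k (wirt (- \<i>) l f) x + cnj (w $ l) * wirt c k (wirt \<i> l f) x)"
      if "finite I" for I
      using that
    proof (induction I)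
      case (insert i I)
      have d: "wirt c i f differentiable (at x)" for c by (rule smooth_on_differentiable[OF sw U(2)])
      have dI: "(\<lambda>x. \<Sum>l\<in>I. w $ l * wirt (- \<i>) l f x + cnj (w $ l) * wirt \<i> l f x) differentiable (at x)"
        by (rule smooth_on_differentiable[OF smooth_on_sum[OF U(1) sd] U(2)])
      have di: "(\<lambda>x. w $ i * wirt (- \<i>) i f x + cnj (w $ i) * wirt \<i> i f x) differentiable (at x)"
        by (rule smooth_on_differentiable[OF sd U(2)])
      have ei: "wirt c k (\<lambda>x. w $ i * wirt (- \<i>) i f x + cnj (w $ i) * wirt \<i> i f x) x
         = w $ i * wirt c k (wirt (- \<i>) i f) x + cnj (w $ i) * wirt c k (wirt \<i> i f) x"
        by (subst wirt_add) (auto intro!: differentiable_mult d simp: wirt_cmult[OF d])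
      show ?case unfolding sum.insert[OF insert.hyps] wirt_add[OF di dI] ei insert.IH ..
    qed simp
    have "wirt c k (dirderiv f w) x
       = wirt c k (\<lambda>x. \<Sum>l\<in>UNIV. w $ l * wirt (- \<i>) l f x + cnj (w $ l) * wirt \<i> l f x) x"
      by (rule wirt_cong[OF U dirderiv_wirt[OF smooth_on_differentiable[OF f]]])
    also note *[OF finite]
    finally show ?thesis .
  qed
  have "dirderiv (dirderiv f w) w x = (\<Sum>k\<in>UNIV. \<Sum>l\<in>UNIV.
      w $ k * w $ l * wirt (- \<i>) k (wirt (- \<i>) l f) x + w $ k * cnj (w $ l) * wirt (- \<i>) k (wirt \<i> l f) x
      + (cnj (w $ k) * w $ l * wirt \<i> k (wirt (- \<i>) l f) x + cnj (w $ k) * cnj (w $ l) * wirt \<i> k (wirt \<i> l f) x))"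
    unfolding dirderiv_wirt[OF smooth_on_differentiable[OF smooth_on_dirderiv'[OF U(1) f] U(2)]] W
      sum_distrib_left sum.distrib[symmetric]
    by (simp add: algebra_simps)
  moreover have "(\<Sum>k\<in>UNIV. \<Sum>l\<in>UNIV. cnj (w $ k) * w $ l * wirt \<i> k (wirt (- \<i>) l f) x)
     = (\<Sum>k\<in>UNIV. \<Sum>l\<in>UNIV. w $ k * cnj (w $ l) * wirt (- \<i>) k (wirt \<i> l f) x)"
    by (subst sum.swap) (simp add: wirt_commute[OF U f, of \<i>] mult_ac)
  ultimately show ?thesis by (simp add: sum.distrib)
qed

lemma norm_cis_smult: "norm (cis \<theta> *s (b::complex^'n::finite)) = norm b"
  by (simp add: norm_vec_def norm_mult)

text \<open>Taylor's formula of order two is inserted into the sub-mean value inequality on a small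
  circle. The first order terms and the pure second derivatives average out; r^2 times the Levi form
  remains, with an error that is an arbitrarily small multiple of r^2.\<close>

lemma psh_smooth_levi:
  fixes G :: "complex^'n::finite \<Rightarrow> real"
  assumes \<Omega>: "open \<Omega>" "a \<in> \<Omega>" and G: "smooth_on \<Omega> G" and psh: "psh \<Omega> (\<lambda>z. ereal (G z))"
  shows "psd (\<lambda>k l. wirt (- \<i>) k (wirt \<i> l (\<lambda>z. complex_of_real (G z))) a)"
  unfolding psd_def
proof (intro conjI allI)
  let ?g = "\<lambda>z. complex_of_real (G z)"
  have g: "smooth_on \<Omega> ?g" by (rule smooth_on_of_real[OF \<Omega>(1) G])
  show "wirt (- \<i>) l (wirt \<i> k ?g) a = cnj (wirt (- \<i>) k (wirt \<i> l ?g) a)" for k l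
    unfolding cnj_wirt2_of_real[OF \<Omega> G] by simp
  fix v :: "'n \<Rightarrow> complex"
  define b :: "complex^'n" where "b = (\<chi> k. v k)"
  define P where "P y = (\<Sum>k\<in>UNIV. \<Sum>l\<in>UNIV. b $ k * b $ l * wirt (- \<i>) k (wirt (- \<i>) l ?g) y)" for y
  define Q where "Q y = (\<Sum>k\<in>UNIV. \<Sum>l\<in>UNIV. cnj (b $ k) * cnj (b $ l) * wirt \<i> k (wirt \<i> l ?g) y)" for y
  define L where "L y = (\<Sum>k\<in>UNIV. \<Sum>l\<in>UNIV. b $ k * cnj (b $ l) * wirt (- \<i>) k (wirt \<i> l ?g) y)" for y
  define d where "d = (\<Sum>k\<in>UNIV. b $ k * wirt (- \<i>) k ?g a)"
  define d' where "d' = (\<Sum>k\<in>UNIV. cnj (b $ k) * wirt \<i> k ?g a)"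
  have real1: "complex_of_real (dirderiv G w y) = dirderiv ?g w y" if "y \<in> \<Omega>" for w y
    using dirderiv_bounded_linear[OF bounded_linear_of_real smooth_on_differentiable[OF G that]] by metis
  have sG: "smooth_on \<Omega> (dirderiv G w)" for w
  proof (rule smooth_on_cong[OF \<Omega>(1)])
    show "smooth_on \<Omega> (\<lambda>x. Re (dirderiv ?g w x))"
      by (rule smooth_on_bounded_linear[OF bounded_linear_Re \<Omega>(1) smooth_on_dirderiv'[OF \<Omega>(1) g]])
    show "Re (dirderiv ?g w x) = dirderiv G w x" if "x \<in> \<Omega>" for x
      using real1[OF that, of w] by (metis Re_complex_of_real)
  qed
  have real2: "complex_of_real (dirderiv (dirderiv G w) w y) = dirderiv (dirderiv ?g w) w y" if "y \<in> \<Omega>" for w y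
  proof -
    have "complex_of_real (dirderiv (dirderiv G w) w y) = dirderiv (\<lambda>x. complex_of_real (dirderiv G w x)) w y"
      by (rule dirderiv_bounded_linear[OF bounded_linear_of_real smooth_on_differentiable[OF sG that], symmetric])
    also have "\<dots> = dirderiv (dirderiv ?g w) w y" by (rule dirderiv_cong[OF \<Omega>(1) that real1])
    finally show ?thesis .
  qed
  have D1: "dirderiv G (cis \<theta> *s b) a = Re (cis \<theta> * d + cnj (cis \<theta>) * d')" for \<theta>
  proof -
    have "complex_of_real (dirderiv G (cis \<theta> *s b) a) = cis \<theta> * d + cnj (cis \<theta>) * d'"
      unfolding real1[OF \<Omega>(2)] dirderiv_wirt[OF smooth_on_differentiable[OF g \<Omega>(2)]] d_def d'_def
      by (simp add: sum.distrib sum_distrib_left mult.assoc)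
    then show ?thesis by (metis Re_complex_of_real)
  qed
  have D2: "dirderiv (dirderiv G (cis \<theta> *s b)) (cis \<theta> *s b) y
      = Re (cis \<theta> * cis \<theta> * P y + cnj (cis \<theta>) * cnj (cis \<theta>) * Q y + 2 * L y)" if "y \<in> \<Omega>" for \<theta> y
  proof -
    have u: "cis \<theta> * (cnj (cis \<theta>) * x) = x" for x 
      using complex_norm_square[of "cis \<theta>"] by (simp flip: mult.assoc)
    have "complex_of_real (dirderiv (dirderiv G (cis \<theta> *s b)) (cis \<theta> *s b) y)
       = cis \<theta> * cis \<theta> * P y + cnj (cis \<theta>) * cnj (cis \<theta>) * Q y + 2 * (cis \<theta> * (cnj (cis \<theta>) * L y))"
      unfolding real2[OF that] dirderiv2_wirt[OF \<Omega>(1) that g] P_def Q_def L_def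
      by (simp add: sum_distrib_left mult_ac)
    then show ?thesis unfolding u by (metis Re_complex_of_real)
  qed
  have cont: "isCont P a" "isCont Q a" "isCont L a"
  proof -
    have "continuous_on \<Omega> P" "continuous_on \<Omega> Q" "continuous_on \<Omega> L"
      unfolding P_def[abs_def] Q_def[abs_def] L_def[abs_def]
      by (intro smooth_on_continuous smooth_on_sum smooth_on_mult smooth_on_const smooth_on_wirt \<Omega> g)+
    then show "isCont P a" "isCont Q a" "isCont L a"
      using \<Omega> continuous_on_eq_continuous_at by blast+
  qed
  \<comment> \<open>The tolerance for each of \<open>P\<close>, \<open>Q\<close> and
    \<open>L\<close> is \<eta>/4; as \<open>L\<close> enters with the factor 2, they add up to
    \<eta>.\<close>
  have key: "0 \<le> 2 * Re (L a) + \<eta>" if \<eta>: "0 < \<eta>" for \<eta>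
  proof -
    have "\<forall>\<^sub>F y in nhds a. dist (P y) (P a) < \<eta>/4" "\<forall>\<^sub>F y in nhds a. dist (Q y) (Q a) < \<eta>/4"
      "\<forall>\<^sub>F y in nhds a. dist (L y) (L a) < \<eta>/4"
      using cont[unfolded isCont_def, THEN tendsto_at_iff_tendsto_nhds[THEN iffD1], THEN tendstoD, of "\<eta>/4"] \<eta>
      by auto
    moreover have "\<forall>\<^sub>F y in nhds a. y \<in> \<Omega>" by (rule eventually_nhds_in_open[OF \<Omega>])
    ultimately have "\<forall>\<^sub>F y in nhds a. y \<in> \<Omega> \<and> dist (P y) (P a) < \<eta>/4 \<and> dist (Q y) (Q a) < \<eta>/4 \<and> dist (L y) (L a) < \<eta>/4"
      by eventually_elim simp
    then obtain e where e: "0 < e" "\<And>y. dist y a < e \<Longrightarrow>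
        y \<in> \<Omega> \<and> dist (P y) (P a) < \<eta>/4 \<and> dist (Q y) (Q a) < \<eta>/4 \<and> dist (L y) (L a) < \<eta>/4"
      unfolding eventually_nhds_metric by blast
    \<comment> \<open>Makes r |b| < e, so that the disc stays where the estimates hold; the summand
      1 covers b = 0.\<close>
    define r where "r = (e / 2) / (norm b + 1)"
    have nb: "0 < norm b + 1" using norm_ge_zero[of b] by linarith
    have r: "0 < r" "r * norm b < e"
    proof -
      show "0 < r" using e nb by (simp add: r_def)
      have "r * norm b \<le> r * (norm b + 1)" using \<open>0 < r\<close> by simp
      also have "\<dots> = e / 2" using nonzero_eq_divide_eq[of "norm b + 1" r "e / 2"] nb r_def by simp
      finally show "r * norm b < e" using e by simp
    qed
    have near: "dist (a + t *\<^sub>R (cis \<theta> *s b)) a < e" if "0 \<le> t" "t \<le> r" for t \<theta>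
    proof -
      have "dist (a + t *\<^sub>R (cis \<theta> *s b)) a = t * norm b"
        using that by (simp add: dist_norm norm_cis_smult)
      also have "\<dots> \<le> r * norm b" using that by (intro mult_right_mono) auto
      finally show ?thesis using r by simp
    qed
    define f where "f \<theta> = G a + r * Re (cis \<theta> * d + cnj (cis \<theta>) * d')
       + r\<^sup>2 / 2 * (Re (cis \<theta> * cis \<theta> * P a + cnj (cis \<theta>) * cnj (cis \<theta>) * Q a + 2 * L a) + \<eta>)" for \<theta>
    have smul: "cis \<theta> *s (r *\<^sub>R b) = r *\<^sub>R (cis \<theta> *s b)" for \<theta> by (simp add: vec_eq_iff)
    have bound: "G (a + cis \<theta> *s (r *\<^sub>R b)) \<le> f \<theta>" for \<theta>
    proof -
      let ?w = "cis \<theta> *s b"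
      \<comment> \<open>The derivatives of order 0, 1 and 2 of G along the ray in direction w, in
        the shape that \<open>Maclaurin\<close> expects.\<close>
      define diff where "diff m = (if m = 0 then (\<lambda>t. G (a + t *\<^sub>R ?w)) else if m = 1 then (\<lambda>t. dirderiv G ?w (a + t *\<^sub>R ?w))
         else (\<lambda>t. dirderiv (dirderiv G ?w) ?w (a + t *\<^sub>R ?w)))" for m :: nat
      have "\<forall>m t. m < 2 \<and> 0 \<le> t \<and> t \<le> r \<longrightarrow> DERIV (diff m) t :> diff (Suc m) t"
      proof (intro allI impI)
        fix m :: nat and t assume mt: "m < 2 \<and> 0 \<le> t \<and> t \<le> r"
        then have in\<Omega>: "a + t *\<^sub>R ?w \<in> \<Omega>" using e(2) near by simp
        consider "m = 0" | "m = 1" using mt by linarith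
        then show "DERIV (diff m) t :> diff (Suc m) t"
          unfolding has_real_derivative_iff_has_vector_derivative
          by cases (auto simp: diff_def intro!: has_vector_derivative_dirderiv
              smooth_on_differentiable[OF G in\<Omega>] smooth_on_differentiable[OF sG in\<Omega>])
      qed
      then obtain t where t: "0 < t" "t < r" "diff 0 r = (\<Sum>m<2. (diff m 0 / fact m) * r ^ m) + (diff 2 t / fact 2) * r ^ 2"
        using Maclaurin[OF r(1), of 2 diff "diff 0"] by auto
      define y where "y = a + t *\<^sub>R ?w"
      have y: "y \<in> \<Omega>" "dist (P y) (P a) < \<eta>/4" "dist (Q y) (Q a) < \<eta>/4" "dist (L y) (L a) < \<eta>/4"
        using e(2)[OF near[of t \<theta>]] t unfolding y_def by auto
      have "G (a + r *\<^sub>R ?w) = G a + r * dirderiv G ?w a + r\<^sup>2 / 2 * dirderiv (dirderiv G ?w) ?w y"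
        using t(3) by (simp add: diff_def y_def eval_nat_numeral)
      also have "\<dots> \<le> f \<theta>"
      proof -
        have "Re (cis \<theta> * cis \<theta> * (P y - P a)) \<le> \<eta>/4" "Re (cnj (cis \<theta>) * cnj (cis \<theta>) * (Q y - Q a)) \<le> \<eta>/4" "Re (L y - L a) \<le> \<eta>/4"
          using y(2-4) complex_Re_le_cmod[of "cis \<theta> * cis \<theta> * (P y - P a)"] complex_Re_le_cmod[of "cnj (cis \<theta>) * cnj (cis \<theta>) * (Q y - Q a)"]
            complex_Re_le_cmod[of "L y - L a"] by (auto simp: dist_norm norm_mult)
        then have "Re (cis \<theta> * cis \<theta> * P y + cnj (cis \<theta>) * cnj (cis \<theta>) * Q y + 2 * L y)
           \<le> Re (cis \<theta> * cis \<theta> * P a + cnj (cis \<theta>) * cnj (cis \<theta>) * Q a + 2 * L a) + \<eta>"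
          by (simp add: right_diff_distrib)
        from mult_left_mono[OF this, of "r\<^sup>2/2"] show ?thesis
          unfolding f_def D1 D2[OF y(1)] by simp
      qed
      finally show ?thesis unfolding smul .
    qed
    have cf: "f \<theta> = (G a + r\<^sup>2/2 * (2 * Re (L a) + \<eta>)) + r * (Re d + Re d') * cos \<theta> + r * (Im d' - Im d) * sin \<theta>
       + r\<^sup>2/2 * (Re (P a) + Re (Q a)) * cos (2 * \<theta>) + r\<^sup>2/2 * (Im (Q a) - Im (P a)) * sin (2 * \<theta>)" for \<theta>
    proof -
      have "cis \<theta> * cis \<theta> = cis (2 * \<theta>)" "cnj (cis \<theta>) * cnj (cis \<theta>) = cnj (cis (2 * \<theta>))"
        by (simp_all add: cis_cnj cis_mult)
      then show ?thesis unfolding f_def by (simp add: algebra_simps add_divide_distrib diff_divide_distrib)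
    qed
    \<comment> \<open>A primitive of \<open>f\<close>. Its trigonometric terms have period 2 pi, so
      over the whole circle only the constant term of \<open>f\<close> contributes.\<close>
    define F where "F \<theta> = (G a + r\<^sup>2/2 * (2 * Re (L a) + \<eta>)) * \<theta> + r * (Re d + Re d') * sin \<theta> - r * (Im d' - Im d) * cos \<theta>
       + r\<^sup>2/2 * (Re (P a) + Re (Q a)) * (sin (2 * \<theta>) / 2) - r\<^sup>2/2 * (Im (Q a) - Im (P a)) * (cos (2 * \<theta>) / 2)" for \<theta>
    have dF: "(F has_real_derivative f \<theta>) (at \<theta>)" for \<theta>
      unfolding F_def[abs_def] cf by (auto intro!: derivative_eq_intros simp: mult_ac)
    have inO: "a + \<zeta> *s (r *\<^sub>R b) \<in> \<Omega>" if "norm \<zeta> \<le> 1" for \<zeta> :: complex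
    proof -
      have "dist (a + \<zeta> *s (r *\<^sub>R b)) a = norm \<zeta> * (r * norm b)"
        using r by (simp add: dist_norm norm_vec_def norm_mult L2_set_right_distrib mult.left_commute)
      also have "\<dots> \<le> 1 * (r * norm b)" using that r by (intro mult_right_mono) auto
      finally show ?thesis using e(2) r by simp
    qed
    have "ereal (G a) \<le> circle_mean (\<lambda>z. ereal (G z)) a (r *\<^sub>R b)"
      using psh inO unfolding psh_def by blast
    also have "\<dots> \<le> ereal ((F (2*pi) - F 0) / (2*pi))"
    proof (rule circle_mean_le[OF _ _ dF bound])
      have "continuous_on {0..2*pi} (\<lambda>\<theta>. a + cis \<theta> *s (r *\<^sub>R b))"
        unfolding smul vector_scalar_mult_def[abs_def] by (intro continuous_intros)
      then show "continuous_on {0..2*pi} (\<lambda>\<theta>. G (a + cis \<theta> *s (r *\<^sub>R b)))"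
        by (rule continuous_on_compose2[OF smooth_on_continuous[OF G]]) (auto intro!: inO)
      show "continuous_on {0..2*pi} f" unfolding cf[abs_def] by (intro continuous_intros)
    qed
    also have "(F (2*pi) - F 0) / (2*pi) = G a + r\<^sup>2/2 * (2 * Re (L a) + \<eta>)"
      by (simp add: F_def)
    finally have "0 \<le> r\<^sup>2/2 * (2 * Re (L a) + \<eta>)" by simp
    then show ?thesis using r(1) by (simp add: zero_le_mult_iff)
  qed
  \<comment> \<open>If Re (L a) were negative, \<eta> = - Re (L a) would be admissible and give 0
    \<le> Re (L a).\<close>
  have "0 \<le> Re (L a)" using key[of "- Re (L a)"] by fastforce
  then show "0 \<le> Re (\<Sum>k\<in>UNIV. \<Sum>l\<in>UNIV. wirt (- \<i>) k (wirt \<i> l ?g) a * v k * cnj (v l))"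
    by (simp add: L_def b_def mult_ac)
qed

section \<open>Monotone limits of currents\<close>

text \<open>Division by a + b reduces this to x \<le> x^q on the unit interval. It bounds the effect
  of a shift by \<delta> on a q-th power by \<delta>^q, which is the error that Dini's argument has
  to tolerate.\<close>

lemma powr_subadditive:
  fixes a b q :: real
  assumes "0 \<le> a" "0 \<le> b" "0 < q" "q \<le> 1"
  shows "(a + b) powr q \<le> a powr q + b powr q"
proof (cases "a = 0 \<or> b = 0")
  case False
  then have ab: "0 < a" "0 < b" using assms by auto
  have 1: "x / (a + b) \<le> (x / (a + b)) powr q" if "0 < x" "x \<le> a + b" for x
    using powr_mono'[of q 1 "x / (a + b)"] that ab assms by simp
  have "1 = a / (a + b) + b / (a + b)" using ab by (simp add: add_divide_distrib[symmetric])
  also have "\<dots> \<le> (a / (a + b)) powr q + (b / (a + b)) powr q"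
    using ab by (intro add_mono 1) auto
  also have "\<dots> = (a powr q + b powr q) / (a + b) powr q"
    using ab by (simp add: powr_divide add_divide_distrib)
  finally show ?thesis using ab by (simp add: le_divide_eq)
qed (use assms in auto)

text \<open>Models the values Re (T \<phi> as as) of a positive current on equal argument lists, as
  a functional of \<phi>. The domain consists of continuous functions, because the factors max(g_j,
  0)^q are not smooth.\<close>

definition pos_functional :: "(complex^'n::finite) set \<Rightarrow> ((complex^'n \<Rightarrow> complex) \<Rightarrow> real) \<Rightarrow> bool" where
  "pos_functional \<Omega> \<Lambda> \<longleftrightarrow>
     (\<forall>\<phi>\<in>Cc \<Omega>. \<forall>\<psi>\<in>Cc \<Omega>. \<forall>c. \<Lambda> (\<lambda>z. complex_of_real c * \<phi> z + \<psi> z) = c * \<Lambda> \<phi> + \<Lambda> \<psi>) \<and>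
     (\<forall>\<phi>\<in>Cc \<Omega>. nonneg_fun \<phi> \<longrightarrow> 0 \<le> \<Lambda> \<phi>)"

lemma Cc_times:
  assumes "open \<Omega>" "\<phi> \<in> Cc \<Omega>" "continuous_on \<Omega> u"
  shows "(\<lambda>z. complex_of_real (u z) * \<phi> z) \<in> Cc \<Omega>"
proof -
  have "(\<lambda>z. \<phi> z * complex_of_real (u z)) \<in> Cc \<Omega>"
    by (rule Cc_mult[OF assms(2,1) Cc_supp(2)[OF assms(2)]]) (intro continuous_intros assms)
  then show ?thesis by (simp add: mult.commute)
qed

lemma Cc_scale: "\<phi> \<in> Cc \<Omega> \<Longrightarrow> (\<lambda>z. c * \<phi> z) \<in> Cc \<Omega>"
  using Cc_mult[of \<phi> \<Omega> UNIV "\<lambda>_. c"] by (simp add: mult.commute)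

lemma pos_functional_linear:
  assumes "pos_functional \<Omega> \<Lambda>" "\<phi> \<in> Cc \<Omega>" "\<psi> \<in> Cc \<Omega>"
  shows "\<Lambda> (\<lambda>z. complex_of_real c * \<phi> z + \<psi> z) = c * \<Lambda> \<phi> + \<Lambda> \<psi>"
  using assms by (simp add: pos_functional_def)

lemma pos_functional_mono:
  assumes \<Lambda>: "pos_functional \<Omega> \<Lambda>" and \<Omega>: "open \<Omega>" and \<phi>: "\<phi> \<in> Cc \<Omega>" "nonneg_fun \<phi>"
    and u: "continuous_on \<Omega> u" and v: "continuous_on \<Omega> v"
    and le: "\<And>z. \<phi> z \<noteq> 0 \<Longrightarrow> u z \<le> v z + c"
  shows "\<Lambda> (\<lambda>z. complex_of_real (u z) * \<phi> z) \<le> \<Lambda> (\<lambda>z. complex_of_real (v z) * \<phi> z) + c * \<Lambda> \<phi>"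
proof -
  let ?w = "\<lambda>z. v z + c - u z"
  have w: "(\<lambda>z. complex_of_real (?w z) * \<phi> z) \<in> Cc \<Omega>"
    by (rule Cc_times[OF \<Omega> \<phi>(1)]) (intro continuous_intros u v)
  have "nonneg_fun (\<lambda>z. complex_of_real (?w z) * \<phi> z)"
    unfolding nonneg_fun_def
  proof
    fix z
    have "\<phi> z = 0 \<or> 0 \<le> ?w z" using le[of z] by auto
    then show "Im (complex_of_real (?w z) * \<phi> z) = 0 \<and> 0 \<le> Re (complex_of_real (?w z) * \<phi> z)"
      using \<phi>(2) by (auto simp: nonneg_fun_def)
  qed
  then have pos: "0 \<le> \<Lambda> (\<lambda>z. complex_of_real (?w z) * \<phi> z)"
    using \<Lambda> w by (simp add: pos_functional_def)
  have "\<Lambda> (\<lambda>z. complex_of_real 1 * (complex_of_real (?w z) * \<phi> z) + complex_of_real (u z) * \<phi> z)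
     = 1 * \<Lambda> (\<lambda>z. complex_of_real (?w z) * \<phi> z) + \<Lambda> (\<lambda>z. complex_of_real (u z) * \<phi> z)"
    by (rule pos_functional_linear[OF \<Lambda> w Cc_times[OF \<Omega> \<phi>(1) u]])
  also have "(\<lambda>z. complex_of_real 1 * (complex_of_real (?w z) * \<phi> z) + complex_of_real (u z) * \<phi> z)
     = (\<lambda>z. complex_of_real c * \<phi> z + complex_of_real (v z) * \<phi> z)"
    by (simp add: fun_eq_iff algebra_simps)
  also have "\<Lambda> \<dots> = c * \<Lambda> \<phi> + \<Lambda> (\<lambda>z. complex_of_real (v z) * \<phi> z)"
    by (rule pos_functional_linear[OF \<Lambda> \<phi>(1) Cc_times[OF \<Omega> \<phi>(1) v]])
  finally show ?thesis using pos by simp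
qed

lemma admissible_seqD:
  assumes "admissible_seq \<Omega> g G"
  shows admissible_smooth: "smooth_on \<Omega> (G j)"
    and admissible_psh: "psh \<Omega> (\<lambda>z. ereal (G j z))"
    and admissible_Suc_le: "z \<in> \<Omega> \<Longrightarrow> G (Suc j) z \<le> G j z"
    and admissible_lim: "z \<in> \<Omega> \<Longrightarrow> (\<lambda>j. ereal (G j z)) \<longlonglongrightarrow> g z"
  using assms by (simp_all add: admissible_seq_def)

lemma admissible_continuous: "admissible_seq \<Omega> g G \<Longrightarrow> continuous_on \<Omega> (G j)"
  by (rule smooth_on_continuous[OF admissible_smooth])

lemma admissible_decreasing:
  assumes "admissible_seq \<Omega> g G" "z \<in> \<Omega>" "i \<le> j"
  shows "G j z \<le> G i z"
  using assms(3)
proof (induction j rule: dec_induct)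
  case (step n)
  have "G (Suc n) z \<le> G n z" by (rule admissible_Suc_le[OF assms(1,2)])
  with step show ?case by linarith
qed simp

text \<open>Dini's argument: one admissible sequence is eventually below each member of another one, up
  to a constant, because both decrease to the same limit.\<close>

lemma admissible_dini:
  assumes \<Omega>: "open \<Omega>" and G: "admissible_seq \<Omega> g G" and H: "admissible_seq \<Omega> g H"
    and K: "compact K" "K \<subseteq> \<Omega>" and \<delta>: "0 < \<delta>"
  shows "\<exists>J. \<forall>j\<ge>J. \<forall>z\<in>K. G j z \<le> H k z + \<delta>"
proof -
  define U where "U j = {z \<in> \<Omega>. G j z - H k z < \<delta>}" for j
  have "open (U j)" for j
  proof -
    have "continuous_on \<Omega> (\<lambda>z. G j z - H k z)"
      by (intro continuous_intros admissible_continuous[OF G] admissible_continuous[OF H])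
    from continuous_open_preimage[OF this \<Omega>, of "{..<\<delta>}"] show ?thesis
      by (simp add: U_def vimage_def Int_def)
  qed
  moreover have "K \<subseteq> (\<Union>j\<in>UNIV. U j)"
  proof
    fix z assume "z \<in> K"
    then have z: "z \<in> \<Omega>" using K by blast
    have lim: "(\<lambda>j. ereal (G j z)) \<longlonglongrightarrow> g z" "(\<lambda>j. ereal (H j z)) \<longlonglongrightarrow> g z"
      by (rule admissible_lim[OF G z], rule admissible_lim[OF H z])
    have "g z \<le> ereal (H k z)"
      by (rule LIMSEQ_le_const2[OF lim(2)]) (use admissible_decreasing[OF H z] in auto)
    also have "\<dots> < ereal (H k z + \<delta>)" using \<delta> by simp
    finally have "\<forall>\<^sub>F j in sequentially. ereal (G j z) < ereal (H k z + \<delta>)"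
      using lim(1) order_tendstoD(2) by blast
    then obtain j where "G j z < H k z + \<delta>"
      unfolding eventually_sequentially by auto
    then have "z \<in> U j" using z by (simp add: U_def)
    then show "z \<in> (\<Union>j\<in>UNIV. U j)" by blast
  qed
  ultimately obtain D where D: "D \<subseteq> UNIV" "finite D" "K \<subseteq> (\<Union>j\<in>D. U j)"
    by (rule compactE_image[OF K(1), of UNIV U]) (auto intro: that)
  have "G j z \<le> H k z + \<delta>" if j: "Max (insert 0 D) \<le> j" and z: "z \<in> K" for j z
  proof -
    obtain i where i: "i \<in> D" "z \<in> U i" using D(3) z by blast
    have "i \<le> j" using i(1) D(2) j by (meson Max_ge finite_insert insertI2 le_trans)
    then have "G j z \<le> G i z" using admissible_decreasing[OF G] z K by blast
    then show ?thesis using i(2) by (simp add: U_def)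
  qed
  then show ?thesis by (intro exI[of _ "Max (insert 0 D)"] allI impI ballI)
qed

text \<open>The bound is passed to the limit in j, in k and in \<delta>, in this order, since the
  index J may depend on k and \<delta>.\<close>

lemma limit_le_limit:
  fixes a b :: "nat \<Rightarrow> real" and w :: "real \<Rightarrow> real"
  assumes "a \<longlonglongrightarrow> l" "b \<longlonglongrightarrow> m" "(w \<longlongrightarrow> 0) (at_right 0)"
    and "\<And>k \<delta>. 0 < \<delta> \<Longrightarrow> \<exists>J. \<forall>j\<ge>J. a j \<le> b k + w \<delta>"
  shows "l \<le> m"
proof -
  have "l \<le> b k + w \<delta>" if "0 < \<delta>" for k and \<delta> :: real
    using LIMSEQ_le_const2[OF assms(1)] assms(4)[OF that] by blast
  then have "l \<le> m + w \<delta>" if "0 < \<delta>" for \<delta>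
    using LIMSEQ_le_const[OF tendsto_add[OF assms(2) tendsto_const]] that by blast
  then have "\<forall>\<^sub>F \<delta> in at_right 0. l \<le> m + w \<delta>"
    by (simp add: eventually_at_filter)
  from tendsto_lowerbound[OF tendsto_add[OF tendsto_const assms(3)] this] show ?thesis by simp
qed

lemma powr_max_continuous:
  assumes "continuous_on S f" "0 < q"
  shows "continuous_on S (\<lambda>z. max (f z) 0 powr q :: real)"
  by (intro continuous_on_powr' continuous_intros assms(1)) (use assms(2) in auto)

text \<open>Members of an admissible sequence may be positive even where the limit is not, so this
  part cannot be dropped. It decreases and is bounded below by 0, which gives convergence; Dini's
  argument in both directions shows that any two sequences yield the same limit.\<close>

lemma admissible_positive_part_limit:
  assumes \<Omega>: "open \<Omega>" and \<Lambda>: "pos_functional \<Omega> \<Lambda>" and \<phi>: "\<phi> \<in> Cc \<Omega>" "nonneg_fun \<phi>" and q: "0 < q" "q \<le> 1"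
  shows "\<exists>l. \<forall>G. admissible_seq \<Omega> g G \<longrightarrow>
     (\<lambda>j. \<Lambda> (\<lambda>z. complex_of_real (max (G j z) 0 powr q) * \<phi> z)) \<longlonglongrightarrow> l"
proof -
  define a where "a G j = \<Lambda> (\<lambda>z. complex_of_real (max (G j z) 0 powr q) * \<phi> z)" for G and j :: nat
  have cont: "continuous_on \<Omega> (\<lambda>z. max (G j z) 0 powr q)" if "admissible_seq \<Omega> g G" for G and j :: nat
    by (rule powr_max_continuous[OF admissible_continuous[OF that] q(1)])
  have supp: "z \<in> supp \<phi>" "z \<in> \<Omega>" if "\<phi> z \<noteq> 0" for z
    using notin_supp[of z \<phi>] that Cc_supp(2)[OF \<phi>(1)] by blast+
  have "0 \<le> \<Lambda> \<phi>" using \<Lambda> \<phi> by (simp add: pos_functional_def)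
  have conv: "convergent (a G)" if G: "admissible_seq \<Omega> g G" for G
  proof -
    have "a G j \<le> a G i + 0 * \<Lambda> \<phi>" if "i \<le> j" for i j
      unfolding a_def
      by (rule pos_functional_mono[OF \<Lambda> \<Omega> \<phi> cont[OF G] cont[OF G]])
         (use q(1) admissible_decreasing[OF G supp(2) that] in \<open>auto intro!: powr_mono2 max.mono\<close>)
    then have dec: "decseq (a G)" by (simp add: decseq_def)
    have "0 \<le> a G j" for j
    proof -
      have "nonneg_fun (\<lambda>z. complex_of_real (max (G j z) 0 powr q) * \<phi> z)"
        using \<phi>(2) by (simp add: nonneg_fun_def)
      then show ?thesis using \<Lambda> Cc_times[OF \<Omega> \<phi>(1) cont[OF G]] by (simp add: pos_functional_def a_def)
    qed
    then obtain l where "a G \<longlonglongrightarrow> l" using decseq_convergent[OF dec] by blast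
    then show ?thesis by (rule convergentI)
  qed
  have w: "((\<lambda>\<delta>. \<delta> powr q * \<Lambda> \<phi>) \<longlongrightarrow> 0) (at_right 0)"
    using q(1) by (intro tendsto_mult_left_zero tendsto_zero_powrI[OF _ tendsto_const]) (auto simp: eventually_at_filter)
  have le: "lim (a G) \<le> lim (a H)" if G: "admissible_seq \<Omega> g G" and H: "admissible_seq \<Omega> g H" for G H
  proof (rule limit_le_limit[OF convergent_LIMSEQ_iff[THEN iffD1, OF conv[OF G]]
        convergent_LIMSEQ_iff[THEN iffD1, OF conv[OF H]] w])
    fix k and \<delta> :: real assume \<delta>: "0 < \<delta>"
    obtain J where J: "\<And>j z. j \<ge> J \<Longrightarrow> z \<in> supp \<phi> \<Longrightarrow> G j z \<le> H k z + \<delta>"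
      using admissible_dini[OF \<Omega> G H Cc_supp[OF \<phi>(1)] \<delta>] by blast
    have "a G j \<le> a H k + \<delta> powr q * \<Lambda> \<phi>" if "j \<ge> J" for j
      unfolding a_def
    proof (rule pos_functional_mono[OF \<Lambda> \<Omega> \<phi> cont[OF G] cont[OF H]])
      fix z assume "\<phi> z \<noteq> 0"
      then have "G j z \<le> H k z + \<delta>" using J[OF that] supp by blast
      then have "max (G j z) 0 powr q \<le> (max (H k z) 0 + \<delta>) powr q"
        using \<delta> q by (intro powr_mono2) auto
      also have "\<dots> \<le> max (H k z) 0 powr q + \<delta> powr q" using \<delta> q by (intro powr_subadditive) auto
      finally show "max (G j z) 0 powr q \<le> max (H k z) 0 powr q + \<delta> powr q" .
    qed
    then show "\<exists>J. \<forall>j\<ge>J. a G j \<le> a H k + \<delta> powr q * \<Lambda> \<phi>" by blast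
  qed
  show ?thesis
  proof (cases "\<exists>G. admissible_seq \<Omega> g G")
    case True
    then obtain G0 where G0: "admissible_seq \<Omega> g G0" by blast
    have "a G \<longlonglongrightarrow> lim (a G0)" if G: "admissible_seq \<Omega> g G" for G
    proof -
      have "lim (a G) = lim (a G0)" using le[OF G G0] le[OF G0 G] by (rule antisym)
      then show ?thesis using convergent_LIMSEQ_iff[THEN iffD1, OF conv[OF G]] by simp
    qed
    then show ?thesis unfolding a_def by blast
  qed blast
qed

text \<open>The negative parts increase, so convergence needs an upper bound, and this is where the
  mass estimate will enter; by monotonicity a bound for large j suffices. A smaller function has a
  larger negative part, so the comparison of two sequences is reversed, hence the minus signs in
  front of the limits.\<close>

lemma admissible_negative_part_limit:
  assumes \<Omega>: "open \<Omega>" and \<Lambda>: "pos_functional \<Omega> \<Lambda>" and \<phi>: "\<phi> \<in> Cc \<Omega>" "nonneg_fun \<phi>" and q: "0 < q" "q \<le> 1"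
    and bounded: "\<And>G. admissible_seq \<Omega> g G \<Longrightarrow>
      \<exists>B J. \<forall>j\<ge>J. \<Lambda> (\<lambda>z. complex_of_real (max (- G j z) 0 powr q) * \<phi> z) \<le> B"
  shows "\<exists>l. \<forall>G. admissible_seq \<Omega> g G \<longrightarrow>
     (\<lambda>j. \<Lambda> (\<lambda>z. complex_of_real (max (- G j z) 0 powr q) * \<phi> z)) \<longlonglongrightarrow> l"
proof -
  define a where "a G j = \<Lambda> (\<lambda>z. complex_of_real (max (- G j z) 0 powr q) * \<phi> z)" for G and j :: nat
  have cont: "continuous_on \<Omega> (\<lambda>z. max (- G j z) 0 powr q)" if "admissible_seq \<Omega> g G" for G and j :: nat
    by (rule powr_max_continuous[OF continuous_on_minus[OF admissible_continuous[OF that]] q(1)])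
  have supp: "z \<in> supp \<phi>" "z \<in> \<Omega>" if "\<phi> z \<noteq> 0" for z
    using notin_supp[of z \<phi>] that Cc_supp(2)[OF \<phi>(1)] by blast+
  have conv: "convergent (a G)" if G: "admissible_seq \<Omega> g G" for G
  proof -
    have "a G i \<le> a G j + 0 * \<Lambda> \<phi>" if "i \<le> j" for i j
      unfolding a_def
      by (rule pos_functional_mono[OF \<Lambda> \<Omega> \<phi> cont[OF G] cont[OF G]])
         (use q(1) admissible_decreasing[OF G supp(2) that] in \<open>auto intro!: powr_mono2 max.mono\<close>)
    then have inc: "incseq (a G)" by (simp add: incseq_def)
    obtain B J where BJ: "\<And>j. j \<ge> J \<Longrightarrow> a G j \<le> B" using bounded[OF G] unfolding a_def by blast
    have "a G j \<le> B" for j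
      using incseqD[OF inc, of j "max j J"] BJ[of "max j J"] by simp
    then obtain l where "a G \<longlonglongrightarrow> l" using incseq_convergent[OF inc] by blast
    then show ?thesis by (rule convergentI)
  qed
  have w: "((\<lambda>\<delta>. \<delta> powr q * \<Lambda> \<phi>) \<longlongrightarrow> 0) (at_right 0)"
    using q(1) by (intro tendsto_mult_left_zero tendsto_zero_powrI[OF _ tendsto_const]) (auto simp: eventually_at_filter)
  have le: "- lim (a G) \<le> - lim (a H)" if G: "admissible_seq \<Omega> g G" and H: "admissible_seq \<Omega> g H" for G H
  proof (rule limit_le_limit[OF tendsto_minus[OF convergent_LIMSEQ_iff[THEN iffD1, OF conv[OF G]]]
        tendsto_minus[OF convergent_LIMSEQ_iff[THEN iffD1, OF conv[OF H]]] w])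
    fix k and \<delta> :: real assume \<delta>: "0 < \<delta>"
    obtain J where J: "\<And>j z. j \<ge> J \<Longrightarrow> z \<in> supp \<phi> \<Longrightarrow> G j z \<le> H k z + \<delta>"
      using admissible_dini[OF \<Omega> G H Cc_supp[OF \<phi>(1)] \<delta>] by blast
    have "a H k \<le> a G j + \<delta> powr q * \<Lambda> \<phi>" if "j \<ge> J" for j
      unfolding a_def
    proof (rule pos_functional_mono[OF \<Lambda> \<Omega> \<phi> cont[OF H] cont[OF G]])
      fix z assume "\<phi> z \<noteq> 0"
      then have "G j z \<le> H k z + \<delta>" using J[OF that] supp by blast
      then have "max (- H k z) 0 powr q \<le> (max (- G j z) 0 + \<delta>) powr q"
        using \<delta> q by (intro powr_mono2) auto
      also have "\<dots> \<le> max (- G j z) 0 powr q + \<delta> powr q" using \<delta> q by (intro powr_subadditive) auto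
      finally show "max (- H k z) 0 powr q \<le> max (- G j z) 0 powr q + \<delta> powr q" .
    qed
    then show "\<exists>J. \<forall>j\<ge>J. - a G j \<le> - a H k + \<delta> powr q * \<Lambda> \<phi>" by fastforce
  qed
  show ?thesis
  proof (cases "\<exists>G. admissible_seq \<Omega> g G")
    case True
    then obtain G0 where G0: "admissible_seq \<Omega> g G0" by blast
    have "a G \<longlonglongrightarrow> lim (a G0)" if G: "admissible_seq \<Omega> g G" for G
    proof -
      have "lim (a G) = lim (a G0)" using le[OF G G0] le[OF G0 G] by linarith
      then show ?thesis using convergent_LIMSEQ_iff[THEN iffD1, OF conv[OF G]] by simp
    qed
    then show ?thesis unfolding a_def by blast
  qed blast
qed

section \<open>Polarization in the arguments of a current\<close>

lemma order0_current_linear: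
  assumes "order0_current \<Omega> p T" "length as = p" "length bs = p" "\<phi> \<in> Cc \<Omega>"
  shows "\<psi> \<in> Cc \<Omega> \<Longrightarrow> T (\<lambda>z. c * \<phi> z + \<psi> z) as bs = c * T \<phi> as bs + T \<psi> as bs"
    and "T (\<lambda>z. c * \<phi> z) as bs = c * T \<phi> as bs"
proof -
  have lin: "T (\<lambda>z. c * \<phi> z + \<psi> z) as bs = c * T \<phi> as bs + T \<psi> as bs"
    if "\<phi> \<in> Cc \<Omega>" "\<psi> \<in> Cc \<Omega>" for \<phi> \<psi> c
    using assms(1-3) that unfolding order0_current_def by blast
  have z: "(\<lambda>z. 0) \<in> Cc \<Omega>" by (rule Dtest_subset_Cc[OF Dtest_zero])
  have zero: "T (\<lambda>z. 0) as bs = 0" using lin[OF z z, of 1] by simp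
  show "T (\<lambda>z. c * \<phi> z + \<psi> z) as bs = c * T \<phi> as bs + T \<psi> as bs" if "\<psi> \<in> Cc \<Omega>"
    by (rule lin[OF assms(4) that])
  show "T (\<lambda>z. c * \<phi> z) as bs = c * T \<phi> as bs" using lin[OF assms(4) z, of c] zero by simp
qed

lemma order0_current_multilinear:
  assumes "order0_current \<Omega> p T" "length as = p" "length bs = p" "\<phi> \<in> Cc \<Omega>" "i < p"
  shows "T \<phi> (as[i := c *s u + v]) bs = c * T \<phi> (as[i := u]) bs + T \<phi> (as[i := v]) bs"
    and "T \<phi> as (bs[i := c *s u + v]) = cnj c * T \<phi> as (bs[i := u]) + T \<phi> as (bs[i := v])"
proof -
  have "multilin_alt p (\<lambda>as. T \<phi> as bs)" "conj_multilin_alt p (\<lambda>bs. T \<phi> as bs)"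
    using assms unfolding order0_current_def by blast+
  then show "T \<phi> (as[i := c *s u + v]) bs = c * T \<phi> (as[i := u]) bs + T \<phi> (as[i := v]) bs"
    "T \<phi> as (bs[i := c *s u + v]) = cnj c * T \<phi> as (bs[i := u]) + T \<phi> as (bs[i := v])"
    using assms(2,3,5) unfolding multilin_alt_def conj_multilin_alt_def by blast+
qed

text \<open>Upon expansion the four values of the form at (a, a), (b, b), (b, a) and (a, b) get the
  coefficients \<i>^m, \<i>^m, \<i>^(2m) and 1 respectively; summed over m < 4, only the last does
  not cancel.\<close>

lemma order0_current_polarization:
  assumes T: "order0_current \<Omega> p T" "length as = p" "length bs = p" "\<phi> \<in> Cc \<Omega>" "i < p"
  shows "T \<phi> (as[i := a]) (bs[i := b])
    = (\<Sum>m<4::nat. \<i> ^ m / 4 * T \<phi> (as[i := \<i> ^ m *s b + a]) (bs[i := \<i> ^ m *s b + a]))"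
proof -
  define F where "F x y = T \<phi> (as[i := x]) (bs[i := y])" for x y
  have 1: "F (c *s u + v) y = c * F u y + F v y" for c u v y
    unfolding F_def by (rule order0_current_multilinear(1)[OF T(1,2) _ T(4,5)]) (simp add: T)
  have 2: "F x (c *s u + v) = cnj c * F x u + F x v" for c u v x
    unfolding F_def by (rule order0_current_multilinear(2)[OF T(1) _ T(3,4,5)]) (simp add: T)
  have "F a b = (\<Sum>m<4::nat. \<i> ^ m / 4 * F (\<i> ^ m *s b + a) (\<i> ^ m *s b + a))"
    unfolding 1 2 by (simp add: eval_nat_numeral algebra_simps)
  then show ?thesis by (simp add: F_def)
qed

text \<open>Reduces arbitrary arguments and complex test functions to equal arguments and
  nonnegative test functions, where monotone convergence is available. \<open>A\<close> singles out
  the admissible sequences, and l stands before the quantifier over \<open>G\<close>, so that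
  independence of the sequence is carried along.\<close>

lemma current_limit_polarize:
  fixes T :: "(complex^'n::finite \<Rightarrow> complex) \<Rightarrow> (complex^'n) list \<Rightarrow> (complex^'n) list \<Rightarrow> complex"
  assumes T: "order0_current \<Omega> p T" and \<Omega>: "open \<Omega>"
    and u: "\<And>G j. A G \<Longrightarrow> continuous_on \<Omega> (u G j)"
    and diag: "\<And>\<phi> as. \<phi> \<in> Cc \<Omega> \<Longrightarrow> nonneg_fun \<phi> \<Longrightarrow> length as = p \<Longrightarrow>
      \<exists>l. \<forall>G. A G \<longrightarrow> (\<lambda>j::nat. T (\<lambda>z. complex_of_real (u G j z) * \<phi> z) as as) \<longlonglongrightarrow> l"
    and \<phi>: "\<phi> \<in> Cc \<Omega>" and len: "length as = p" "length bs = p"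
  shows "\<exists>l. \<forall>G. A G \<longrightarrow> (\<lambda>j. T (\<lambda>z. complex_of_real (u G j z) * \<phi> z) as bs) \<longlonglongrightarrow> l"
proof -
  \<comment> \<open>Induction on the number i of leading positions in which \<open>as\<close> and
    \<open>bs\<close> may differ: polarizing at position i makes the lists agree there.\<close>
  have nonneg: "\<exists>l. \<forall>G. A G \<longrightarrow> (\<lambda>j. T (\<lambda>z. complex_of_real (u G j z) * \<phi> z) as bs) \<longlonglongrightarrow> l"
    if \<phi>: "\<phi> \<in> Cc \<Omega>" "nonneg_fun \<phi>" and "length as = p" "length bs = p" "i \<le> p"
      "\<And>k. i \<le> k \<Longrightarrow> k < p \<Longrightarrow> as ! k = bs ! k" for \<phi> as bs i
    using that(3-)
  proof (induction i arbitrary: as bs)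
    case 0
    then have "as = bs" by (intro nth_equalityI) auto
    then show ?case using diag[OF \<phi>, of bs] 0 by simp
  next
    case (Suc i)
    let ?c = "\<lambda>m::nat. \<i> ^ m *s (bs ! i) + as ! i"
    have "\<exists>l. \<forall>G. A G \<longrightarrow> (\<lambda>j. T (\<lambda>z. complex_of_real (u G j z) * \<phi> z) (as[i := ?c m]) (bs[i := ?c m])) \<longlonglongrightarrow> l" for m
    proof (rule Suc.IH)
      show "as[i := ?c m] ! k = bs[i := ?c m] ! k" if "i \<le> k" "k < p" for k
        using Suc.prems(4)[of k] Suc.prems(1-3) that by (cases "k = i") auto
    qed (use Suc.prems in auto)
    then obtain l where l: "\<And>m G. A G \<Longrightarrow>
        (\<lambda>j. T (\<lambda>z. complex_of_real (u G j z) * \<phi> z) (as[i := ?c m]) (bs[i := ?c m])) \<longlonglongrightarrow> l m"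
      using choice[of "\<lambda>m l. \<forall>G. A G \<longrightarrow>
        (\<lambda>j. T (\<lambda>z. complex_of_real (u G j z) * \<phi> z) (as[i := ?c m]) (bs[i := ?c m])) \<longlonglongrightarrow> l"] by blast
    have "(\<lambda>j. T (\<lambda>z. complex_of_real (u G j z) * \<phi> z) as bs) \<longlonglongrightarrow> (\<Sum>m<4::nat. \<i> ^ m / 4 * l m)" if G: "A G" for G
    proof -
      have "T (\<lambda>z. complex_of_real (u G j z) * \<phi> z) as bs
         = (\<Sum>m<4::nat. \<i> ^ m / 4 * T (\<lambda>z. complex_of_real (u G j z) * \<phi> z) (as[i := ?c m]) (bs[i := ?c m]))" for j
        using order0_current_polarization[OF T Suc.prems(1,2) Cc_times[OF \<Omega> \<phi>(1) u[OF G]], of i j "as ! i" "bs ! i"]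
          Suc.prems(3) by simp
      then show ?thesis by (simp only:) (intro tendsto_sum tendsto_mult tendsto_const l G)
    qed
    then show ?case by blast
  qed
  have nn: "\<exists>l. \<forall>G. A G \<longrightarrow> (\<lambda>j. T (\<lambda>z. complex_of_real (u G j z) * \<phi>' z) as bs) \<longlonglongrightarrow> l"
    if "\<phi>' \<in> Cc \<Omega>" "nonneg_fun \<phi>'" for \<phi>'
    by (rule nonneg[OF that len order_refl]) simp
  \<comment> \<open>Positive and negative parts of a test function are only continuous, so the
    diagonal hypothesis has to cover all of \<open>Cc\<close>.\<close>
  have part: "(\<lambda>z. complex_of_real (max (h (\<phi> z)) 0)) \<in> Cc \<Omega>" "nonneg_fun (\<lambda>z. complex_of_real (max (h (\<phi> z)) 0))"
    if h: "bounded_linear h" for h :: "complex \<Rightarrow> real"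
  proof -
    have c: "continuous_on UNIV \<phi>" using \<phi> by (simp add: Cc_def)
    have z: "\<phi> z = 0 \<Longrightarrow> complex_of_real (max (h (\<phi> z)) 0) = 0" for z
      by (simp add: linear_simps(3)[OF h])
    have "continuous_on UNIV (\<lambda>z. complex_of_real (max (h (\<phi> z)) 0))"
      by (intro continuous_intros bounded_linear.continuous_on[OF h] c)
    moreover have "supp (\<lambda>z. complex_of_real (max (h (\<phi> z)) 0)) \<subseteq> \<Omega>"
      by (rule subset_trans[OF compact_supp_mono(2)[OF Cc_supp(1)[OF \<phi>] z] Cc_supp(2)[OF \<phi>]])
    moreover have "compact (supp (\<lambda>z. complex_of_real (max (h (\<phi> z)) 0)))"
      by (rule compact_supp_mono(1)[OF Cc_supp(1)[OF \<phi>] z])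
    ultimately show "(\<lambda>z. complex_of_real (max (h (\<phi> z)) 0)) \<in> Cc \<Omega>" by (simp add: Cc_def)
    show "nonneg_fun (\<lambda>z. complex_of_real (max (h (\<phi> z)) 0))" by (simp add: nonneg_fun_def)
  qed
  note bl = bounded_linear_Re bounded_linear_minus[OF bounded_linear_Re]
    bounded_linear_Im bounded_linear_minus[OF bounded_linear_Im]
  let ?p = "\<lambda>h z. complex_of_real (max (h (\<phi> z)) 0)"
  obtain l1 where l1: "\<And>G. A G \<Longrightarrow> (\<lambda>j. T (\<lambda>z. complex_of_real (u G j z) * ?p Re z) as bs) \<longlonglongrightarrow> l1"
    using nn[OF part[OF bl(1)]] by blast
  obtain l2 where l2: "\<And>G. A G \<Longrightarrow> (\<lambda>j. T (\<lambda>z. complex_of_real (u G j z) * ?p (\<lambda>x. - Re x) z) as bs) \<longlonglongrightarrow> l2"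
    using nn[OF part[OF bl(2)]] by blast
  obtain l3 where l3: "\<And>G. A G \<Longrightarrow> (\<lambda>j. T (\<lambda>z. complex_of_real (u G j z) * ?p Im z) as bs) \<longlonglongrightarrow> l3"
    using nn[OF part[OF bl(3)]] by blast
  obtain l4 where l4: "\<And>G. A G \<Longrightarrow> (\<lambda>j. T (\<lambda>z. complex_of_real (u G j z) * ?p (\<lambda>x. - Im x) z) as bs) \<longlonglongrightarrow> l4"
    using nn[OF part[OF bl(4)]] by blast
  have "(\<lambda>j. T (\<lambda>z. complex_of_real (u G j z) * \<phi> z) as bs) \<longlonglongrightarrow> l1 + (-1 * l2 + (\<i> * l3 + (- \<i>) * l4))" if G: "A G" for G
  proof -
    let ?P = "\<lambda>j h z. complex_of_real (u G j z) * ?p h z"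
    have P: "?P j h \<in> Cc \<Omega>" if "bounded_linear h" for j h by (rule Cc_times[OF \<Omega> part(1)[OF that] u[OF G]])
    have "T (\<lambda>z. complex_of_real (u G j z) * \<phi> z) as bs
       = T (?P j Re) as bs + (-1 * T (?P j (\<lambda>x. - Re x)) as bs + (\<i> * T (?P j Im) as bs + (- \<i>) * T (?P j (\<lambda>x. - Im x)) as bs))" for j
    proof -
      note lin = order0_current_linear[OF T len]
      have "(\<lambda>z. complex_of_real (u G j z) * \<phi> z)
         = (\<lambda>z. 1 * ?P j Re z + (-1 * ?P j (\<lambda>x. - Re x) z + (\<i> * ?P j Im z + (- \<i>) * ?P j (\<lambda>x. - Im x) z)))"
      proof
        fix z
        have "\<phi> z = ?p Re z - ?p (\<lambda>x. - Re x) z + \<i> * (?p Im z - ?p (\<lambda>x. - Im x) z)"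
          by (simp add: complex_eq_iff max_def)
        from arg_cong[OF this, of "\<lambda>x. complex_of_real (u G j z) * x"]
        show "complex_of_real (u G j z) * \<phi> z
         = 1 * ?P j Re z + (-1 * ?P j (\<lambda>x. - Re x) z + (\<i> * ?P j Im z + (- \<i>) * ?P j (\<lambda>x. - Im x) z))"
          by (simp add: algebra_simps)
      qed
      then have "T (\<lambda>z. complex_of_real (u G j z) * \<phi> z) as bs
         = T (\<lambda>z. 1 * ?P j Re z + (-1 * ?P j (\<lambda>x. - Re x) z + (\<i> * ?P j Im z + (- \<i>) * ?P j (\<lambda>x. - Im x) z))) as bs"
        by (rule arg_cong[where f = "\<lambda>h. T h as bs"])
      also have "\<dots> = 1 * T (?P j Re) as bs + T (\<lambda>z. -1 * ?P j (\<lambda>x. - Re x) z + (\<i> * ?P j Im z + (- \<i>) * ?P j (\<lambda>x. - Im x) z)) as bs"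
        by (rule lin(1)) (intro P bl Cc_add Cc_scale)+
      also have "T (\<lambda>z. -1 * ?P j (\<lambda>x. - Re x) z + (\<i> * ?P j Im z + (- \<i>) * ?P j (\<lambda>x. - Im x) z)) as bs
         = -1 * T (?P j (\<lambda>x. - Re x)) as bs + T (\<lambda>z. \<i> * ?P j Im z + (- \<i>) * ?P j (\<lambda>x. - Im x) z) as bs"
        by (rule lin(1)) (intro P bl Cc_add Cc_scale)+
      also have "T (\<lambda>z. \<i> * ?P j Im z + (- \<i>) * ?P j (\<lambda>x. - Im x) z) as bs
         = \<i> * T (?P j Im) as bs + T (\<lambda>z. (- \<i>) * ?P j (\<lambda>x. - Im x) z) as bs"
        by (rule lin(1)) (intro P bl Cc_add Cc_scale)+
      also have "T (\<lambda>z. (- \<i>) * ?P j (\<lambda>x. - Im x) z) as bs = (- \<i>) * T (?P j (\<lambda>x. - Im x)) as bs"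
        by (rule lin(2)) (intro P bl)
      finally show ?thesis by simp
    qed
    then show ?thesis by (simp only:) (intro tendsto_add tendsto_mult tendsto_const l1 l2 l3 l4 G)
  qed
  then show ?thesis by blast
qed

section \<open>Integration by parts against cutoff functions\<close>

abbreviation ddbar :: "(complex^'n::finite \<Rightarrow> complex) \<Rightarrow> 'n \<Rightarrow> 'n \<Rightarrow> complex^'n \<Rightarrow> complex" where
  "ddbar f k l \<equiv> wirt (- \<i>) k (wirt \<i> l f)"

lemma wirt_notin_supp:
  assumes "z \<notin> supp f"
  shows "wirt c k f z = 0"
proof -
  have "wirt c k f z = wirt c k (\<lambda>_. 0) z"
  proof (rule wirt_cong)
    show "open (- supp f)" by (simp add: open_Compl)
    show "z \<in> - supp f" using assms by simp
    show "f y = 0" if "y \<in> - supp f" for y using notin_supp[of y f] that by simp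
  qed
  then show ?thesis by simp
qed

lemma supp_wirt: "supp (wirt c k f) \<subseteq> supp f"
proof (rule closure_minimal)
  show "{z. wirt c k f z \<noteq> 0} \<subseteq> supp f" using wirt_notin_supp[of _ f c k] by blast
qed simp

lemma Dtest_wirt:
  assumes "\<phi> \<in> Dtest \<Omega>"
  shows "wirt c k \<phi> \<in> Dtest \<Omega>"
proof -
  have s: "smooth_on UNIV (wirt c k \<phi>)"
    using assms by (intro smooth_on_wirt) (simp_all add: Dtest_def)
  have "compact (supp \<phi>)" by (rule Cc_supp(1)[OF Dtest_subset_Cc[OF assms]])
  from compact_Int_closed[OF this closed_closure, of "{z. wirt c k \<phi> z \<noteq> 0}"]
  have "compact (supp (wirt c k \<phi>))" unfolding Int_absorb1[OF supp_wirt] .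
  moreover have "supp (wirt c k \<phi>) \<subseteq> \<Omega>"
    by (rule subset_trans[OF supp_wirt Cc_supp(2)[OF Dtest_subset_Cc[OF assms]]])
  ultimately show ?thesis using s smooth_on_continuous[OF s] by (simp add: Dtest_def Cc_def)
qed

lemma Dtest_mono:
  assumes "\<phi> \<in> Dtest V" "V \<subseteq> \<Omega>"
  shows "\<phi> \<in> Dtest \<Omega>"
  using assms(1) subset_trans[OF Cc_supp(2)[OF Dtest_subset_Cc[OF assms(1)]] assms(2)]
  by (simp add: Dtest_def Cc_def)

lemma pos_form_mono:
  assumes "pos_form \<Omega> M" "V \<subseteq> \<Omega>"
  shows "pos_form V M"
  using assms(1) Dtest_mono[OF _ assms(2)] by (simp add: pos_form_def)

lemma Dtest_of_real:
  assumes "smooth_on UNIV \<kappa>" "compact (supp \<kappa>)" "supp \<kappa> \<subseteq> \<Omega>"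
  shows "(\<lambda>z. complex_of_real (\<kappa> z)) \<in> Dtest \<Omega>"
proof -
  have e: "supp (\<lambda>z. complex_of_real (\<kappa> z)) = supp \<kappa>" by simp
  have s: "smooth_on UNIV (\<lambda>z. complex_of_real (\<kappa> z))" by (rule smooth_on_of_real[OF open_UNIV assms(1)])
  show ?thesis using s smooth_on_continuous[OF s] assms(2,3) unfolding Dtest_def Cc_def e by simp
qed

section \<open>Domination of Hermitian matrices\<close>

definition delta :: "'n \<Rightarrow> 'n \<Rightarrow> complex" where
  "delta k l = of_bool (k = l)"

lemma sum_delta_form:
  "(\<Sum>k\<in>UNIV. \<Sum>l\<in>UNIV. c * delta k l * f k l) = c * (\<Sum>k\<in>(UNIV::'n::finite set). f k k)"
  by (simp add: delta_def of_bool_def if_distrib if_distribR sum.delta sum_distrib_left cong: if_cong)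

text \<open>|E_kl v_k v_l| is at most B (|v_k|^2 + |v_l|^2) / 2, and summation over both indices
  gives n B |v|^2. It lets terms without a sign be absorbed by a trace.\<close>

lemma psd_dominated:
  fixes E :: "'n::finite \<Rightarrow> 'n \<Rightarrow> complex"
  assumes herm: "\<And>k l. E l k = cnj (E k l)" and B: "\<And>k l. cmod (E k l) \<le> B"
  shows "psd (\<lambda>k l. of_real (real CARD('n) * B) * delta k l - E k l)"
  unfolding psd_def
proof (intro conjI allI)
  show "of_real (real CARD('n) * B) * delta l k - E l k = cnj (of_real (real CARD('n) * B) * delta k l - E k l)" for k l
    using herm[of l k] by (auto simp: delta_def)
  fix v :: "'n \<Rightarrow> complex"
  have B0: "0 \<le> B" using B[of undefined undefined] norm_ge_zero order_trans by blast
  have "Re (E k l * v k * cnj (v l)) \<le> B * ((cmod (v k))\<^sup>2 + (cmod (v l))\<^sup>2) / 2" for k l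
  proof -
    have "Re (E k l * v k * cnj (v l)) \<le> cmod (E k l * v k * cnj (v l))" by (rule complex_Re_le_cmod)
    also have "\<dots> = cmod (E k l) * (cmod (v k) * cmod (v l))" by (simp add: norm_mult)
    also have "\<dots> \<le> B * (((cmod (v k))\<^sup>2 + (cmod (v l))\<^sup>2) / 2)"
      using sum_squares_bound[of "cmod (v k)" "cmod (v l)"] by (intro mult_mono B B0) auto
    finally show ?thesis by simp
  qed
  then have "(\<Sum>k\<in>UNIV. \<Sum>l\<in>UNIV. Re (E k l * v k * cnj (v l)))
     \<le> (\<Sum>k\<in>UNIV. \<Sum>l\<in>UNIV. B * ((cmod (v k))\<^sup>2 + (cmod (v l))\<^sup>2) / 2)"
    by (intro sum_mono)
  also have "\<dots> = real CARD('n) * B * (\<Sum>k\<in>UNIV. (cmod (v k))\<^sup>2)"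
    by (simp add: add_divide_distrib distrib_left sum.distrib sum_distrib_left[symmetric] sum_divide_distrib[symmetric])
  finally have le: "(\<Sum>k\<in>UNIV. \<Sum>l\<in>UNIV. Re (E k l * v k * cnj (v l))) \<le> real CARD('n) * B * (\<Sum>k\<in>UNIV. (cmod (v k))\<^sup>2)" .
  have "(\<Sum>k\<in>UNIV. \<Sum>l\<in>UNIV. (of_real (real CARD('n) * B) * delta k l - E k l) * v k * cnj (v l))
     = (\<Sum>k\<in>UNIV. \<Sum>l\<in>UNIV. of_real (real CARD('n) * B) * delta k l * (v k * cnj (v l)))
       - (\<Sum>k\<in>UNIV. \<Sum>l\<in>UNIV. E k l * v k * cnj (v l))"
    unfolding sum_subtractf[symmetric] by (intro sum.cong refl) (simp add: algebra_simps)
  also have "\<dots> = of_real (real CARD('n) * B * (\<Sum>k\<in>UNIV. (cmod (v k))\<^sup>2)) - (\<Sum>k\<in>UNIV. \<Sum>l\<in>UNIV. E k l * v k * cnj (v l))"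
    unfolding sum_delta_form by (simp only: of_real_mult of_real_sum complex_norm_square)
  finally show "0 \<le> Re (\<Sum>k\<in>UNIV. \<Sum>l\<in>UNIV. (of_real (real CARD('n) * B) * delta k l - E k l) * v k * cnj (v l))"
    using le by simp
qed

lemma psd_scale_delta:
  assumes "0 \<le> c"
  shows "psd (\<lambda>k l. complex_of_real c * delta k l)"
  unfolding psd_def
proof (intro conjI allI)
  show "complex_of_real c * delta l k = cnj (complex_of_real c * delta k l)" for k l by (auto simp: delta_def)
  fix v :: "'a \<Rightarrow> complex"
  have "(\<Sum>k\<in>UNIV. \<Sum>l\<in>UNIV. complex_of_real c * delta k l * v k * cnj (v l))
    = complex_of_real c * (\<Sum>k\<in>UNIV. v k * cnj (v k))"
    using sum_delta_form[of "complex_of_real c" "\<lambda>k l. v k * cnj (v l)"] by (simp add: mult.assoc)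
  also have "\<dots> = of_real (c * (\<Sum>k\<in>UNIV. (cmod (v k))\<^sup>2))"
    by (simp only: of_real_mult of_real_sum complex_norm_square)
  finally show "0 \<le> Re (\<Sum>k\<in>UNIV. \<Sum>l\<in>UNIV. complex_of_real c * delta k l * v k * cnj (v l))"
    using assms by (simp add: sum_nonneg)
qed

lemma psd_add:
  assumes "psd H" "psd K"
  shows "psd (\<lambda>k l. H k l + K k l)"
  unfolding psd_def
proof (intro conjI allI)
  show "H l k + K l k = cnj (H k l + K k l)" for k l
    using psd_herm[OF assms(1), of l k] psd_herm[OF assms(2), of l k] by simp
  show "0 \<le> Re (\<Sum>k\<in>UNIV. \<Sum>l\<in>UNIV. (H k l + K k l) * v k * cnj (v l))" for v
    using psd_form[OF assms(1), of v] psd_form[OF assms(2), of v] by (simp add: distrib_right sum.distrib)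
qed

text \<open>The inequality dd^c M \<ge> 0 in the sense of distributions, with both derivatives moved
  onto the test function.\<close>

definition psh_form :: "(complex^'n::finite) set \<Rightarrow> ((complex^'n \<Rightarrow> complex) \<Rightarrow> 'n \<Rightarrow> 'n \<Rightarrow> complex) \<Rightarrow> bool" where
  "psh_form \<Omega> M \<longleftrightarrow> (\<forall>\<psi>\<in>Dtest \<Omega>. nonneg_fun \<psi> \<longrightarrow> 0 \<le> Re (\<Sum>k\<in>UNIV. \<Sum>l\<in>UNIV. M (ddbar \<psi> k l) k l))"

text \<open>The part of the complex Hessian of \<open>\<kappa> F\<close> that contains derivatives of the cutoff \<open>\<kappa>\<close>.\<close>

definition cutoff_hess ::
  "(complex^'n::finite \<Rightarrow> real) \<Rightarrow> (complex^'n \<Rightarrow> real) \<Rightarrow> 'n \<Rightarrow> 'n \<Rightarrow> complex^'n \<Rightarrow> complex" where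
  "cutoff_hess \<kappa> F k l z =
     wirt (- \<i>) k (\<lambda>z. of_real (\<kappa> z)) z * wirt \<i> l (\<lambda>z. of_real (F z)) z
   + wirt \<i> l (\<lambda>z. of_real (\<kappa> z)) z * wirt (- \<i>) k (\<lambda>z. of_real (F z)) z
   + ddbar (\<lambda>z. of_real (\<kappa> z)) k l z * of_real (F z)"

text \<open>\<open>F\<close> is smooth on \<open>W\<close> only, so all supports are kept inside
  \<open>W\<close>. The Hessian of \<kappa> F contains \<open>cutoff_hess\<close>, which has no
  sign. Multiplying it by the second cutoff \<kappa>2, which is 1 on the support of \<kappa>, does
  not change it, but provides a nonnegative test function against which it is bounded through
  \<open>B\<close>.\<close>

locale cutoff =
  fixes \<Omega> W :: "(complex^'n::finite) set" and F \<kappa> \<kappa>2 :: "complex^'n \<Rightarrow> real" and B :: real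
  assumes W: "open W" "W \<subseteq> \<Omega>"
    and F: "smooth_on W F" "\<And>z. z \<in> W \<Longrightarrow> 0 \<le> F z"
    and \<kappa>: "smooth_on UNIV \<kappa>" "\<And>z. 0 \<le> \<kappa> z" "compact (supp \<kappa>)" "supp \<kappa> \<subseteq> W"
    and \<kappa>2: "smooth_on UNIV \<kappa>2" "\<And>z. 0 \<le> \<kappa>2 z" "compact (supp \<kappa>2)" "supp \<kappa>2 \<subseteq> W"
      "\<And>z. z \<in> supp \<kappa> \<Longrightarrow> \<kappa>2 z = 1"
    and B: "\<And>k l z. z \<in> W \<Longrightarrow> cmod (cutoff_hess \<kappa> F k l z) \<le> B"
begin

abbreviation "Fc \<equiv> \<lambda>z. complex_of_real (F z)"
abbreviation "\<kappa>c \<equiv> \<lambda>z. complex_of_real (\<kappa> z)"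
abbreviation "\<kappa>2c \<equiv> \<lambda>z. complex_of_real (\<kappa>2 z)"
abbreviation "\<omega> \<equiv> \<lambda>z k l. - ddbar Fc k l z"
abbreviation "Q \<equiv> \<lambda>z k l. cutoff_hess \<kappa> F k l z"
abbreviation "\<psi> \<equiv> \<lambda>z. \<kappa>c z * Fc z"

lemma Fc: "smooth_on W Fc"
  by (rule smooth_on_of_real[OF W(1) F(1)])

lemma \<kappa>c: "\<kappa>c \<in> Dtest W"
  by (rule Dtest_of_real[OF \<kappa>(1,3,4)])

lemma \<kappa>2c: "\<kappa>2c \<in> Dtest W" "nonneg_fun \<kappa>2c"
  by (rule Dtest_of_real[OF \<kappa>2(1,3,4)]) (simp add: nonneg_fun_def \<kappa>2(2))

lemma \<omega>_smooth: "smooth_on W (\<lambda>z. \<omega> z k l)"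
  by (intro smooth_on_minus smooth_on_wirt W Fc)

lemma Q_smooth: "smooth_on W (\<lambda>z. Q z k l)"
proof -
  have "smooth_on W \<kappa>c" using \<kappa>c smooth_on_subset[of UNIV \<kappa>c W] by (simp add: Dtest_def)
  then show ?thesis unfolding cutoff_hess_def
    by (intro smooth_on_add smooth_on_mult smooth_on_wirt W Fc)
qed

lemma \<kappa>2c_supp: "supp \<kappa>2c \<subseteq> W" using \<kappa>2(4) by simp

lemma \<kappa>c_supp: "supp \<kappa>c \<subseteq> W" using \<kappa>(4) by simp

lemma \<psi>: "\<psi> \<in> Dtest W" "nonneg_fun \<psi>" "supp \<psi> \<subseteq> supp \<kappa>"
proof -
  show "\<psi> \<in> Dtest W" by (rule Dtest_mult[OF \<kappa>c W(1) \<kappa>c_supp Fc])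
  have "0 \<le> \<kappa> z * F z" for z
  proof (cases "z \<in> W")
    case True
    then show ?thesis using \<kappa>(2)[of z] F(2)[of z] by simp
  next
    case False
    then have "z \<notin> supp \<kappa>" using \<kappa>(4) by blast
    then show ?thesis using notin_supp[of z \<kappa>] by simp
  qed
  then show "nonneg_fun \<psi>" by (simp add: nonneg_fun_def)
  show "supp \<psi> \<subseteq> supp \<kappa>" by (rule closure_mono) auto
qed

lemma Q_herm:
  assumes "z \<in> W"
  shows "Q z l k = cnj (Q z k l)"
proof -
  have \<kappa>W: "smooth_on W \<kappa>" using smooth_on_subset[OF \<kappa>(1)] by simp
  note d = smooth_on_differentiable[OF \<kappa>W assms] smooth_on_differentiable[OF F(1) assms]
  show ?thesis
    unfolding cutoff_hess_def complex_cnj_add complex_cnj_mult cnj_wirt_of_real[OF d(1)] cnj_wirt_of_real[OF d(2)]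
      cnj_wirt2_of_real[OF W(1) assms \<kappa>W]
    by simp
qed

lemma Q_off_supp:
  assumes "z \<notin> supp \<kappa>"
  shows "Q z k l = 0"
proof -
  have z: "z \<notin> supp \<kappa>c" using assms by simp
  have "z \<notin> supp (wirt \<i> l \<kappa>c)" using z supp_wirt by blast
  then show ?thesis unfolding cutoff_hess_def wirt_notin_supp[OF z] by (simp add: wirt_notin_supp)
qed

text \<open>Off the support of \<kappa> both sides vanish. On it \<kappa>2 = 1, and in the Leibniz
  rule the term with both derivatives on \<open>F\<close> is - \<kappa> \<omega>.\<close>

lemma ddbar_\<psi>: "ddbar \<psi> k l z = \<kappa>2c z * Q z k l + (-1) * (\<kappa>c z * \<omega> z k l)"
proof (cases "z \<in> supp \<kappa>")
  case True
  then have z: "z \<in> W" using \<kappa>(4) by blast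
  have "smooth_on W \<kappa>c" by (rule smooth_on_of_real[OF W(1) smooth_on_subset[OF \<kappa>(1)]]) simp
  from wirt2_mult[OF W(1) z this Fc, of "- \<i>" k \<i> l] \<kappa>2(5)[OF True] show ?thesis
    unfolding cutoff_hess_def by (simp add: algebra_simps)
next
  case False
  then have z: "z \<notin> supp \<psi>" using \<psi>(3) by blast
  have "z \<notin> supp (wirt \<i> l \<psi>)" using z supp_wirt by blast
  then show ?thesis using Q_off_supp[OF False] notin_supp[OF False] by (simp add: wirt_notin_supp)
qed

lemma psd_gap: "z \<in> W \<Longrightarrow> psd (\<lambda>k l. of_real (real CARD('n) * B) * delta k l - Q z k l)"
  by (rule psd_dominated) (rule Q_herm, assumption, rule B)

lemma \<kappa>2Q: "(\<lambda>z. \<kappa>2c z * Q z k l) \<in> Dtest W"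
  by (rule Dtest_mult[OF \<kappa>2c(1) W(1) \<kappa>2c_supp Q_smooth])

lemma \<kappa>\<omega>: "(\<lambda>z. \<kappa>c z * \<omega> z k l) \<in> Dtest W"
  by (rule Dtest_mult[OF \<kappa>c W(1) \<kappa>c_supp \<omega>_smooth])

text \<open>The inequality dd^c M \<ge> 0 tested on \<kappa> F reads 0 \<le> M(\<kappa>2 Q) -
  M(\<kappa> \<omega>), contracted over both indices. In the first term \<open>Q\<close> is
  dominated by n B times the identity, whose contraction with \<open>M\<close> is the trace.\<close>

lemma cutoff_mass_bound:
  assumes M: "pos_form \<Omega> M" and psh: "psh_form \<Omega> M"
  shows "Re (\<Sum>k\<in>UNIV. \<Sum>l\<in>UNIV. M (\<lambda>z. \<kappa>c z * \<omega> z k l) k l)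
      \<le> real CARD('n) * B * Re (\<Sum>k\<in>UNIV. M \<kappa>2c k k)"
proof -
  have M': "pos_form W M" by (rule pos_form_mono[OF M W(2)])
  have "0 \<le> Re (\<Sum>k\<in>UNIV. \<Sum>l\<in>UNIV. M (ddbar \<psi> k l) k l)"
    using psh Dtest_mono[OF \<psi>(1) W(2)] \<psi>(2) unfolding psh_form_def by simp
  also have "(\<Sum>k\<in>UNIV. \<Sum>l\<in>UNIV. M (ddbar \<psi> k l) k l)
     = (\<Sum>k\<in>UNIV. \<Sum>l\<in>UNIV. M (\<lambda>z. \<kappa>2c z * Q z k l) k l) - (\<Sum>k\<in>UNIV. \<Sum>l\<in>UNIV. M (\<lambda>z. \<kappa>c z * \<omega> z k l) k l)"
  proof -
    have "M (ddbar \<psi> k l) k l = M (\<lambda>z. \<kappa>2c z * Q z k l) k l - M (\<lambda>z. \<kappa>c z * \<omega> z k l) k l" for k l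
    proof -
      have "M (ddbar \<psi> k l) k l = M (\<lambda>z. \<kappa>2c z * Q z k l + (-1) * (\<kappa>c z * \<omega> z k l)) k l"
        by (rule arg_cong[where f = "\<lambda>h. M h k l"]) (rule ext, rule ddbar_\<psi>)
      also have "\<dots> = M (\<lambda>z. \<kappa>2c z * Q z k l) k l + M (\<lambda>z. (-1) * (\<kappa>c z * \<omega> z k l)) k l"
        by (rule pos_form_add[OF M' \<kappa>2Q Dtest_scale[OF \<kappa>\<omega>]])
      also have "M (\<lambda>z. (-1) * (\<kappa>c z * \<omega> z k l)) k l = (-1) * M (\<lambda>z. \<kappa>c z * \<omega> z k l) k l"
        by (rule pos_form_scale[OF M' \<kappa>\<omega>])
      finally show ?thesis by simp
    qed
    then show ?thesis by (simp only: sum_subtractf)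
  qed
  finally have 1: "Re (\<Sum>k\<in>UNIV. \<Sum>l\<in>UNIV. M (\<lambda>z. \<kappa>c z * \<omega> z k l) k l)
     \<le> Re (\<Sum>k\<in>UNIV. \<Sum>l\<in>UNIV. M (\<lambda>z. \<kappa>2c z * Q z k l) k l)" by simp
  let ?c = "complex_of_real (real CARD('n) * B)"
  have "0 \<le> Re (\<Sum>k\<in>UNIV. \<Sum>l\<in>UNIV. M (\<lambda>z. \<kappa>2c z * (?c * delta k l - Q z k l)) k l)"
    by (rule pos_form_psd[OF M' \<kappa>2c W(1) \<kappa>2c_supp smooth_on_diff[OF W(1) smooth_on_const Q_smooth] psd_gap])
  also have "(\<Sum>k\<in>UNIV. \<Sum>l\<in>UNIV. M (\<lambda>z. \<kappa>2c z * (?c * delta k l - Q z k l)) k l)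
     = (\<Sum>k\<in>UNIV. \<Sum>l\<in>UNIV. ?c * delta k l * M \<kappa>2c k l) - (\<Sum>k\<in>UNIV. \<Sum>l\<in>UNIV. M (\<lambda>z. \<kappa>2c z * Q z k l) k l)"
  proof -
    have "M (\<lambda>z. \<kappa>2c z * (?c * delta k l - Q z k l)) k l = ?c * delta k l * M \<kappa>2c k l - M (\<lambda>z. \<kappa>2c z * Q z k l) k l" for k l
    proof -
      have "M (\<lambda>z. \<kappa>2c z * (?c * delta k l - Q z k l)) k l = M (\<lambda>z. (?c * delta k l) * \<kappa>2c z + (-1) * (\<kappa>2c z * Q z k l)) k l"
        by (rule arg_cong[where f = "\<lambda>h. M h k l"]) (simp add: fun_eq_iff algebra_simps)
      also have "\<dots> = M (\<lambda>z. (?c * delta k l) * \<kappa>2c z) k l + M (\<lambda>z. (-1) * (\<kappa>2c z * Q z k l)) k l"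
        by (rule pos_form_add[OF M' Dtest_scale[OF \<kappa>2c(1)] Dtest_scale[OF \<kappa>2Q]])
      also have "M (\<lambda>z. (?c * delta k l) * \<kappa>2c z) k l = (?c * delta k l) * M \<kappa>2c k l"
        by (rule pos_form_scale[OF M' \<kappa>2c(1)])
      also have "M (\<lambda>z. (-1) * (\<kappa>2c z * Q z k l)) k l = (-1) * M (\<lambda>z. \<kappa>2c z * Q z k l) k l"
        by (rule pos_form_scale[OF M' \<kappa>2Q])
      finally show ?thesis by simp
    qed
    then show ?thesis by (simp only: sum_subtractf)
  qed
  finally show ?thesis using 1 unfolding sum_delta_form by simp
qed

end

section \<open>Forms with two pairs of arguments\<close>

text \<open>The indices follow the argument lists of a current: k, m are holomorphic, l, q
  antiholomorphic, with k paired to l and m to q. Positivity concerns products of two constant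
  vectors, in the form in which a positive current provides it.\<close>

definition pos_form2 :: "(complex^'n::finite) set \<Rightarrow> ((complex^'n \<Rightarrow> complex) \<Rightarrow> 'n \<Rightarrow> 'n \<Rightarrow> 'n \<Rightarrow> 'n \<Rightarrow> complex) \<Rightarrow> bool" where
  "pos_form2 \<Omega> N \<longleftrightarrow>
     (\<forall>\<phi>\<in>Dtest \<Omega>. \<forall>\<psi>\<in>Dtest \<Omega>. \<forall>c k m l q. N (\<lambda>z. c * \<phi> z + \<psi> z) k m l q = c * N \<phi> k m l q + N \<psi> k m l q) \<and>
     (\<forall>\<phi>\<in>Dtest \<Omega>. \<forall>v w. nonneg_fun \<phi> \<longrightarrow> 0 \<le> Re (\<Sum>k\<in>UNIV. \<Sum>l\<in>UNIV. v k * cnj (v l) *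
        (\<Sum>m\<in>UNIV. \<Sum>q\<in>UNIV. w m * cnj (w q) * N \<phi> k m l q)))"

lemma pos_form2_add:
  assumes "pos_form2 \<Omega> N" "\<phi> \<in> Dtest \<Omega>" "\<psi> \<in> Dtest \<Omega>"
  shows "N (\<lambda>z. c * \<phi> z + \<psi> z) k m l q = c * N \<phi> k m l q + N \<psi> k m l q"
  using assms by (simp add: pos_form2_def)

lemma pos_form2_slice:
  assumes "pos_form2 \<Omega> N"
  shows "pos_form \<Omega> (\<lambda>\<phi> k l. \<Sum>m\<in>UNIV. \<Sum>q\<in>UNIV. w m * cnj (w q) * N \<phi> k m l q)"
  unfolding pos_form_def
proof (intro conjI ballI allI impI)
  show "(\<Sum>m\<in>UNIV. \<Sum>q\<in>UNIV. w m * cnj (w q) * N (\<lambda>z. c * \<phi> z + \<psi> z) k m l q)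
     = c * (\<Sum>m\<in>UNIV. \<Sum>q\<in>UNIV. w m * cnj (w q) * N \<phi> k m l q) + (\<Sum>m\<in>UNIV. \<Sum>q\<in>UNIV. w m * cnj (w q) * N \<psi> k m l q)"
    if "\<phi> \<in> Dtest \<Omega>" "\<psi> \<in> Dtest \<Omega>" for \<phi> \<psi> c k l
    unfolding sum_distrib_left sum.distrib[symmetric] pos_form2_add[OF assms that]
    by (intro sum.cong refl) (simp add: algebra_simps)
  show "0 \<le> Re (\<Sum>k\<in>UNIV. \<Sum>l\<in>UNIV. v k * cnj (v l) * (\<Sum>m\<in>UNIV. \<Sum>q\<in>UNIV. w m * cnj (w q) * N \<phi> k m l q))"
    if "\<phi> \<in> Dtest \<Omega>" "nonneg_fun \<phi>" for \<phi> v
    using assms that by (simp add: pos_form2_def)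
qed

lemma sum4_swap:
  "(\<Sum>k\<in>A. \<Sum>l\<in>B. \<Sum>m\<in>C. \<Sum>q\<in>D. f k l m q) = (\<Sum>m\<in>C. \<Sum>q\<in>D. \<Sum>k\<in>A. \<Sum>l\<in>B. f k l m q)"
proof -
  have "(\<Sum>k\<in>A. \<Sum>l\<in>B. \<Sum>m\<in>C. \<Sum>q\<in>D. f k l m q) = (\<Sum>k\<in>A. \<Sum>m\<in>C. \<Sum>q\<in>D. \<Sum>l\<in>B. f k l m q)"
    by (intro sum.cong refl) (subst sum.swap, intro sum.cong refl, rule sum.swap)
  also have "\<dots> = (\<Sum>m\<in>C. \<Sum>q\<in>D. \<Sum>k\<in>A. \<Sum>l\<in>B. f k l m q)"
    by (subst sum.swap, intro sum.cong refl, rule sum.swap)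
  finally show ?thesis .
qed

lemma sum4_rotate:
  "(\<Sum>m\<in>A. \<Sum>q\<in>B. \<Sum>k\<in>C. \<Sum>l\<in>D. f m q k l) = (\<Sum>q\<in>B. \<Sum>l\<in>D. \<Sum>m\<in>A. \<Sum>k\<in>C. f m q k l)"
proof -
  have "(\<Sum>m\<in>A. \<Sum>q\<in>B. \<Sum>k\<in>C. \<Sum>l\<in>D. f m q k l) = (\<Sum>q\<in>B. \<Sum>m\<in>A. \<Sum>k\<in>C. \<Sum>l\<in>D. f m q k l)"
    by (rule sum.swap)
  also have "\<dots> = (\<Sum>q\<in>B. \<Sum>m\<in>A. \<Sum>l\<in>D. \<Sum>k\<in>C. f m q k l)"
    by (rule sum.cong[OF refl], rule sum.cong[OF refl], rule sum.swap)
  also have "\<dots> = (\<Sum>q\<in>B. \<Sum>l\<in>D. \<Sum>m\<in>A. \<Sum>k\<in>C. f m q k l)"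
    by (rule sum.cong[OF refl], rule sum.swap)
  finally show ?thesis .
qed

text \<open>The result for one pair is used twice. With a constant w in the pair (m, q), contraction
  of (k, l) with \<open>H\<close> is nonnegative; hence contraction with \<open>H\<close> leaves a
  positive form in (m, q), and to this form \<open>K\<close> is applied.\<close>

lemma pos_form2_psd:
  fixes N :: "(complex^'n::finite \<Rightarrow> complex) \<Rightarrow> 'n \<Rightarrow> 'n \<Rightarrow> 'n \<Rightarrow> 'n \<Rightarrow> complex"
  assumes N: "pos_form2 \<Omega> N" and V: "open V" "V \<subseteq> \<Omega>" and \<phi>: "\<phi> \<in> Dtest V" "nonneg_fun \<phi>"
    and H: "\<And>k l. smooth_on V (\<lambda>z. H z k l)" "\<And>z. z \<in> V \<Longrightarrow> psd (H z)"
    and K: "\<And>k l. smooth_on V (\<lambda>z. K z k l)" "\<And>z. z \<in> V \<Longrightarrow> psd (K z)"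
  shows "0 \<le> Re (\<Sum>m\<in>UNIV. \<Sum>q\<in>UNIV. \<Sum>k\<in>UNIV. \<Sum>l\<in>UNIV. N (\<lambda>z. \<phi> z * K z m q * H z k l) k m l q)"
proof -
  define M where "M \<psi> m q = (\<Sum>k\<in>UNIV. \<Sum>l\<in>UNIV. N (\<lambda>z. \<psi> z * H z k l) k m l q)" for \<psi> m q
  have sub: "supp \<psi> \<subseteq> V" if "\<psi> \<in> Dtest V" for \<psi>
    by (rule Cc_supp(2)[OF Dtest_subset_Cc[OF that]])
  have HD: "(\<lambda>z. \<psi> z * H z k l) \<in> Dtest \<Omega>" if "\<psi> \<in> Dtest V" for \<psi> k l
    by (rule Dtest_mono[OF Dtest_mult[OF that V(1) sub[OF that] H(1)] V(2)])
  have M: "pos_form V M"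
    unfolding pos_form_def
  proof (intro conjI ballI allI impI)
    show "M (\<lambda>z. c * \<psi> z + \<psi>' z) m q = c * M \<psi> m q + M \<psi>' m q"
      if D: "\<psi> \<in> Dtest V" "\<psi>' \<in> Dtest V" for \<psi> \<psi>' c m q
    proof -
      have "N (\<lambda>z. (c * \<psi> z + \<psi>' z) * H z k l) k m l q
        = c * N (\<lambda>z. \<psi> z * H z k l) k m l q + N (\<lambda>z. \<psi>' z * H z k l) k m l q" for k l
      proof -
        have "(\<lambda>z. (c * \<psi> z + \<psi>' z) * H z k l) = (\<lambda>z. c * (\<psi> z * H z k l) + \<psi>' z * H z k l)"
          by (simp add: fun_eq_iff algebra_simps)
        then show ?thesis using pos_form2_add[OF N HD[OF D(1)] HD[OF D(2)]] by simp
      qed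
      then show ?thesis by (simp add: M_def sum.distrib sum_distrib_left)
    qed
    show "0 \<le> Re (\<Sum>m\<in>UNIV. \<Sum>q\<in>UNIV. w m * cnj (w q) * M \<psi> m q)"
      if D: "\<psi> \<in> Dtest V" "nonneg_fun \<psi>" for \<psi> w
    proof -
      have "0 \<le> Re (\<Sum>k\<in>UNIV. \<Sum>l\<in>UNIV. (\<Sum>m\<in>UNIV. \<Sum>q\<in>UNIV. w m * cnj (w q) * N (\<lambda>z. \<psi> z * H z k l) k m l q))"
        by (rule pos_form_psd[OF pos_form2_slice[OF N] Dtest_mono[OF D(1) V(2)] D(2) V(1) sub[OF D(1)] H])
      also have "(\<Sum>k\<in>UNIV. \<Sum>l\<in>UNIV. (\<Sum>m\<in>UNIV. \<Sum>q\<in>UNIV. w m * cnj (w q) * N (\<lambda>z. \<psi> z * H z k l) k m l q))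
         = (\<Sum>m\<in>UNIV. \<Sum>q\<in>UNIV. w m * cnj (w q) * M \<psi> m q)"
        unfolding M_def sum_distrib_left by (rule sum4_swap)
      finally show ?thesis .
    qed
  qed
  have "0 \<le> Re (\<Sum>m\<in>UNIV. \<Sum>q\<in>UNIV. M (\<lambda>z. \<phi> z * K z m q) m q)"
    by (rule pos_form_psd[OF M \<phi> V(1) sub[OF \<phi>(1)] K])
  then show ?thesis unfolding M_def .
qed

lemma sum_antisymmetric:
  fixes f :: "'n::finite \<Rightarrow> 'n \<Rightarrow> complex"
  assumes "\<And>k l. f l k = - f k l"
  shows "(\<Sum>k\<in>UNIV. \<Sum>l\<in>UNIV. f k l) = 0"
proof -
  have "(\<Sum>k\<in>UNIV. \<Sum>l\<in>UNIV. f k l) = (\<Sum>k\<in>UNIV. \<Sum>l\<in>UNIV. f l k)" by (rule sum.swap)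
  also have "\<dots> = (\<Sum>k\<in>UNIV. \<Sum>l\<in>UNIV. - f k l)" by (intro sum.cong refl) (rule assms)
  also have "\<dots> = - (\<Sum>k\<in>UNIV. \<Sum>l\<in>UNIV. f k l)" by (simp only: sum_negf)
  finally show ?thesis by simp
qed

definition alternating2 :: "(complex^'n::finite) set \<Rightarrow> ((complex^'n \<Rightarrow> complex) \<Rightarrow> 'n \<Rightarrow> 'n \<Rightarrow> 'n \<Rightarrow> 'n \<Rightarrow> complex) \<Rightarrow> bool" where
  "alternating2 \<Omega> N \<longleftrightarrow> (\<forall>\<phi>\<in>Dtest \<Omega>. \<forall>k m l q. N \<phi> m k l q = - N \<phi> k m l q \<and> N \<phi> k m q l = - N \<phi> k m l q)"

lemma alternating2D:
  assumes "alternating2 \<Omega> N" "\<phi> \<in> Dtest \<Omega>"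
  shows "N \<phi> m k l q = - N \<phi> k m l q" "N \<phi> k m q l = - N \<phi> k m l q"
proof -
  note h = bspec[OF assms(1)[unfolded alternating2_def] assms(2), THEN spec, THEN spec, THEN spec, THEN spec]
  show "N \<phi> m k l q = - N \<phi> k m l q" by (rule conjunct1[OF h])
  show "N \<phi> k m q l = - N \<phi> k m l q" by (rule conjunct2[OF h])
qed

definition psh_form2 :: "(complex^'n::finite) set \<Rightarrow> ((complex^'n \<Rightarrow> complex) \<Rightarrow> 'n \<Rightarrow> 'n \<Rightarrow> 'n \<Rightarrow> 'n \<Rightarrow> complex) \<Rightarrow> bool" where
  "psh_form2 \<Omega> N \<longleftrightarrow> (\<forall>w. psh_form \<Omega> (\<lambda>\<phi> k l. \<Sum>m\<in>UNIV. \<Sum>q\<in>UNIV. w m * cnj (w q) * N \<phi> k m l q))"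

lemma ddbar_linear:
  assumes "\<phi> \<in> Dtest \<Omega>" "\<psi> \<in> Dtest \<Omega>"
  shows "ddbar (\<lambda>z. c * \<phi> z + \<psi> z) k l = (\<lambda>z. c * ddbar \<phi> k l z + ddbar \<psi> k l z)"
proof -
  have d: "f differentiable (at z)" if "f \<in> Dtest \<Omega>" for f z
    using that smooth_on_differentiable[of UNIV f z] by (simp add: Dtest_def)
  have lin: "wirt a j (\<lambda>z. c * f z + g z) = (\<lambda>z. c * wirt a j f z + wirt a j g z)"
    if "f \<in> Dtest \<Omega>" "g \<in> Dtest \<Omega>" for a j f g
  proof
    fix z
    have "wirt a j (\<lambda>z. c * f z + g z) z = wirt a j (\<lambda>z. c * f z) z + wirt a j g z"
      by (rule wirt_add[OF d[OF Dtest_scale[OF that(1)]] d[OF that(2)]])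
    then show "wirt a j (\<lambda>z. c * f z + g z) z = c * wirt a j f z + wirt a j g z"
      using wirt_cmult[OF d[OF that(1)]] by simp
  qed
  show ?thesis unfolding lin[OF assms] lin[OF Dtest_wirt[OF assms(1)] Dtest_wirt[OF assms(2)]] ..
qed

text \<open>Plurisubharmonicity is used up in the pair (k, l), and a positive form in the remaining
  pair (m, q) is left. This form may then be contracted with a positive matrix that varies with the
  point.\<close>

lemma pos_form_hessian:
  fixes N :: "(complex^'n::finite \<Rightarrow> complex) \<Rightarrow> 'n \<Rightarrow> 'n \<Rightarrow> 'n \<Rightarrow> 'n \<Rightarrow> complex"
  assumes N: "pos_form2 \<Omega> N" and psh: "psh_form2 \<Omega> N"
  shows "pos_form \<Omega> (\<lambda>\<psi> m q. \<Sum>k\<in>UNIV. \<Sum>l\<in>UNIV. N (ddbar \<psi> k l) k m l q)"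
  unfolding pos_form_def
proof (intro conjI ballI allI impI)
  show "(\<Sum>k\<in>UNIV. \<Sum>l\<in>UNIV. N (ddbar (\<lambda>z. c * \<phi> z + \<psi> z) k l) k m l q)
     = c * (\<Sum>k\<in>UNIV. \<Sum>l\<in>UNIV. N (ddbar \<phi> k l) k m l q) + (\<Sum>k\<in>UNIV. \<Sum>l\<in>UNIV. N (ddbar \<psi> k l) k m l q)"
    if D: "\<phi> \<in> Dtest \<Omega>" "\<psi> \<in> Dtest \<Omega>" for \<phi> \<psi> c m q
    unfolding ddbar_linear[OF D] pos_form2_add[OF N Dtest_wirt[OF Dtest_wirt[OF D(1)]] Dtest_wirt[OF Dtest_wirt[OF D(2)]]]
      sum.distrib sum_distrib_left ..
  show "0 \<le> Re (\<Sum>m\<in>UNIV. \<Sum>q\<in>UNIV. w m * cnj (w q) * (\<Sum>k\<in>UNIV. \<Sum>l\<in>UNIV. N (ddbar \<phi> k l) k m l q))"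
    if D: "\<phi> \<in> Dtest \<Omega>" "nonneg_fun \<phi>" for \<phi> w
  proof -
    have "0 \<le> Re (\<Sum>k\<in>UNIV. \<Sum>l\<in>UNIV. \<Sum>m\<in>UNIV. \<Sum>q\<in>UNIV. w m * cnj (w q) * N (ddbar \<phi> k l) k m l q)"
      using psh D unfolding psh_form2_def psh_form_def by simp
    also have "(\<Sum>k\<in>UNIV. \<Sum>l\<in>UNIV. \<Sum>m\<in>UNIV. \<Sum>q\<in>UNIV. w m * cnj (w q) * N (ddbar \<phi> k l) k m l q)
       = (\<Sum>m\<in>UNIV. \<Sum>q\<in>UNIV. w m * cnj (w q) * (\<Sum>k\<in>UNIV. \<Sum>l\<in>UNIV. N (ddbar \<phi> k l) k m l q))"
      unfolding sum_distrib_left by (rule sum4_swap)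
    finally show ?thesis .
  qed
qed

context cutoff
begin

text \<open>dd^c N is tested on the positive form \<psi> \<omega>, where \<psi> = \<kappa> F. Being
  a Hessian, \<omega> is closed: its derivatives are symmetric in two holomorphic or two
  antiholomorphic indices, in which \<open>N\<close> is antisymmetric. So all terms of the product
  rule that differentiate \<omega> sum to zero, and the Hessian of \<psi> times \<omega> remains, to
  which the estimate for one pair is adapted.\<close>

lemma cutoff_mass_bound2:
  assumes N: "pos_form2 \<Omega> N" and psh: "psh_form2 \<Omega> N" and alt: "alternating2 \<Omega> N"
    and \<omega>_psd: "\<And>z. z \<in> W \<Longrightarrow> psd (\<omega> z)"
  shows "Re (\<Sum>m\<in>UNIV. \<Sum>q\<in>UNIV. \<Sum>k\<in>UNIV. \<Sum>l\<in>UNIV. N (\<lambda>z. \<kappa>c z * \<omega> z m q * \<omega> z k l) k m l q)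
      \<le> real CARD('n) * B * Re (\<Sum>m\<in>UNIV. \<Sum>q\<in>UNIV. \<Sum>k\<in>UNIV. N (\<lambda>z. \<kappa>2c z * \<omega> z m q) k m k q)"
proof -
  have alt1: "N \<phi> m k l q = - N \<phi> k m l q" and alt2: "N \<phi> k m q l = - N \<phi> k m l q" if "\<phi> \<in> Dtest W" for \<phi> k m l q
    by (rule alternating2D[OF alt Dtest_mono[OF that W(2)]])+
  have add: "N (\<lambda>z. \<phi> z + \<psi> z) k m l q = N \<phi> k m l q + N \<psi> k m l q" if "\<phi> \<in> Dtest W" "\<psi> \<in> Dtest W" for \<phi> \<psi> k m l q
    using pos_form2_add[OF N Dtest_mono[OF that(1) W(2)] Dtest_mono[OF that(2) W(2)], of 1] by simp
  have scale: "N (\<lambda>z. c * \<phi> z) k m l q = c * N \<phi> k m l q" if "\<phi> \<in> Dtest W" for \<phi> c k m l q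
  proof -
    have z: "(\<lambda>z. 0) \<in> Dtest \<Omega>" by (rule Dtest_zero)
    have "N (\<lambda>z. 0) k m l q = 0" using pos_form2_add[OF N z z, of 1] by simp
    then show ?thesis using pos_form2_add[OF N Dtest_mono[OF that W(2)] z, of c] by simp
  qed
  have \<psi>s: "supp \<psi> \<subseteq> W" using \<psi>(3) \<kappa>(4) by (rule subset_trans)
  have ws: "supp (wirt c k \<psi>) \<subseteq> W" for c k using supp_wirt \<psi>s by (rule subset_trans)
  have mul: "(\<lambda>z. \<psi> z * f z) \<in> Dtest W" "(\<lambda>z. wirt c k \<psi> z * f z) \<in> Dtest W"
    "(\<lambda>z. ddbar \<psi> k l z * f z) \<in> Dtest W" if "smooth_on W f" for f c k l
    by (rule Dtest_mult[OF \<psi>(1) W(1) \<psi>s that], rule Dtest_mult[OF Dtest_wirt[OF \<psi>(1)] W(1) ws that],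
        rule Dtest_mult[OF Dtest_wirt[OF Dtest_wirt[OF \<psi>(1)]] W(1) subset_trans[OF supp_wirt ws] that])
  define \<omega>f where "\<omega>f m q z = \<omega> z m q" for m q z
  have \<omega>f: "smooth_on W (\<omega>f m q)" for m q unfolding \<omega>f_def[abs_def] by (rule \<omega>_smooth)
  note sw = smooth_on_wirt[OF W(1)]
  have \<omega>f_eq: "\<omega>f m q = (\<lambda>z. (-1) * ddbar Fc m q z)" for m q by (simp add: \<omega>f_def fun_eq_iff)
  have wirt_\<omega>: "wirt c k (\<omega>f m q) z = - wirt c k (ddbar Fc m q) z" if "z \<in> W" for c k m q z
    unfolding \<omega>f_eq using wirt_cmult[OF smooth_on_differentiable[OF sw[OF sw[OF Fc]] that], of c k "-1"] by simp
  \<comment> \<open>This says that \<omega> is closed under the antiholomorphic differential;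
    \<open>sym2\<close> is the holomorphic counterpart.\<close>
  have sym1: "wirt \<i> l (\<omega>f m q) z = wirt \<i> q (\<omega>f m l) z" if "z \<in> W" for l m q z
  proof -
    have "wirt \<i> l (ddbar Fc m q) z = wirt (- \<i>) m (wirt \<i> l (wirt \<i> q Fc)) z"
      by (rule wirt_commute[OF W(1) that sw[OF Fc]])
    also have "\<dots> = wirt (- \<i>) m (wirt \<i> q (wirt \<i> l Fc)) z"
      by (rule wirt_cong[OF W(1) that wirt_commute[OF W(1) _ Fc]])
    also have "\<dots> = wirt \<i> q (ddbar Fc m l) z"
      by (rule wirt_commute[OF W(1) that sw[OF Fc], symmetric])
    finally show ?thesis unfolding wirt_\<omega>[OF that] by simp
  qed
  have sym2: "wirt (- \<i>) k (\<omega>f m q) z = wirt (- \<i>) m (\<omega>f k q) z" if "z \<in> W" for k m q z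
    unfolding wirt_\<omega>[OF that] using wirt_commute[OF W(1) that sw[OF Fc]] by simp
  have sym3: "ddbar (\<omega>f m q) k l z = ddbar (\<omega>f m l) k q z" if "z \<in> W" for k l m q z
    by (rule wirt_cong[OF W(1) that sym1])
  have prod: "ddbar (\<lambda>z. \<psi> z * \<omega>f m q z) k l z = \<psi> z * ddbar (\<omega>f m q) k l z + (wirt (- \<i>) k \<psi> z * wirt \<i> l (\<omega>f m q) z
      + (wirt \<i> l \<psi> z * wirt (- \<i>) k (\<omega>f m q) z + ddbar \<psi> k l z * \<omega>f m q z))" for k l m q z
  proof (cases "z \<in> supp \<psi>")
    case True
    then have z: "z \<in> W" using \<psi>s by blast
    have "smooth_on W \<psi>" using \<psi>(1) smooth_on_subset[of UNIV \<psi> W] by (simp add: Dtest_def)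
    from wirt2_mult[OF W(1) z this \<omega>f] show ?thesis by simp
  next
    case False
    have "supp (\<lambda>z. \<psi> z * \<omega>f m q z) \<subseteq> supp \<psi>" by (rule closure_mono) auto
    then have f1: "z \<notin> supp (\<lambda>z. \<psi> z * \<omega>f m q z)" using False by blast
    then have f2: "z \<notin> supp (wirt \<i> l (\<lambda>z. \<psi> z * \<omega>f m q z))" using supp_wirt by blast
    have f3: "z \<notin> supp (wirt \<i> l \<psi>)" using False supp_wirt by blast
    show ?thesis unfolding wirt_notin_supp[OF f2] wirt_notin_supp[OF f3] wirt_notin_supp[OF False] notin_supp[OF False] by simp
  qed
  have eq: "N f k m l q = N g k m l q" if "\<And>z. f z = g z" for f g k m l q
  proof -
    have "f = g" by (rule ext) (rule that)
    then show ?thesis by simp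
  qed
  have zero_off: "\<psi> z = 0" "wirt c k \<psi> z = 0" if "z \<notin> W" for z c k
  proof -
    have z: "z \<notin> supp \<psi>" using that \<psi>s by blast
    show "\<psi> z = 0" by (rule notin_supp[OF z])
    show "wirt c k \<psi> z = 0" by (rule wirt_notin_supp[OF z])
  qed
  have split: "N (ddbar (\<lambda>z. \<psi> z * \<omega>f m q z) k l) k m l q
     = N (\<lambda>z. \<psi> z * ddbar (\<omega>f m q) k l z) k m l q + (N (\<lambda>z. wirt (- \<i>) k \<psi> z * wirt \<i> l (\<omega>f m q) z) k m l q
      + (N (\<lambda>z. wirt \<i> l \<psi> z * wirt (- \<i>) k (\<omega>f m q) z) k m l q + N (\<lambda>z. ddbar \<psi> k l z * \<omega>f m q z) k m l q))" for k m l q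
  proof -
    note D = mul(1)[OF sw[OF sw[OF \<omega>f]]] mul(2)[OF sw[OF \<omega>f]] mul(3)[OF \<omega>f]
    have "N (ddbar (\<lambda>z. \<psi> z * \<omega>f m q z) k l) k m l q
      = N (\<lambda>z. \<psi> z * ddbar (\<omega>f m q) k l z + (wirt (- \<i>) k \<psi> z * wirt \<i> l (\<omega>f m q) z
      + (wirt \<i> l \<psi> z * wirt (- \<i>) k (\<omega>f m q) z + ddbar \<psi> k l z * \<omega>f m q z))) k m l q"
      by (rule eq) (rule prod)
    also have "\<dots> = N (\<lambda>z. \<psi> z * ddbar (\<omega>f m q) k l z) k m l q + N (\<lambda>z. wirt (- \<i>) k \<psi> z * wirt \<i> l (\<omega>f m q) z
      + (wirt \<i> l \<psi> z * wirt (- \<i>) k (\<omega>f m q) z + ddbar \<psi> k l z * \<omega>f m q z)) k m l q"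
      by (rule add[OF D(1) Dtest_add[OF D(2) Dtest_add[OF D(2) D(3)]]])
    also have "N (\<lambda>z. wirt (- \<i>) k \<psi> z * wirt \<i> l (\<omega>f m q) z
      + (wirt \<i> l \<psi> z * wirt (- \<i>) k (\<omega>f m q) z + ddbar \<psi> k l z * \<omega>f m q z)) k m l q
       = N (\<lambda>z. wirt (- \<i>) k \<psi> z * wirt \<i> l (\<omega>f m q) z) k m l q + N (\<lambda>z. wirt \<i> l \<psi> z * wirt (- \<i>) k (\<omega>f m q) z + ddbar \<psi> k l z * \<omega>f m q z) k m l q"
      by (rule add[OF D(2) Dtest_add[OF D(2) D(3)]])
    also have "N (\<lambda>z. wirt \<i> l \<psi> z * wirt (- \<i>) k (\<omega>f m q) z + ddbar \<psi> k l z * \<omega>f m q z) k m l q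
      = N (\<lambda>z. wirt \<i> l \<psi> z * wirt (- \<i>) k (\<omega>f m q) z) k m l q + N (\<lambda>z. ddbar \<psi> k l z * \<omega>f m q z) k m l q"
      by (rule add[OF D(2) D(3)])
    finally show ?thesis .
  qed
  \<comment> \<open>Both derivatives fall on \<omega>: the function is symmetric in l and q, and
    \<open>N\<close> antisymmetric.\<close>
  have z1: "(\<Sum>q\<in>UNIV. \<Sum>l\<in>UNIV. N (\<lambda>z. \<psi> z * ddbar (\<omega>f m q) k l z) k m l q) = 0" for k m
  proof (rule sum_antisymmetric)
    fix q l
    have "N (\<lambda>z. \<psi> z * ddbar (\<omega>f m l) k q z) k m q l = N (\<lambda>z. \<psi> z * ddbar (\<omega>f m q) k l z) k m q l"
    proof (rule eq)
      fix z show "\<psi> z * ddbar (\<omega>f m l) k q z = \<psi> z * ddbar (\<omega>f m q) k l z"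
      proof (cases "z \<in> W")
        case True
        then show ?thesis using sym3[where z = z and k = k and m = m and l = q and q = l] by simp
      next
        case False
        show ?thesis unfolding zero_off(1)[OF False] by simp
      qed
    qed
    also have "\<dots> = - N (\<lambda>z. \<psi> z * ddbar (\<omega>f m q) k l z) k m l q"
      by (rule alt2[OF mul(1)[OF sw[OF sw[OF \<omega>f]]]])
    finally show "N (\<lambda>z. \<psi> z * ddbar (\<omega>f m l) k q z) k m q l = - N (\<lambda>z. \<psi> z * ddbar (\<omega>f m q) k l z) k m l q" .
  qed
  have z2: "(\<Sum>q\<in>UNIV. \<Sum>l\<in>UNIV. N (\<lambda>z. wirt (- \<i>) k \<psi> z * wirt \<i> l (\<omega>f m q) z) k m l q) = 0" for k m
  proof (rule sum_antisymmetric)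
    fix q l
    have "N (\<lambda>z. wirt (- \<i>) k \<psi> z * wirt \<i> q (\<omega>f m l) z) k m q l = N (\<lambda>z. wirt (- \<i>) k \<psi> z * wirt \<i> l (\<omega>f m q) z) k m q l"
    proof (rule eq)
      fix z show "wirt (- \<i>) k \<psi> z * wirt \<i> q (\<omega>f m l) z = wirt (- \<i>) k \<psi> z * wirt \<i> l (\<omega>f m q) z"
      proof (cases "z \<in> W")
        case True
        then show ?thesis using sym1[where z = z and m = m and l = q and q = l] by simp
      next
        case False
        show ?thesis unfolding zero_off(2)[OF False] by simp
      qed
    qed
    also have "\<dots> = - N (\<lambda>z. wirt (- \<i>) k \<psi> z * wirt \<i> l (\<omega>f m q) z) k m l q"
      by (rule alt2[OF mul(2)[OF sw[OF \<omega>f]]])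
    finally show "N (\<lambda>z. wirt (- \<i>) k \<psi> z * wirt \<i> q (\<omega>f m l) z) k m q l = - N (\<lambda>z. wirt (- \<i>) k \<psi> z * wirt \<i> l (\<omega>f m q) z) k m l q" .
  qed
  \<comment> \<open>Here the derivative in z_k falls on \<omega>, so the cancellation takes place
    between k and m instead of l and q.\<close>
  have z3: "(\<Sum>m\<in>UNIV. \<Sum>k\<in>UNIV. N (\<lambda>z. wirt \<i> l \<psi> z * wirt (- \<i>) k (\<omega>f m q) z) k m l q) = 0" for l q
  proof (rule sum_antisymmetric)
    fix m k
    have "N (\<lambda>z. wirt \<i> l \<psi> z * wirt (- \<i>) m (\<omega>f k q) z) m k l q = N (\<lambda>z. wirt \<i> l \<psi> z * wirt (- \<i>) k (\<omega>f m q) z) m k l q"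
    proof (rule eq)
      fix z show "wirt \<i> l \<psi> z * wirt (- \<i>) m (\<omega>f k q) z = wirt \<i> l \<psi> z * wirt (- \<i>) k (\<omega>f m q) z"
      proof (cases "z \<in> W")
        case True
        then show ?thesis using sym2[where z = z and m = k and k = m and q = q] by simp
      next
        case False
        show ?thesis unfolding zero_off(2)[OF False] by simp
      qed
    qed
    also have "\<dots> = - N (\<lambda>z. wirt \<i> l \<psi> z * wirt (- \<i>) k (\<omega>f m q) z) k m l q"
      by (rule alt1[OF mul(2)[OF sw[OF \<omega>f]]])
    finally show "N (\<lambda>z. wirt \<i> l \<psi> z * wirt (- \<i>) m (\<omega>f k q) z) m k l q = - N (\<lambda>z. wirt \<i> l \<psi> z * wirt (- \<i>) k (\<omega>f m q) z) k m l q" .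
  qed
  let ?S = "\<lambda>f. \<Sum>m\<in>(UNIV::'n set). \<Sum>q\<in>(UNIV::'n set). \<Sum>k\<in>(UNIV::'n set). \<Sum>l\<in>(UNIV::'n set). (f m q k l :: complex)"
  have "0 \<le> Re (?S (\<lambda>m q k l. N (ddbar (\<lambda>z. \<psi> z * \<omega>f m q z) k l) k m l q))"
    unfolding \<omega>f_def
    by (rule pos_form_psd[OF pos_form_hessian[OF N psh] Dtest_mono[OF \<psi>(1) W(2)] \<psi>(2) W(1) \<psi>s \<omega>_smooth \<omega>_psd])
  also have "?S (\<lambda>m q k l. N (ddbar (\<lambda>z. \<psi> z * \<omega>f m q z) k l) k m l q)
     = ?S (\<lambda>m q k l. N (\<lambda>z. \<psi> z * ddbar (\<omega>f m q) k l z) k m l q) + (?S (\<lambda>m q k l. N (\<lambda>z. wirt (- \<i>) k \<psi> z * wirt \<i> l (\<omega>f m q) z) k m l q)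
      + (?S (\<lambda>m q k l. N (\<lambda>z. wirt \<i> l \<psi> z * wirt (- \<i>) k (\<omega>f m q) z) k m l q) + ?S (\<lambda>m q k l. N (\<lambda>z. ddbar \<psi> k l z * \<omega>f m q z) k m l q)))"
    unfolding split sum.distrib ..
  also have "?S (\<lambda>m q k l. N (\<lambda>z. \<psi> z * ddbar (\<omega>f m q) k l z) k m l q) = 0"
    by (rule sum.neutral, rule ballI, subst sum.swap, rule sum.neutral, rule ballI, rule z1)
  also have "?S (\<lambda>m q k l. N (\<lambda>z. wirt (- \<i>) k \<psi> z * wirt \<i> l (\<omega>f m q) z) k m l q) = 0"
    by (rule sum.neutral, rule ballI, subst sum.swap, rule sum.neutral, rule ballI, rule z2)
  also have "?S (\<lambda>m q k l. N (\<lambda>z. wirt \<i> l \<psi> z * wirt (- \<i>) k (\<omega>f m q) z) k m l q) = 0"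
  proof -
    have "?S (\<lambda>m q k l. N (\<lambda>z. wirt \<i> l \<psi> z * wirt (- \<i>) k (\<omega>f m q) z) k m l q)
      = (\<Sum>q\<in>UNIV. \<Sum>l\<in>UNIV. \<Sum>m\<in>UNIV. \<Sum>k\<in>UNIV. N (\<lambda>z. wirt \<i> l \<psi> z * wirt (- \<i>) k (\<omega>f m q) z) k m l q)"
      by (rule sum4_rotate)
    then show ?thesis unfolding z3 by simp
  qed
  also have "?S (\<lambda>m q k l. N (\<lambda>z. ddbar \<psi> k l z * \<omega>f m q z) k m l q)
     = ?S (\<lambda>m q k l. N (\<lambda>z. \<kappa>2c z * \<omega> z m q * Q z k l) k m l q) - ?S (\<lambda>m q k l. N (\<lambda>z. \<kappa>c z * \<omega> z m q * \<omega> z k l) k m l q)"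
  proof -
    have D1: "(\<lambda>z. \<kappa>2c z * (\<omega> z m q * Q z k l)) \<in> Dtest W" for m q k l
      by (rule Dtest_mult[OF \<kappa>2c(1) W(1) \<kappa>2c_supp]) (intro smooth_on_mult W \<omega>_smooth Q_smooth)
    have D2: "(\<lambda>z. \<kappa>c z * (\<omega> z m q * \<omega> z k l)) \<in> Dtest W" for m q k l
      by (rule Dtest_mult[OF \<kappa>c W(1) \<kappa>c_supp]) (intro smooth_on_mult W \<omega>_smooth)
    have "N (\<lambda>z. ddbar \<psi> k l z * \<omega>f m q z) k m l q
       = N (\<lambda>z. \<kappa>2c z * \<omega> z m q * Q z k l) k m l q - N (\<lambda>z. \<kappa>c z * \<omega> z m q * \<omega> z k l) k m l q" for m q k l
    proof -
      have "N (\<lambda>z. ddbar \<psi> k l z * \<omega>f m q z) k m l q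
        = N (\<lambda>z. \<kappa>2c z * (\<omega> z m q * Q z k l) + (-1) * (\<kappa>c z * (\<omega> z m q * \<omega> z k l))) k m l q"
        by (rule eq) (simp only: ddbar_\<psi> \<omega>f_def, simp add: algebra_simps)
      also have "\<dots> = N (\<lambda>z. \<kappa>2c z * (\<omega> z m q * Q z k l)) k m l q + N (\<lambda>z. (-1) * (\<kappa>c z * (\<omega> z m q * \<omega> z k l))) k m l q"
        by (rule add[OF D1 Dtest_scale[OF D2]])
      also have "N (\<lambda>z. (-1) * (\<kappa>c z * (\<omega> z m q * \<omega> z k l))) k m l q = (-1) * N (\<lambda>z. \<kappa>c z * (\<omega> z m q * \<omega> z k l)) k m l q"
        by (rule scale[OF D2])
      finally show ?thesis by (simp add: mult.assoc)
    qed
    then show ?thesis by (simp only: sum_subtractf)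
  qed
  finally have 1: "Re (?S (\<lambda>m q k l. N (\<lambda>z. \<kappa>c z * \<omega> z m q * \<omega> z k l) k m l q))
     \<le> Re (?S (\<lambda>m q k l. N (\<lambda>z. \<kappa>2c z * \<omega> z m q * Q z k l) k m l q))" by simp
  let ?c = "complex_of_real (real CARD('n) * B)"
  \<comment> \<open>As \<omega> is positive, \<open>Q\<close> may be replaced in the pair (k, l) by
    the larger matrix n B times the identity.\<close>
  have "0 \<le> Re (?S (\<lambda>m q k l. N (\<lambda>z. \<kappa>2c z * \<omega> z m q * (?c * delta k l - Q z k l)) k m l q))"
    by (rule pos_form2_psd[OF N W \<kappa>2c smooth_on_diff[OF W(1) smooth_on_const Q_smooth] psd_gap \<omega>_smooth \<omega>_psd])
  also have "?S (\<lambda>m q k l. N (\<lambda>z. \<kappa>2c z * \<omega> z m q * (?c * delta k l - Q z k l)) k m l q)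
     = ?S (\<lambda>m q k l. ?c * delta k l * N (\<lambda>z. \<kappa>2c z * \<omega> z m q) k m l q) - ?S (\<lambda>m q k l. N (\<lambda>z. \<kappa>2c z * \<omega> z m q * Q z k l) k m l q)"
  proof -
    have D1: "(\<lambda>z. \<kappa>2c z * (\<omega> z m q * Q z k l)) \<in> Dtest W" for m q k l
      by (rule Dtest_mult[OF \<kappa>2c(1) W(1) \<kappa>2c_supp]) (intro smooth_on_mult W \<omega>_smooth Q_smooth)
    have D2: "(\<lambda>z. \<kappa>2c z * \<omega> z m q) \<in> Dtest W" for m q
      by (rule Dtest_mult[OF \<kappa>2c(1) W(1) \<kappa>2c_supp \<omega>_smooth])
    have "N (\<lambda>z. \<kappa>2c z * \<omega> z m q * (?c * delta k l - Q z k l)) k m l q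
       = ?c * delta k l * N (\<lambda>z. \<kappa>2c z * \<omega> z m q) k m l q - N (\<lambda>z. \<kappa>2c z * \<omega> z m q * Q z k l) k m l q" for m q k l
    proof -
      have "N (\<lambda>z. \<kappa>2c z * \<omega> z m q * (?c * delta k l - Q z k l)) k m l q
        = N (\<lambda>z. (?c * delta k l) * (\<kappa>2c z * \<omega> z m q) + (-1) * (\<kappa>2c z * (\<omega> z m q * Q z k l))) k m l q"
        by (rule eq) (simp add: algebra_simps)
      also have "\<dots> = N (\<lambda>z. (?c * delta k l) * (\<kappa>2c z * \<omega> z m q)) k m l q + N (\<lambda>z. (-1) * (\<kappa>2c z * (\<omega> z m q * Q z k l))) k m l q"
        by (rule add[OF Dtest_scale[OF D2] Dtest_scale[OF D1]])
      also have "N (\<lambda>z. (-1) * (\<kappa>2c z * (\<omega> z m q * Q z k l))) k m l q = (-1) * N (\<lambda>z. \<kappa>2c z * (\<omega> z m q * Q z k l)) k m l q"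
        by (rule scale[OF D1])
      also have "N (\<lambda>z. (?c * delta k l) * (\<kappa>2c z * \<omega> z m q)) k m l q = (?c * delta k l) * N (\<lambda>z. \<kappa>2c z * \<omega> z m q) k m l q"
        by (rule scale[OF D2])
      finally show ?thesis by (simp add: mult.assoc)
    qed
    then show ?thesis by (simp only: sum_subtractf)
  qed
  also have "?S (\<lambda>m q k l. ?c * delta k l * N (\<lambda>z. \<kappa>2c z * \<omega> z m q) k m l q)
     = ?c * (\<Sum>m\<in>UNIV. \<Sum>q\<in>UNIV. \<Sum>k\<in>UNIV. N (\<lambda>z. \<kappa>2c z * \<omega> z m q) k m k q)"
    unfolding sum_delta_form sum_distrib_left ..
  finally show ?thesis using 1 by simp
qed

end

section \<open>The weight\<close>

text \<open>Plurisubharmonicity of -F with a quantified lower bound: \<omega> is at least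
  \<open>c\<close> times the identity, where \<open>c\<close> depends on the point. A mass bound for
  \<omega> thereby turns into one for the function \<open>c\<close>.\<close>

locale cutoff_weight = cutoff \<Omega> W F \<kappa> \<kappa>2 B
  for \<Omega> W :: "(complex^'n::finite) set" and F \<kappa> \<kappa>2 B +
  fixes c :: "complex^'n::finite \<Rightarrow> real"
  assumes c: "smooth_on W c" "\<And>z. z \<in> W \<Longrightarrow> 0 \<le> c z"
    and c_psd: "\<And>z. z \<in> W \<Longrightarrow> psd (\<lambda>k l. - ddbar (\<lambda>z. complex_of_real (F z)) k l z - complex_of_real (c z) * delta k l)"
begin

abbreviation "cc \<equiv> \<lambda>z. complex_of_real (c z)"

lemma cc: "smooth_on W cc"
  by (rule smooth_on_of_real[OF W(1) c(1)])

lemma cdelta: "smooth_on W (\<lambda>z. cc z * delta k l)" "z \<in> W \<Longrightarrow> psd (\<lambda>k l. cc z * delta k l)"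
  by (intro smooth_on_mult W cc smooth_on_const) (intro psd_scale_delta c(2))

lemma gap_smooth: "smooth_on W (\<lambda>z. \<omega> z k l - cc z * delta k l)"
  by (intro smooth_on_diff W \<omega>_smooth cdelta)

lemma \<omega>_psd: "z \<in> W \<Longrightarrow> psd (\<omega> z)"
  using psd_add[OF c_psd[of z] cdelta(2)[of z]] by simp

lemma \<kappa>c_nonneg: "nonneg_fun \<kappa>c"
  by (simp add: nonneg_fun_def \<kappa>(2))

lemma \<kappa>cc: "(\<lambda>z. \<kappa>c z * cc z) \<in> Dtest W"
  by (rule Dtest_mult[OF \<kappa>c W(1) \<kappa>c_supp cc])

lemma weight_mass_bound:
  assumes M: "pos_form \<Omega> M" and psh: "psh_form \<Omega> M"
  shows "Re (\<Sum>k\<in>UNIV. M (\<lambda>z. \<kappa>c z * cc z) k k) \<le> real CARD('n) * B * Re (\<Sum>k\<in>UNIV. M \<kappa>2c k k)"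
proof -
  have M': "pos_form W M" by (rule pos_form_mono[OF M W(2)])
  have "0 \<le> Re (\<Sum>k\<in>UNIV. \<Sum>l\<in>UNIV. M (\<lambda>z. \<kappa>c z * (\<omega> z k l - cc z * delta k l)) k l)"
    by (rule pos_form_psd[OF M' \<kappa>c \<kappa>c_nonneg W(1) \<kappa>c_supp gap_smooth c_psd])
  also have "(\<Sum>k\<in>UNIV. \<Sum>l\<in>UNIV. M (\<lambda>z. \<kappa>c z * (\<omega> z k l - cc z * delta k l)) k l)
     = (\<Sum>k\<in>UNIV. \<Sum>l\<in>UNIV. M (\<lambda>z. \<kappa>c z * \<omega> z k l) k l) - (\<Sum>k\<in>UNIV. \<Sum>l\<in>UNIV. 1 * delta k l * M (\<lambda>z. \<kappa>c z * cc z) k l)"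
  proof -
    have "M (\<lambda>z. \<kappa>c z * (\<omega> z k l - cc z * delta k l)) k l
      = M (\<lambda>z. \<kappa>c z * \<omega> z k l) k l - 1 * delta k l * M (\<lambda>z. \<kappa>c z * cc z) k l" for k l
    proof -
      have "M (\<lambda>z. \<kappa>c z * (\<omega> z k l - cc z * delta k l)) k l = M (\<lambda>z. \<kappa>c z * \<omega> z k l + (- delta k l) * (\<kappa>c z * cc z)) k l"
        by (rule arg_cong[where f = "\<lambda>h. M h k l"]) (simp add: fun_eq_iff algebra_simps)
      also have "\<dots> = M (\<lambda>z. \<kappa>c z * \<omega> z k l) k l + M (\<lambda>z. (- delta k l) * (\<kappa>c z * cc z)) k l"
        by (rule pos_form_add[OF M' \<kappa>\<omega> Dtest_scale[OF \<kappa>cc]])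
      also have "M (\<lambda>z. (- delta k l) * (\<kappa>c z * cc z)) k l = (- delta k l) * M (\<lambda>z. \<kappa>c z * cc z) k l"
        by (rule pos_form_scale[OF M' \<kappa>cc])
      finally show ?thesis by simp
    qed
    then show ?thesis by (simp only: sum_subtractf)
  qed
  finally show ?thesis using cutoff_mass_bound[OF M psh] unfolding sum_delta_form by simp
qed

text \<open>The product of \<omega> with itself is \<omega> (\<omega> - c I) + (\<omega> - c I) c I
  + c^2 I I, where the left factor acts on (m, q) and the right one on (k, l). The first two
  summands are nonnegative on \<open>N\<close>, so the last one is bounded by the whole.\<close>

lemma weight_square_mass_bound:
  assumes N: "pos_form2 \<Omega> N" and psh: "psh_form2 \<Omega> N" and alt: "alternating2 \<Omega> N"
  shows "Re (\<Sum>m\<in>UNIV. \<Sum>k\<in>UNIV. N (\<lambda>z. \<kappa>c z * (cc z * cc z)) k m k m)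
      \<le> real CARD('n) * B * Re (\<Sum>m\<in>UNIV. \<Sum>q\<in>UNIV. \<Sum>k\<in>UNIV. N (\<lambda>z. \<kappa>2c z * \<omega> z m q) k m k q)"
proof -
  let ?S = "\<lambda>f. \<Sum>m\<in>(UNIV::'n set). \<Sum>q\<in>(UNIV::'n set). \<Sum>k\<in>(UNIV::'n set). \<Sum>l\<in>(UNIV::'n set). (f m q k l :: complex)"
  have add: "N (\<lambda>z. a * \<phi> z + \<psi> z) k m l q = a * N \<phi> k m l q + N \<psi> k m l q" if "\<phi> \<in> Dtest W" "\<psi> \<in> Dtest W" for a \<phi> \<psi> k m l q
    by (rule pos_form2_add[OF N Dtest_mono[OF that(1) W(2)] Dtest_mono[OF that(2) W(2)]])
  have "0 \<le> Re (?S (\<lambda>m q k l. N (\<lambda>z. \<kappa>c z * \<omega> z m q * (\<omega> z k l - cc z * delta k l)) k m l q))"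
    by (rule pos_form2_psd[OF N W \<kappa>c \<kappa>c_nonneg gap_smooth c_psd \<omega>_smooth \<omega>_psd])
  moreover have "0 \<le> Re (?S (\<lambda>m q k l. N (\<lambda>z. \<kappa>c z * (\<omega> z m q - cc z * delta m q) * (cc z * delta k l)) k m l q))"
    by (rule pos_form2_psd[OF N W \<kappa>c \<kappa>c_nonneg cdelta gap_smooth c_psd])
  moreover have "?S (\<lambda>m q k l. N (\<lambda>z. \<kappa>c z * \<omega> z m q * \<omega> z k l) k m l q)
     = ?S (\<lambda>m q k l. N (\<lambda>z. \<kappa>c z * \<omega> z m q * (\<omega> z k l - cc z * delta k l)) k m l q)
     + (?S (\<lambda>m q k l. N (\<lambda>z. \<kappa>c z * (\<omega> z m q - cc z * delta m q) * (cc z * delta k l)) k m l q)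
      + ?S (\<lambda>m q k l. delta m q * delta k l * N (\<lambda>z. \<kappa>c z * (cc z * cc z)) k m l q))"
  proof -
    have D1: "(\<lambda>z. \<kappa>c z * \<omega> z m q * (\<omega> z k l - cc z * delta k l)) \<in> Dtest W" for m q k l
      unfolding mult.assoc by (rule Dtest_mult[OF \<kappa>c W(1) \<kappa>c_supp]) (intro smooth_on_mult W \<omega>_smooth gap_smooth)
    have D2: "(\<lambda>z. \<kappa>c z * (\<omega> z m q - cc z * delta m q) * (cc z * delta k l)) \<in> Dtest W" for m q k l
      unfolding mult.assoc[of "\<kappa>c _"]
      by (rule Dtest_mult[OF \<kappa>c W(1) \<kappa>c_supp]) (intro smooth_on_mult[OF W(1)] gap_smooth cdelta)
    have D3: "(\<lambda>z. \<kappa>c z * (cc z * cc z)) \<in> Dtest W"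
      by (rule Dtest_mult[OF \<kappa>c W(1) \<kappa>c_supp]) (intro smooth_on_mult W cc)
    have D4: "(\<lambda>z. delta m q * delta k l * (\<kappa>c z * (cc z * cc z))) \<in> Dtest W" for m q k l by (rule Dtest_scale[OF D3])
    have "N (\<lambda>z. \<kappa>c z * \<omega> z m q * \<omega> z k l) k m l q
       = N (\<lambda>z. \<kappa>c z * \<omega> z m q * (\<omega> z k l - cc z * delta k l)) k m l q
     + (N (\<lambda>z. \<kappa>c z * (\<omega> z m q - cc z * delta m q) * (cc z * delta k l)) k m l q
      + delta m q * delta k l * N (\<lambda>z. \<kappa>c z * (cc z * cc z)) k m l q)" for m q k l
    proof -
      have "(\<lambda>z. \<kappa>c z * \<omega> z m q * \<omega> z k l) = (\<lambda>z. 1 * (\<kappa>c z * \<omega> z m q * (\<omega> z k l - cc z * delta k l))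
         + (1 * (\<kappa>c z * (\<omega> z m q - cc z * delta m q) * (cc z * delta k l)) + (delta m q * delta k l) * (\<kappa>c z * (cc z * cc z))))"
        by (rule ext) (simp add: algebra_simps)
      then have "N (\<lambda>z. \<kappa>c z * \<omega> z m q * \<omega> z k l) k m l q
        = N (\<lambda>z. 1 * (\<kappa>c z * \<omega> z m q * (\<omega> z k l - cc z * delta k l))
         + (1 * (\<kappa>c z * (\<omega> z m q - cc z * delta m q) * (cc z * delta k l)) + (delta m q * delta k l) * (\<kappa>c z * (cc z * cc z)))) k m l q"
        by (rule arg_cong[where f = "\<lambda>h. N h k m l q"])
      also have "\<dots> = 1 * N (\<lambda>z. \<kappa>c z * \<omega> z m q * (\<omega> z k l - cc z * delta k l)) k m l q
        + N (\<lambda>z. 1 * (\<kappa>c z * (\<omega> z m q - cc z * delta m q) * (cc z * delta k l)) + (delta m q * delta k l) * (\<kappa>c z * (cc z * cc z))) k m l q"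
        by (rule add[OF D1 Dtest_add[OF Dtest_scale[OF D2] D4]])
      also have "N (\<lambda>z. 1 * (\<kappa>c z * (\<omega> z m q - cc z * delta m q) * (cc z * delta k l)) + (delta m q * delta k l) * (\<kappa>c z * (cc z * cc z))) k m l q
        = 1 * N (\<lambda>z. \<kappa>c z * (\<omega> z m q - cc z * delta m q) * (cc z * delta k l)) k m l q + N (\<lambda>z. (delta m q * delta k l) * (\<kappa>c z * (cc z * cc z))) k m l q"
        by (rule add[OF D2 D4])
      also have "N (\<lambda>z. (delta m q * delta k l) * (\<kappa>c z * (cc z * cc z))) k m l q = (delta m q * delta k l) * N (\<lambda>z. \<kappa>c z * (cc z * cc z)) k m l q"
      proof -
        have "N (\<lambda>z. 0) k m l q = 0" using add[OF Dtest_zero Dtest_zero, of 1 k m l q] by simp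
        then show ?thesis using add[OF D3 Dtest_zero, of "delta m q * delta k l"] by simp
      qed
      finally show ?thesis by simp
    qed
    then show ?thesis by (simp only: sum.distrib)
  qed
  moreover have "?S (\<lambda>m q k l. delta m q * delta k l * N (\<lambda>z. \<kappa>c z * (cc z * cc z)) k m l q)
     = (\<Sum>m\<in>UNIV. \<Sum>k\<in>UNIV. N (\<lambda>z. \<kappa>c z * (cc z * cc z)) k m k m)"
    unfolding sum_delta_form
    using sum_delta_form[of 1 "\<lambda>m q. \<Sum>k\<in>UNIV. N (\<lambda>z. \<kappa>c z * (cc z * cc z)) k m k q"] by simp
  ultimately show ?thesis
    using cutoff_mass_bound2[OF N psh alt \<omega>_psd] by simp
qed

end

lemma psd_scale:
  assumes "0 \<le> a" "psd H"
  shows "psd (\<lambda>k l. complex_of_real a * H k l)"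
  unfolding psd_def
proof (intro conjI allI)
  show "complex_of_real a * H l k = cnj (complex_of_real a * H k l)" for k l
    using psd_herm[OF assms(2), of l k] by simp
  fix v
  have "(\<Sum>k\<in>UNIV. \<Sum>l\<in>UNIV. complex_of_real a * H k l * v k * cnj (v l))
     = complex_of_real a * (\<Sum>k\<in>UNIV. \<Sum>l\<in>UNIV. H k l * v k * cnj (v l))"
    by (simp add: sum_distrib_left mult.assoc)
  then show "0 \<le> Re (\<Sum>k\<in>UNIV. \<Sum>l\<in>UNIV. complex_of_real a * H k l * v k * cnj (v l))"
    using psd_form[OF assms(2), of v] assms(1) by simp
qed

lemma psd_rank_one: "psd (\<lambda>k l. u k * cnj (u l))"
  unfolding psd_def
proof (intro conjI allI)
  show "u l * cnj (u k) = cnj (u k * cnj (u l))" for k l by simp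
  fix v
  have "(\<Sum>k\<in>UNIV. \<Sum>l\<in>UNIV. u k * cnj (u l) * v k * cnj (v l)) = (\<Sum>k\<in>UNIV. u k * v k) * cnj (\<Sum>k\<in>UNIV. u k * v k)"
    unfolding cnj_sum sum_product by (intro sum.cong refl) simp
  also have "\<dots> = of_real ((cmod (\<Sum>k\<in>UNIV. u k * v k))\<^sup>2)" by (rule complex_norm_square[symmetric])
  finally show "0 \<le> Re (\<Sum>k\<in>UNIV. \<Sum>l\<in>UNIV. u k * cnj (u l) * v k * cnj (v l))" by simp
qed

section \<open>Hessian and size of the weight\<close>

lemma powr_shift:
  assumes "0 < (t::real)"
  shows "t powr (a - 1) = t powr a * inverse t" "t powr (a - 2) = t powr a * (inverse t)\<^sup>2"
  using assms by (simp_all add: powr_diff field_simps)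

text \<open>The Hessian of r = R - |z|^2 is minus the identity; through r the multiple of the
  identity enters the Hessian of the weight.\<close>

lemma wirt_radius:
  fixes z :: "complex^'n::finite" and R :: real
  defines "r \<equiv> \<lambda>z::complex^'n. R - z \<bullet> z"
  shows "\<And>U. open U \<Longrightarrow> smooth_on U r"
    and "wirt \<i> k (\<lambda>z. complex_of_real (r z)) z = - (z $ k)"
    and "wirt (- \<i>) k (\<lambda>z. complex_of_real (r z)) z = - cnj (z $ k)"
    and "ddbar (\<lambda>z. complex_of_real (r z)) k l z = - delta k l"
proof -
  show sm: "smooth_on U r" if "open U" for U
    unfolding r_def using that by (intro smooth_on_diff smooth_on_inner smooth_on_ident smooth_on_const)
  have D: "dirderiv r v z = - 2 * (z \<bullet> v)" for v z
  proof -
    have "(r has_derivative (\<lambda>v. 0 - (z \<bullet> v + v \<bullet> z))) (at z)"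
      unfolding r_def by (intro derivative_intros)
    from dirderiv_eq[OF this] show ?thesis by (simp add: inner_commute)
  qed
  have d: "r differentiable (at z)" for z by (rule smooth_on_differentiable[OF sm[OF open_UNIV]]) simp
  have 1: "wirt \<i> k (\<lambda>z. complex_of_real (r z)) z = - (z $ k)" for k z
    unfolding wirt_of_real[OF d] D by (simp add: inner_axis complex_eq_iff)
  then show "wirt \<i> k (\<lambda>z. complex_of_real (r z)) z = - (z $ k)" .
  show "wirt (- \<i>) k (\<lambda>z. complex_of_real (r z)) z = - cnj (z $ k)"
    unfolding wirt_of_real[OF d] D by (simp add: inner_axis complex_eq_iff)
  have "bounded_linear (\<lambda>z::complex^'n. - (z $ l))"
    by (intro bounded_linear_minus bounded_linear_vec_nth)
  then have E: "dirderiv (\<lambda>z::complex^'n. - (z $ l)) v z = - (v $ l)" for v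
    using dirderiv_eq[OF bounded_linear_imp_has_derivative] by blast
  have "ddbar (\<lambda>z. complex_of_real (r z)) k l z = wirt (- \<i>) k (\<lambda>z. - (z $ l)) z"
    by (rule wirt_cong[OF open_UNIV UNIV_I 1])
  also have "\<dots> = - delta k l" unfolding wirt_def E by (simp add: axis_def delta_def complex_eq_iff)
  finally show "ddbar (\<lambda>z. complex_of_real (r z)) k l z = - delta k l" .
qed

definition weight_dom :: "(complex^'n::finite) set \<Rightarrow> (complex^'n \<Rightarrow> real) \<Rightarrow> real \<Rightarrow> real \<Rightarrow> (complex^'n) set" where
  "weight_dom \<Omega> G c0 R = {z \<in> \<Omega>. G z < c0 \<and> z \<bullet> z < R}"

definition weight :: "real \<Rightarrow> (complex^'n::finite \<Rightarrow> real) \<Rightarrow> real \<Rightarrow> real \<Rightarrow> complex^'n \<Rightarrow> real" where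
  "weight q G c0 R z = (c0 - G z) powr q * (R - z \<bullet> z) powr (1 - q)"

lemma open_weight_dom:
  assumes "open \<Omega>" "continuous_on \<Omega> G"
  shows "open (weight_dom \<Omega> G c0 R)"
proof -
  have "open (\<Omega> \<inter> (\<lambda>z. (c0 - G z, R - z \<bullet> z)) -` ({0<..} \<times> {0<..}))"
    by (intro continuous_open_preimage[OF _ assms(1)] continuous_intros assms(2) open_Times)
  also have "\<Omega> \<inter> (\<lambda>z. (c0 - G z, R - z \<bullet> z)) -` ({0<..} \<times> {0<..}) = weight_dom \<Omega> G c0 R"
    by (auto simp: weight_dom_def)
  finally show ?thesis .
qed

text \<open>The function \<open>s\<^sup>q r\<^sup>1\<^sup>-\<^sup>q\<close> is concave, increasing and homogeneous of degree one in \<open>(s, r)\<close>;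
  its complex Hessian contributes a rank one term, which is a square.\<close>

lemma weight_hessian:
  fixes G :: "complex^'n::finite \<Rightarrow> real"
  assumes \<Omega>: "open \<Omega>" and G: "smooth_on \<Omega> G" "psh \<Omega> (\<lambda>z. ereal (G z))" and q: "0 \<le> q" "q \<le> 1"
    and z: "z \<in> weight_dom \<Omega> G c0 R"
  shows "psd (\<lambda>k l. - ddbar (\<lambda>z. complex_of_real (weight q G c0 R z)) k l z
      - complex_of_real ((1 - q) * (c0 - G z) powr q * (R - z \<bullet> z) powr (- q)) * delta k l)"
proof -
  define W where "W = weight_dom \<Omega> G c0 R"
  have W: "open W" "z \<in> W" "W \<subseteq> \<Omega>"
    using open_weight_dom[OF \<Omega> smooth_on_continuous[OF G(1)]] z by (auto simp: W_def weight_dom_def)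
  define s where "s z = c0 - G z" for z
  define r where "r z = R - z \<bullet> z" for z :: "complex^'n"
  have GW: "smooth_on W G" by (rule smooth_on_subset[OF G(1) W(3)])
  have ss: "smooth_on W s" unfolding s_def[abs_def] by (intro smooth_on_diff smooth_on_const W GW)
  have rs: "smooth_on W r" unfolding r_def[abs_def] by (rule wirt_radius(1)[OF W(1)])
  have pos: "0 < s y" "0 < r y" if "y \<in> W" for y using that by (auto simp: W_def weight_dom_def s_def r_def)
  let ?sc = "\<lambda>z. complex_of_real (s z)" and ?rc = "\<lambda>z. complex_of_real (r z)" and ?Gc = "\<lambda>z. complex_of_real (G z)"
  have Gc: "smooth_on W ?Gc" by (rule smooth_on_of_real[OF W(1) GW])
  define x where "x k = wirt (- \<i>) k ?sc z" for k
  define y where "y k = wirt (- \<i>) k ?rc z" for k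
  have xb: "wirt \<i> k ?sc z = cnj (x k)" for k
    unfolding x_def cnj_wirt_of_real[OF smooth_on_differentiable[OF ss W(2)]] by simp
  have yb: "wirt \<i> k ?rc z = cnj (y k)" for k
    unfolding y_def cnj_wirt_of_real[OF smooth_on_differentiable[OF rs W(2)]] by simp
  have Ls: "ddbar ?sc k l z = - ddbar ?Gc k l z" for k l
  proof -
    have e: "?sc = (\<lambda>z. of_real c0 + (-1) * ?Gc z)" by (simp add: s_def fun_eq_iff)
    have "wirt \<i> l ?sc y = (-1) * wirt \<i> l ?Gc y" if "y \<in> W" for y
    proof -
      have d: "?Gc differentiable (at y)" by (rule smooth_on_differentiable[OF Gc that])
      have "wirt \<i> l (\<lambda>z. of_real c0 + (-1) * ?Gc z) y = wirt \<i> l (\<lambda>z. of_real c0) y + wirt \<i> l (\<lambda>z. (-1) * ?Gc z) y"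
        by (rule wirt_add) (intro differentiable_mult differentiable_const d)+
      then show ?thesis unfolding e wirt_cmult[OF d] wirt_const by simp
    qed
    then have "ddbar ?sc k l z = wirt (- \<i>) k (\<lambda>y. (-1) * wirt \<i> l ?Gc y) z" by (rule wirt_cong[OF W(1,2)])
    also have "\<dots> = (-1) * ddbar ?Gc k l z"
      by (rule wirt_cmult[OF smooth_on_differentiable[OF smooth_on_wirt[OF W(1) Gc] W(2)]])
    finally show ?thesis by simp
  qed
  have Lr: "ddbar ?rc k l z = - delta k l" for k l
    unfolding r_def by (rule wirt_radius(4))
  define P where "P = complex_of_real (s z powr q)"
  define P' where "P' = complex_of_real (r z powr (1 - q))"
  define \<sigma> where "\<sigma> = complex_of_real (inverse (s z))"
  define \<rho> where "\<rho> = complex_of_real (inverse (r z))"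
  define Q where "Q = complex_of_real q"
  note ps = powr_shift[OF pos(1)[OF W(2)], of q] and pr = powr_shift[OF pos(2)[OF W(2)], of "1 - q"]
  have w: "(\<lambda>z. complex_of_real (weight q G c0 R z)) = (\<lambda>z. complex_of_real (s z powr q) * complex_of_real (r z powr (1 - q)))"
    by (simp add: weight_def s_def r_def fun_eq_iff)
  have sq: "smooth_on W (\<lambda>z. complex_of_real (s z powr q))" "smooth_on W (\<lambda>z. complex_of_real (r z powr (1 - q)))"
    by (intro smooth_on_of_real smooth_on_powr W ss rs pos; assumption)+
  \<comment> \<open>With x and y the holomorphic derivatives of s and r, all products of first
    derivatives combine to q (1-q) s^q r^(1-q) times the square of \<sigma> x - \<rho> y, the
    derivative of log (s / r). This perfect square depends on the exponents of s and r adding up to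
    1.\<close>
  have "- ddbar (\<lambda>z. complex_of_real (weight q G c0 R z)) k l z
      - complex_of_real ((1 - q) * (c0 - G z) powr q * (R - z \<bullet> z) powr (- q)) * delta k l
     = complex_of_real (q * s z powr q * r z powr (1 - q) * inverse (s z)) * ddbar ?Gc k l z
      + complex_of_real (q * (1 - q) * s z powr q * r z powr (1 - q)) * ((\<sigma> * x k - \<rho> * y k) * cnj (\<sigma> * x l - \<rho> * y l))" for k l
  proof -
    note d = smooth_on_differentiable[OF ss W(2)] smooth_on_differentiable[OF rs W(2)]
    have e1: "wirt a j (\<lambda>z. complex_of_real (s z powr q)) z = Q * P * \<sigma> * wirt a j ?sc z" for a j
      unfolding wirt_powr[OF d(1) pos(1)[OF W(2)]] ps by (simp add: Q_def P_def \<sigma>_def)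
    have e2: "wirt a j (\<lambda>z. complex_of_real (r z powr (1 - q))) z = (1 - Q) * P' * \<rho> * wirt a j ?rc z" for a j
      unfolding wirt_powr[OF d(2) pos(2)[OF W(2)]] pr by (simp add: Q_def P'_def \<rho>_def)
    have e3: "ddbar (\<lambda>z. complex_of_real (s z powr q)) k l z
       = Q * P * \<sigma> * (- ddbar ?Gc k l z) + Q * (Q - 1) * P * \<sigma>\<^sup>2 * x k * cnj (x l)"
      using wirt2_powr[OF W(1,2) ss pos(1), of "- \<i>" k \<i> l q] unfolding ps Ls xb by (simp add: Q_def P_def \<sigma>_def x_def)
    have e4: "ddbar (\<lambda>z. complex_of_real (r z powr (1 - q))) k l z
       = (1 - Q) * P' * \<rho> * (- delta k l) + (1 - Q) * (- Q) * P' * \<rho>\<^sup>2 * y k * cnj (y l)"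
      using wirt2_powr[OF W(1,2) rs pos(2), of "- \<i>" k \<i> l "1 - q"] unfolding pr Lr yb by (simp add: Q_def P'_def \<rho>_def y_def)
    have e5: "complex_of_real ((1 - q) * (c0 - G z) powr q * (R - z \<bullet> z) powr (- q)) = (1 - Q) * P * P' * \<rho>"
    proof -
      have "r z powr (- q) = r z powr (1 - q) * inverse (r z)" using pr(1) by simp
      then show ?thesis unfolding s_def[symmetric] r_def[symmetric] by (simp add: Q_def P_def P'_def \<rho>_def)
    qed
    have c: "cnj \<sigma> = \<sigma>" "cnj \<rho> = \<rho>" by (simp_all add: \<sigma>_def \<rho>_def)
    have f: "complex_of_real (q * s z powr q * r z powr (1 - q) * inverse (s z)) = Q * P * P' * \<sigma>"
      "complex_of_real (q * (1 - q) * s z powr q * r z powr (1 - q)) = Q * (1 - Q) * P * P'"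
      by (simp_all add: Q_def P_def P'_def \<sigma>_def)
    show ?thesis
      unfolding w wirt2_mult[OF W(1,2) sq] e1 e2 e3 e4 e5 f xb yb complex_cnj_diff complex_cnj_mult c
        P_def[symmetric] P'_def[symmetric] x_def[symmetric] y_def[symmetric]
      by (simp add: algebra_simps power2_eq_square)
  qed
  moreover have "psd (\<lambda>k l. complex_of_real (q * s z powr q * r z powr (1 - q) * inverse (s z)) * ddbar ?Gc k l z
      + complex_of_real (q * (1 - q) * s z powr q * r z powr (1 - q)) * ((\<sigma> * x k - \<rho> * y k) * cnj (\<sigma> * x l - \<rho> * y l)))"
  proof (intro psd_add psd_scale psd_rank_one)
    show "0 \<le> q * s z powr q * r z powr (1 - q) * inverse (s z)" using q pos(1)[OF W(2)] by simp
    show "0 \<le> q * (1 - q) * s z powr q * r z powr (1 - q)" using q by simp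
    show "psd (\<lambda>k l. ddbar ?Gc k l z)" using W(2,3) by (intro psh_smooth_levi[OF \<Omega> _ G]) auto
  qed
  ultimately show ?thesis by simp
qed

text \<open>As s, r \<ge> 1, powers with exponent in [0, 1] are at most S and R respectively, and
  those with exponent in [-1, 0] at most 1. The function G enters the bounds only through S and D,
  that is, through its C^1 size at the point.\<close>

lemma weight_bound:
  fixes G :: "complex^'n::finite \<Rightarrow> real"
  assumes \<Omega>: "open \<Omega>" and G: "smooth_on \<Omega> G" and z: "z \<in> \<Omega>" and q: "0 \<le> q" "q \<le> 1"
    and s: "1 \<le> c0 - G z" "c0 - G z \<le> S" and r: "1 \<le> R - z \<bullet> z"
    and D: "\<And>v. v \<in> Basis \<Longrightarrow> \<bar>dirderiv G v z\<bar> \<le> D" and a: "a \<in> {\<i>, - \<i>}"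
  shows "cmod (complex_of_real (weight q G c0 R z)) \<le> S * R"
    and "cmod (wirt a k (\<lambda>z. complex_of_real (weight q G c0 R z)) z) \<le> S * R + D * R"
proof -
  define s' where "s' z = c0 - G z" for z
  define r' where "r' z = R - z \<bullet> z" for z :: "complex^'n"
  have zz: "0 \<le> z \<bullet> z" by simp
  have R1: "1 \<le> R" "r' z \<le> R" "1 \<le> r' z" "1 \<le> s' z" "s' z \<le> S" using r zz s unfolding r'_def s'_def by linarith+
  have ps: "0 \<le> s' z powr q" "s' z powr q \<le> S" "0 \<le> s' z powr (q - 1)" "s' z powr (q - 1) \<le> 1"
    using powr_mono[of q 1 "s' z"] powr_mono[of "q - 1" 0 "s' z"] R1 q by auto
  have pr: "0 \<le> r' z powr (1 - q)" "r' z powr (1 - q) \<le> R" "0 \<le> r' z powr (1 - q - 1)" "r' z powr (1 - q - 1) \<le> 1"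
    using powr_mono[of "1 - q" 1 "r' z"] powr_mono[of "1 - q - 1" 0 "r' z"] R1 q by auto
  have w: "weight q G c0 R = (\<lambda>z. s' z powr q * r' z powr (1 - q))" by (simp add: weight_def s'_def r'_def fun_eq_iff)
  show "cmod (complex_of_real (weight q G c0 R z)) \<le> S * R"
    unfolding w norm_of_real using ps pr R1 by (simp add: abs_mult mult_mono)
  have ds: "s' differentiable (at z)" unfolding s'_def[abs_def]
    using smooth_on_differentiable[OF G z] by (intro differentiable_diff) auto
  have dr: "r' differentiable (at z)" unfolding r'_def[abs_def]
    by (rule smooth_on_differentiable[OF wirt_radius(1)[OF open_UNIV]]) simp
  have Ds: "dirderiv s' v z = - dirderiv G v z" for v
  proof -
    have "(s' has_derivative (\<lambda>v. 0 - dirderiv G v z)) (at z)"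
      unfolding s'_def[abs_def] by (intro derivative_intros has_derivative_dirderiv smooth_on_differentiable[OF G z])
    from dirderiv_eq[OF this] show ?thesis by simp
  qed
  have bs: "cmod (wirt a k (\<lambda>z. complex_of_real (s' z)) z) \<le> D"
    by (rule cmod_wirt_of_real_le[OF ds]) (use a D Ds in auto)
  have nz: "cmod (z $ k) \<le> R"
  proof -
    have "cmod (z $ k) \<le> norm z" by (rule Finite_Cartesian_Product.norm_nth_le)
    moreover have "(norm z)\<^sup>2 \<le> R\<^sup>2"
    proof -
      have "(norm z)\<^sup>2 \<le> R" using r by (simp add: power2_norm_eq_inner)
      also have "R \<le> R\<^sup>2" using R1(1) by (simp add: power2_eq_square)
      finally show ?thesis .
    qed
    ultimately show ?thesis using R1(1) power2_le_imp_le[of "norm z" R] by simp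
  qed
  have br: "cmod (wirt a k (\<lambda>z. complex_of_real (r' z)) z) \<le> R"
  proof -
    have "wirt \<i> k (\<lambda>z. complex_of_real (r' z)) z = - (z $ k)" "wirt (- \<i>) k (\<lambda>z. complex_of_real (r' z)) z = - cnj (z $ k)"
      unfolding r'_def by (rule wirt_radius(2), rule wirt_radius(3))
    then show ?thesis using a nz by auto
  qed
  have dsq: "(\<lambda>z. complex_of_real (s' z powr q)) differentiable (at z)" "(\<lambda>z. complex_of_real (r' z powr (1 - q))) differentiable (at z)"
  proof -
    have "open {z \<in> \<Omega>. 0 < s' z}"
    proof -
      have "continuous_on \<Omega> s'" unfolding s'_def[abs_def] by (intro continuous_intros smooth_on_continuous[OF G])
      from continuous_open_preimage[OF this \<Omega>, of "{0<..}"] show ?thesis by (simp add: vimage_def Int_def)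
    qed
    moreover have "smooth_on \<Omega> s'" unfolding s'_def[abs_def] by (intro smooth_on_diff smooth_on_const G \<Omega>)
    ultimately have "smooth_on {z \<in> \<Omega>. 0 < s' z} (\<lambda>z. complex_of_real (s' z powr q))"
      by (intro smooth_on_of_real smooth_on_powr) (auto intro: smooth_on_subset)
    then show "(\<lambda>z. complex_of_real (s' z powr q)) differentiable (at z)"
      by (rule smooth_on_differentiable) (use z R1 in auto)
    have c: "open {z. 0 < r' z}" unfolding r'_def by (intro open_Collect_less continuous_intros)
    then have "smooth_on {z. 0 < r' z} (\<lambda>z. complex_of_real (r' z powr (1 - q)))"
      using wirt_radius(1)[OF c, of R] unfolding r'_def[symmetric] by (intro smooth_on_of_real smooth_on_powr) auto
    then show "(\<lambda>z. complex_of_real (r' z powr (1 - q))) differentiable (at z)"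
      by (rule smooth_on_differentiable) (use R1 in auto)
  qed
  have pos: "0 < s' z" "0 < r' z" using R1 by auto
  have "wirt a k (\<lambda>z. complex_of_real (weight q G c0 R z)) z
     = of_real (s' z powr q) * (of_real ((1 - q) * r' z powr (1 - q - 1)) * wirt a k (\<lambda>z. of_real (r' z)) z)
      + of_real (q * s' z powr (q - 1)) * wirt a k (\<lambda>z. of_real (s' z)) z * of_real (r' z powr (1 - q))"
    unfolding w of_real_mult wirt_mult[OF dsq] wirt_powr[OF ds pos(1)] wirt_powr[OF dr pos(2)] by simp
  also have "cmod (of_real (s' z powr q) * (of_real ((1 - q) * r' z powr (1 - q - 1)) * wirt a k (\<lambda>z. of_real (r' z)) z)
      + of_real (q * s' z powr (q - 1)) * wirt a k (\<lambda>z. of_real (s' z)) z * of_real (r' z powr (1 - q)))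
     \<le> s' z powr q * ((1 - q) * r' z powr (1 - q - 1) * cmod (wirt a k (\<lambda>z. of_real (r' z)) z))
      + q * s' z powr (q - 1) * cmod (wirt a k (\<lambda>z. of_real (s' z)) z) * r' z powr (1 - q)"
    by (rule order_trans[OF norm_triangle_ineq]) (simp only: norm_mult norm_of_real abs_mult, use q in simp)
  also have "\<dots> \<le> S * (1 * 1 * R) + 1 * 1 * D * R"
    using ps pr R1 q br bs order_trans[OF norm_ge_zero bs] by (intro add_mono mult_mono) auto
  finally show "cmod (wirt a k (\<lambda>z. complex_of_real (weight q G c0 R z)) z) \<le> S * R + D * R" by simp
qed

text \<open>Every summand of \<open>cutoff_hess\<close> has a derivative of \<kappa> as a factor,
  which vanishes off the support of \<kappa> and on \<open>W0\<close>. What is left is a compact set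
  disjoint from \<open>L\<close>, where the sequence is bounded in C^1 for large j; so one constant
  serves all those j.\<close>

lemma cutoff_hess_weight_bounded:
  fixes G :: "nat \<Rightarrow> complex^'n::finite \<Rightarrow> real"
  assumes \<Omega>: "open \<Omega>" and G: "\<And>j. smooth_on \<Omega> (G j)"
    and bd: "\<And>K. compact K \<Longrightarrow> K \<subseteq> \<Omega> - L \<Longrightarrow>
      \<exists>D J. \<forall>j\<ge>J. \<forall>z\<in>K. \<bar>G j z\<bar> \<le> D \<and> (\<forall>v\<in>Basis. \<bar>dirderiv (G j) v z\<bar> \<le> D)"
    and \<kappa>: "smooth_on UNIV \<kappa>" "compact (supp \<kappa>)" "supp \<kappa> \<subseteq> \<Omega>"
    and W0: "open W0" "L \<subseteq> W0" "\<And>z. z \<in> W0 \<Longrightarrow> \<kappa> z = 1"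
    and q: "0 \<le> q" "q \<le> 1"
    and c0: "\<And>j z. z \<in> supp \<kappa> \<Longrightarrow> G j z + 1 \<le> c0" and R: "\<And>z. z \<in> supp \<kappa> \<Longrightarrow> z \<bullet> z + 1 \<le> R"
  shows "\<exists>B J. \<forall>j\<ge>J. \<forall>z k l. cmod (cutoff_hess \<kappa> (weight q (G j) c0 R) k l z) \<le> B"
proof -
  let ?\<kappa> = "\<lambda>z. complex_of_real (\<kappa> z)"
  define C where "C = supp \<kappa> - W0"
  have C: "compact C" "C \<subseteq> \<Omega> - L" unfolding C_def using compact_diff[OF \<kappa>(2) W0(1)] \<kappa>(3) W0(2) by auto
  obtain D J where D: "\<And>j z. j \<ge> J \<Longrightarrow> z \<in> C \<Longrightarrow> \<bar>G j z\<bar> \<le> D"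
    "\<And>j z v. j \<ge> J \<Longrightarrow> z \<in> C \<Longrightarrow> v \<in> Basis \<Longrightarrow> \<bar>dirderiv (G j) v z\<bar> \<le> D"
    using bd[OF C] by blast
  define f where "f z = (\<Sum>k\<in>UNIV. cmod (wirt \<i> k ?\<kappa> z)) + (\<Sum>k\<in>UNIV. cmod (wirt (- \<i>) k ?\<kappa> z))
      + (\<Sum>k\<in>UNIV. \<Sum>l\<in>UNIV. cmod (ddbar ?\<kappa> k l z))" for z
  have \<kappa>c: "smooth_on UNIV ?\<kappa>" by (rule smooth_on_of_real[OF open_UNIV \<kappa>(1)])
  have "continuous_on UNIV f"
    unfolding f_def[abs_def]
    by (intro continuous_intros smooth_on_continuous smooth_on_wirt \<kappa>c open_UNIV)
  then have "compact (f ` C)" using C(1) by (meson compact_continuous_image continuous_on_subset subset_UNIV)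
  then obtain b where b: "\<And>z. z \<in> C \<Longrightarrow> f z \<le> b"
    using compact_imp_bounded bounded_real by (metis abs_le_D1 imageI)
  have f1: "cmod (wirt \<i> k ?\<kappa> z) \<le> f z" "cmod (wirt (- \<i>) k ?\<kappa> z) \<le> f z" "cmod (ddbar ?\<kappa> k l z) \<le> f z" for k l z
  proof -
    have n: "0 \<le> (\<Sum>k\<in>UNIV. cmod (wirt \<i> k ?\<kappa> z))" "0 \<le> (\<Sum>k\<in>UNIV. cmod (wirt (- \<i>) k ?\<kappa> z))"
      "0 \<le> (\<Sum>k\<in>UNIV. \<Sum>l\<in>UNIV. cmod (ddbar ?\<kappa> k l z))" by (intro sum_nonneg norm_ge_zero)+
    have "cmod (wirt \<i> k ?\<kappa> z) \<le> (\<Sum>k\<in>UNIV. cmod (wirt \<i> k ?\<kappa> z))"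
      "cmod (wirt (- \<i>) k ?\<kappa> z) \<le> (\<Sum>k\<in>UNIV. cmod (wirt (- \<i>) k ?\<kappa> z))"
      by (rule member_le_sum; simp)+
    moreover have "cmod (ddbar ?\<kappa> k l z) \<le> (\<Sum>l\<in>UNIV. cmod (ddbar ?\<kappa> k l z))" by (rule member_le_sum) simp_all
    moreover have "\<dots> \<le> (\<Sum>k\<in>UNIV. \<Sum>l\<in>UNIV. cmod (ddbar ?\<kappa> k l z))"
      by (rule member_le_sum[of k UNIV "\<lambda>k. \<Sum>l\<in>UNIV. cmod (ddbar ?\<kappa> k l z)"]) (simp_all add: sum_nonneg)
    ultimately show "cmod (wirt \<i> k ?\<kappa> z) \<le> f z" "cmod (wirt (- \<i>) k ?\<kappa> z) \<le> f z" "cmod (ddbar ?\<kappa> k l z) \<le> f z"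
      using n unfolding f_def by linarith+
  qed
  define S where "S = c0 + D"
  define B where "B = b * (S * R + D * R) + b * (S * R + D * R) + b * (S * R)"
  have on: "cmod (cutoff_hess \<kappa> (weight q (G j) c0 R) k l z) \<le> B" if j: "j \<ge> J" and z: "z \<in> C" for j z k l
  proof -
    have zs: "z \<in> supp \<kappa>" "z \<in> \<Omega>" using z C(2) by (auto simp: C_def)
    have s: "1 \<le> c0 - G j z" "c0 - G j z \<le> S" "1 \<le> R - z \<bullet> z"
      using c0[OF zs(1), of j] R[OF zs(1)] D(1)[OF j z] by (auto simp: S_def)
    note wb = weight_bound[OF \<Omega> G zs(2) q s D(2)[OF j z]]
    have w1: "cmod (complex_of_real (weight q (G j) c0 R z)) \<le> S * R" by (rule wb(1)[of "\<i>"]) simp_all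
    have w2: "cmod (wirt \<i> l (\<lambda>z. complex_of_real (weight q (G j) c0 R z)) z) \<le> S * R + D * R" by (rule wb(2)) simp_all
    have w3: "cmod (wirt (- \<i>) k (\<lambda>z. complex_of_real (weight q (G j) c0 R z)) z) \<le> S * R + D * R" by (rule wb(2)) simp_all
    have b0: "0 \<le> b" by (rule order_trans[OF norm_ge_zero order_trans[OF f1(1) b[OF z]]])
    show ?thesis
      unfolding cutoff_hess_def B_def
    proof (intro norm_triangle_le add_mono, unfold norm_mult)
      show "cmod (wirt (- \<i>) k ?\<kappa> z) * cmod (wirt \<i> l (\<lambda>z. complex_of_real (weight q (G j) c0 R z)) z) \<le> b * (S * R + D * R)"
        by (rule mult_mono[OF order_trans[OF f1(2) b[OF z]] w2 b0 norm_ge_zero])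
      show "cmod (wirt \<i> l ?\<kappa> z) * cmod (wirt (- \<i>) k (\<lambda>z. complex_of_real (weight q (G j) c0 R z)) z) \<le> b * (S * R + D * R)"
        by (rule mult_mono[OF order_trans[OF f1(1) b[OF z]] w3 b0 norm_ge_zero])
      show "cmod (ddbar ?\<kappa> k l z) * cmod (complex_of_real (weight q (G j) c0 R z)) \<le> b * (S * R)"
        by (rule mult_mono[OF order_trans[OF f1(3) b[OF z]] w1 b0 norm_ge_zero])
    qed
  qed
  have off: "cutoff_hess \<kappa> F k l z = 0" if z: "z \<notin> C" for F k l z
  proof -
    have "wirt \<i> l ?\<kappa> z = 0 \<and> wirt (- \<i>) k ?\<kappa> z = 0 \<and> ddbar ?\<kappa> k l z = 0"
    proof (cases "z \<in> W0")
      case True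
      have e: "wirt a i ?\<kappa> y = 0" if "y \<in> W0" for a i y
        using wirt_cong[OF W0(1) that, of ?\<kappa> "\<lambda>_. 1" a i] W0(3) by simp
      have "ddbar ?\<kappa> k l z = wirt (- \<i>) k (\<lambda>_. 0) z" by (rule wirt_cong[OF W0(1) True e])
      then show ?thesis using e[OF True] by simp
    next
      case False
      then have z: "z \<notin> supp ?\<kappa>" using z by (simp add: C_def)
      then have z2: "z \<notin> supp (wirt \<i> l ?\<kappa>)" using supp_wirt by blast
      show ?thesis unfolding wirt_notin_supp[OF z] wirt_notin_supp[OF z2] by simp
    qed
    then show ?thesis unfolding cutoff_hess_def by simp
  qed
  \<comment> \<open>Off C the left side is 0, and if C is empty the sign of \<open>B\<close> is
    unknown; hence the maximum.\<close>
  have "cmod (cutoff_hess \<kappa> (weight q (G j) c0 R) k l z) \<le> max B 0" if "j \<ge> J" for j z k l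
    using on[OF that] off by (cases "z \<in> C") (auto simp: le_max_iff_disj)
  then show ?thesis by blast
qed

text \<open>The coefficient of the identity in the lower bound for the Hessian of minus the weight,
  hence the density whose mass is controlled. For q < 1 it is comparable to s^q wherever r lies
  between positive bounds.\<close>

definition weight_dens :: "real \<Rightarrow> (complex^'n::finite \<Rightarrow> real) \<Rightarrow> real \<Rightarrow> real \<Rightarrow> complex^'n \<Rightarrow> real" where
  "weight_dens q G c0 R z = (1 - q) * (c0 - G z) powr q * (R - z \<bullet> z) powr (- q)"

lemma smooth_on_weight_dens:
  fixes G :: "complex^'n::finite \<Rightarrow> real"
  assumes "open \<Omega>" "smooth_on \<Omega> G"
  shows "smooth_on (weight_dom \<Omega> G c0 R) (weight q G c0 R)" "smooth_on (weight_dom \<Omega> G c0 R) (weight_dens q G c0 R)"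
proof -
  let ?W = "weight_dom \<Omega> G c0 R"
  have W: "open ?W" "?W \<subseteq> \<Omega>"
    using open_weight_dom[OF assms(1) smooth_on_continuous[OF assms(2)]] by (auto simp: weight_dom_def)
  have sG: "smooth_on ?W G" by (rule smooth_on_subset[OF assms(2) W(2)])
  have s: "smooth_on ?W (\<lambda>z. (c0 - G z) powr a)" for a
    by (intro smooth_on_powr smooth_on_diff smooth_on_const W sG) (auto simp: weight_dom_def)
  have r: "smooth_on ?W (\<lambda>z. (R - z \<bullet> z) powr a)" for a
    by (intro smooth_on_powr smooth_on_diff smooth_on_const smooth_on_inner smooth_on_ident W) (auto simp: weight_dom_def)
  show "smooth_on ?W (weight q G c0 R)"
    unfolding weight_def[abs_def] by (intro smooth_on_mult W s r)
  show "smooth_on ?W (weight_dens q G c0 R)"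
    unfolding weight_dens_def[abs_def] by (intro smooth_on_mult W s r smooth_on_const)
qed

lemma cutoff_weightI:
  fixes G :: "complex^'n::finite \<Rightarrow> real"
  assumes \<Omega>: "open \<Omega>" and G: "smooth_on \<Omega> G" "psh \<Omega> (\<lambda>z. ereal (G z))" and q: "0 \<le> q" "q \<le> 1"
    and \<kappa>: "smooth_on UNIV \<kappa>" "\<And>z. 0 \<le> \<kappa> z" "compact (supp \<kappa>)"
    and \<kappa>2: "smooth_on UNIV \<kappa>2" "\<And>z. 0 \<le> \<kappa>2 z" "compact (supp \<kappa>2)" "supp \<kappa>2 \<subseteq> weight_dom \<Omega> G c0 R"
      "\<And>z. z \<in> supp \<kappa> \<Longrightarrow> \<kappa>2 z = 1"
    and B: "\<And>k l z. cmod (cutoff_hess \<kappa> (weight q G c0 R) k l z) \<le> B"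
  shows "cutoff_weight \<Omega> (weight_dom \<Omega> G c0 R) (weight q G c0 R) \<kappa> \<kappa>2 B (weight_dens q G c0 R)"
proof -
  let ?W = "weight_dom \<Omega> G c0 R"
  have W: "open ?W" "?W \<subseteq> \<Omega>"
    using open_weight_dom[OF \<Omega> smooth_on_continuous[OF G(1)]] by (auto simp: weight_dom_def)
  have "supp \<kappa> \<subseteq> {z. \<kappa>2 z \<noteq> 0}" using \<kappa>2(5) by auto
  then have \<kappa>W: "supp \<kappa> \<subseteq> ?W" using \<kappa>2(4) closure_subset[of "{z. \<kappa>2 z \<noteq> 0}"] by (meson subset_trans)
  note wF = smooth_on_weight_dens(1)[OF \<Omega> G(1)] and wc = smooth_on_weight_dens(2)[OF \<Omega> G(1)]
  show ?thesis
  proof (unfold_locales)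
    show "0 \<le> weight q G c0 R z" for z by (simp add: weight_def)
    show "0 \<le> weight_dens q G c0 R z" for z using q by (simp add: weight_dens_def)
    show "psd (\<lambda>k l. - ddbar (\<lambda>z. complex_of_real (weight q G c0 R z)) k l z - complex_of_real (weight_dens q G c0 R z) * delta k l)"
      if "z \<in> ?W" for z
      unfolding weight_dens_def by (rule weight_hessian[OF \<Omega> G q that])
  qed (fact W wF wc \<kappa> \<kappa>W \<kappa>2 | rule B)+
qed

lemma sum_unit_form:
  fixes f :: "'n::finite \<Rightarrow> 'n \<Rightarrow> complex"
  shows "(\<Sum>i\<in>UNIV. \<Sum>l\<in>UNIV. of_bool (i = k) * cnj (of_bool (l = k)) * f i l) = f k k"
proof -
  have 1: "(\<Sum>l\<in>UNIV. of_bool (l = k) * h l) = h k" for h :: "'n \<Rightarrow> complex"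
    by (simp add: of_bool_def if_distrib if_distribR sum.delta cong: if_cong)
  have 2: "cnj (of_bool b) = of_bool b" for b by (cases b) simp_all
  show ?thesis unfolding 2 mult.assoc sum_distrib_left[symmetric] 1 ..
qed

text \<open>The three cutoffs are nested, each equal to 1 near the support of the one before, and
  the first one near \<open>K\<close> and \<open>L\<close>. The first bound uses the first two. The
  second bound uses them too and is left with \<omega> times the second cutoff, which is removed by
  the one-pair bound with the second and third; this is why \<open>C\<close> occurs twice. The
  right-hand sides no longer involve the sequence.\<close>

lemma uniform_mass_bounds:
  fixes G :: "nat \<Rightarrow> complex^'n::finite \<Rightarrow> real"
  assumes \<Omega>: "open \<Omega>" and L: "compact L" "L \<subseteq> \<Omega>" and K: "compact K" "K \<subseteq> \<Omega>"
    and G: "\<And>j. smooth_on \<Omega> (G j)" "\<And>j. psh \<Omega> (\<lambda>z. ereal (G j z))"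
    and dec: "\<And>j z. z \<in> \<Omega> \<Longrightarrow> G j z \<le> G 0 z"
    and bd: "\<And>K. compact K \<Longrightarrow> K \<subseteq> \<Omega> - L \<Longrightarrow>
      \<exists>D J. \<forall>j\<ge>J. \<forall>z\<in>K. \<bar>G j z\<bar> \<le> D \<and> (\<forall>v\<in>Basis. \<bar>dirderiv (G j) v z\<bar> \<le> D)"
    and q: "0 \<le> q" "q \<le> 1"
  obtains \<kappa> \<kappa>2 \<kappa>3 :: "complex^'n \<Rightarrow> real" and c0 R C J where
    "smooth_on UNIV \<kappa>" "\<And>z. 0 \<le> \<kappa> z" "compact (supp \<kappa>)" "\<And>j. supp \<kappa> \<subseteq> weight_dom \<Omega> (G j) c0 R" "\<And>z. z \<in> K \<Longrightarrow> \<kappa> z = 1"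
    "0 \<le> c0"
    "\<And>j M. j \<ge> J \<Longrightarrow> pos_form \<Omega> M \<Longrightarrow> psh_form \<Omega> M \<Longrightarrow>
       Re (\<Sum>k\<in>UNIV. M (\<lambda>z. complex_of_real (\<kappa> z) * complex_of_real (weight_dens q (G j) c0 R z)) k k)
        \<le> C * Re (\<Sum>k\<in>UNIV. M (\<lambda>z. complex_of_real (\<kappa>2 z)) k k)"
    "\<And>j N. j \<ge> J \<Longrightarrow> pos_form2 \<Omega> N \<Longrightarrow> psh_form2 \<Omega> N \<Longrightarrow> alternating2 \<Omega> N \<Longrightarrow>
       Re (\<Sum>m\<in>UNIV. \<Sum>k\<in>UNIV. N (\<lambda>z. complex_of_real (\<kappa> z) *
          (complex_of_real (weight_dens q (G j) c0 R z) * complex_of_real (weight_dens q (G j) c0 R z))) k m k m)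
        \<le> C * (C * Re (\<Sum>k\<in>UNIV. \<Sum>m\<in>UNIV. N (\<lambda>z. complex_of_real (\<kappa>3 z)) m k m k))"
proof -
  obtain \<kappa>1 W1 where \<kappa>1: "smooth_on UNIV (\<kappa>1 :: complex^'n \<Rightarrow> real)" "\<And>z. 0 \<le> \<kappa>1 z" "\<And>z. \<kappa>1 z \<le> 1"
    "compact (supp \<kappa>1)" "supp \<kappa>1 \<subseteq> \<Omega>" "open W1" "K \<union> L \<subseteq> W1" "W1 \<subseteq> \<Omega>" "\<And>z. z \<in> W1 \<Longrightarrow> \<kappa>1 z = 1"
    by (rule smooth_cutoff[of "K \<union> L" \<Omega>]) (use K L \<Omega> in auto)
  obtain \<kappa>2 W2 where \<kappa>2: "smooth_on UNIV (\<kappa>2 :: complex^'n \<Rightarrow> real)" "\<And>z. 0 \<le> \<kappa>2 z" "\<And>z. \<kappa>2 z \<le> 1"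
    "compact (supp \<kappa>2)" "supp \<kappa>2 \<subseteq> \<Omega>" "open W2" "supp \<kappa>1 \<subseteq> W2" "W2 \<subseteq> \<Omega>" "\<And>z. z \<in> W2 \<Longrightarrow> \<kappa>2 z = 1"
    by (rule smooth_cutoff[OF \<kappa>1(4) \<Omega> \<kappa>1(5)]) (rule that; assumption)
  obtain \<kappa>3 W3 where \<kappa>3: "smooth_on UNIV (\<kappa>3 :: complex^'n \<Rightarrow> real)" "\<And>z. 0 \<le> \<kappa>3 z" "\<And>z. \<kappa>3 z \<le> 1"
    "compact (supp \<kappa>3)" "supp \<kappa>3 \<subseteq> \<Omega>" "open W3" "supp \<kappa>2 \<subseteq> W3" "W3 \<subseteq> \<Omega>" "\<And>z. z \<in> W3 \<Longrightarrow> \<kappa>3 z = 1"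
    by (rule smooth_cutoff[OF \<kappa>2(4) \<Omega> \<kappa>2(5)]) (rule that; assumption)
  have nz: "A \<subseteq> supp f" if "\<And>z. z \<in> A \<Longrightarrow> f z = 1" for A and f :: "complex^'n \<Rightarrow> real"
  proof -
    have "A \<subseteq> {z. f z \<noteq> 0}" using that by auto
    then show ?thesis using closure_subset by (rule subset_trans)
  qed
  have s23: "supp \<kappa>2 \<subseteq> supp \<kappa>3" using \<kappa>3(7) nz[of W3 \<kappa>3] \<kappa>3(9) by (meson subset_trans)
  have s12: "supp \<kappa>1 \<subseteq> supp \<kappa>2" using \<kappa>2(7) nz[of W2 \<kappa>2] \<kappa>2(9) by (meson subset_trans)
  have "bounded ((\<lambda>z. \<bar>G 0 z\<bar> + z \<bullet> z) ` supp \<kappa>3)"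
    by (intro compact_imp_bounded compact_continuous_image continuous_intros
        continuous_on_subset[OF smooth_on_continuous[OF G(1)] \<kappa>3(5)] \<kappa>3(4))
  then obtain b where "\<forall>x\<in>(\<lambda>z. \<bar>G 0 z\<bar> + z \<bullet> z) ` supp \<kappa>3. \<bar>x\<bar> \<le> b"
    unfolding bounded_real by blast
  then have b: "\<bar>G 0 z\<bar> + z \<bullet> z \<le> b" if "z \<in> supp \<kappa>3" for z
    using that by fastforce
  \<comment> \<open>Serves both as c0 and as R. Since the sequence decreases, the bound for G 0 on
    the support of \<kappa>3 gives s \<ge> 1 and r \<ge> 1 there for every j.\<close>
  define c where "c = max b 0 + 1"
  have c0: "G j z + 1 \<le> c" "z \<bullet> z + 1 \<le> c" if z: "z \<in> supp \<kappa>3" for j z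
  proof -
    have "z \<in> \<Omega>" using z \<kappa>3(5) by blast
    then have "G j z \<le> G 0 z" by (rule dec)
    moreover have "0 \<le> z \<bullet> z" by simp
    ultimately show "G j z + 1 \<le> c" "z \<bullet> z + 1 \<le> c" using b[OF z] unfolding c_def by linarith+
  qed
  have dom: "supp \<kappa>3 \<subseteq> weight_dom \<Omega> (G j) c c" for j
  proof
    fix z assume z: "z \<in> supp \<kappa>3"
    then have "z \<in> \<Omega>" using \<kappa>3(5) by blast
    then show "z \<in> weight_dom \<Omega> (G j) c c" using c0(1)[OF z, of j] c0(2)[OF z] by (simp add: weight_dom_def)
  qed
  have c1: "G j z + 1 \<le> c" "z \<bullet> z + 1 \<le> c" if z: "z \<in> supp \<kappa>1" for j z
    by (rule c0; use z s12 s23 in blast)+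
  have c2: "G j z + 1 \<le> c" "z \<bullet> z + 1 \<le> c" if z: "z \<in> supp \<kappa>2" for j z
    by (rule c0; use z s23 in blast)+
  have LW1: "L \<subseteq> W1" using \<kappa>1(7) by blast
  have LW2: "L \<subseteq> W2" using LW1 nz[of W1 \<kappa>1] \<kappa>1(9) \<kappa>2(7) by (meson subset_trans)
  obtain B1 J1 where B1: "\<And>j z k l. j \<ge> J1 \<Longrightarrow> cmod (cutoff_hess \<kappa>1 (weight q (G j) c c) k l z) \<le> B1"
    using cutoff_hess_weight_bounded[OF \<Omega> G(1) bd \<kappa>1(1,4,5,6) LW1 \<kappa>1(9) q c1] by blast
  obtain B2 J2 where B2: "\<And>j z k l. j \<ge> J2 \<Longrightarrow> cmod (cutoff_hess \<kappa>2 (weight q (G j) c c) k l z) \<le> B2"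
    using cutoff_hess_weight_bounded[OF \<Omega> G(1) bd \<kappa>2(1,4,5,6) LW2 \<kappa>2(9) q c2] by blast
  define B where "B = max 0 (max B1 B2)"
  define J where "J = max J1 J2"
  define C where "C = real CARD('n) * B"
  have C0: "0 \<le> C" by (simp add: C_def B_def)
  have cw1: "cutoff_weight \<Omega> (weight_dom \<Omega> (G j) c c) (weight q (G j) c c) \<kappa>1 \<kappa>2 B (weight_dens q (G j) c c)"
    if j: "j \<ge> J" for j
  proof (rule cutoff_weightI[OF \<Omega> G q \<kappa>1(1,2,4) \<kappa>2(1,2,4)])
    show "supp \<kappa>2 \<subseteq> weight_dom \<Omega> (G j) c c" using s23 dom by (rule subset_trans)
    show "\<kappa>2 z = 1" if "z \<in> supp \<kappa>1" for z using that \<kappa>2(7,9) by blast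
    show "cmod (cutoff_hess \<kappa>1 (weight q (G j) c c) k l z) \<le> B" for k l z
      using B1[of j k l z] j by (simp add: B_def J_def)
  qed
  have cw2: "cutoff_weight \<Omega> (weight_dom \<Omega> (G j) c c) (weight q (G j) c c) \<kappa>2 \<kappa>3 B (weight_dens q (G j) c c)"
    if j: "j \<ge> J" for j
  proof (rule cutoff_weightI[OF \<Omega> G q \<kappa>2(1,2,4) \<kappa>3(1,2,4) dom])
    show "\<kappa>3 z = 1" if "z \<in> supp \<kappa>2" for z using that \<kappa>3(7,9) by blast
    show "cmod (cutoff_hess \<kappa>2 (weight q (G j) c c) k l z) \<le> B" for k l z
      using B2[of j k l z] j by (simp add: B_def J_def)
  qed
  show ?thesis
  proof (rule that[of \<kappa>1 c c J C \<kappa>2 \<kappa>3])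
    show "smooth_on UNIV \<kappa>1" "\<And>z. 0 \<le> \<kappa>1 z" "compact (supp \<kappa>1)" by (fact \<kappa>1)+
    show "supp \<kappa>1 \<subseteq> weight_dom \<Omega> (G j) c c" for j using s12 s23 dom by (meson subset_trans)
    show "\<kappa>1 z = 1" if "z \<in> K" for z using that \<kappa>1(7,9) by blast
    show "0 \<le> c" by (simp add: c_def)
    show "Re (\<Sum>k\<in>UNIV. M (\<lambda>z. complex_of_real (\<kappa>1 z) * complex_of_real (weight_dens q (G j) c c z)) k k)
        \<le> C * Re (\<Sum>k\<in>UNIV. M (\<lambda>z. complex_of_real (\<kappa>2 z)) k k)"
      if "j \<ge> J" "pos_form \<Omega> M" "psh_form \<Omega> M" for j M
      using cutoff_weight.weight_mass_bound[OF cw1[OF that(1)] that(2,3)] unfolding C_def .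
    show "Re (\<Sum>m\<in>UNIV. \<Sum>k\<in>UNIV. N (\<lambda>z. complex_of_real (\<kappa>1 z) *
          (complex_of_real (weight_dens q (G j) c c z) * complex_of_real (weight_dens q (G j) c c z))) k m k m)
        \<le> C * (C * Re (\<Sum>k\<in>UNIV. \<Sum>m\<in>UNIV. N (\<lambda>z. complex_of_real (\<kappa>3 z)) m k m k))"
      if j: "j \<ge> J" and N: "pos_form2 \<Omega> N" "psh_form2 \<Omega> N" "alternating2 \<Omega> N" for j N
    proof -
      interpret cw2: cutoff_weight \<Omega> "weight_dom \<Omega> (G j) c c" "weight q (G j) c c" \<kappa>2 \<kappa>3 B "weight_dens q (G j) c c"
        by (rule cw2[OF j])
      let ?\<omega> = "\<lambda>m l z. complex_of_real (\<kappa>2 z) * - ddbar (\<lambda>z. complex_of_real (weight q (G j) c c z)) m l z"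
      define e :: "'n \<Rightarrow> 'n \<Rightarrow> complex" where "e k m = of_bool (m = k)" for k m
      have slice: "(\<Sum>m'\<in>UNIV. \<Sum>q'\<in>UNIV. e k m' * cnj (e k q') * N \<phi> m m' q' q) = N \<phi> m k k q"
        "(\<Sum>m'\<in>UNIV. \<Sum>q'\<in>UNIV. e k m' * cnj (e k q') * N \<phi> m m' q q') = N \<phi> m k q k" for \<phi> k m q
        unfolding e_def by (rule sum_unit_form)+
      have D: "?\<omega> m q \<in> Dtest \<Omega>" for m q by (rule Dtest_mono[OF cw2.\<kappa>\<omega> cw2.W(2)])
      \<comment> \<open>Two swaps, two signs: the pair contracted with \<omega> moves to the first
        place, where the bound for one pair applies to the slice at the unit vector e_k.\<close>
      have alt: "N (?\<omega> m q) k m k q = N (?\<omega> m q) m k q k" for m q k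
        using alternating2D(1)[OF N(3) D, of m q k m k q] alternating2D(2)[OF N(3) D, of m q m k q k] by simp
      have "Re (\<Sum>m\<in>UNIV. \<Sum>q\<in>UNIV. N (?\<omega> m q) m k q k) \<le> C * Re (\<Sum>m\<in>UNIV. N (\<lambda>z. complex_of_real (\<kappa>3 z)) m k m k)" for k
        using cw2.cutoff_mass_bound[OF pos_form2_slice[OF N(1), of "e k"] N(2)[unfolded psh_form2_def, THEN spec, of "e k"]]
        unfolding slice C_def .
      then have "(\<Sum>k\<in>UNIV. Re (\<Sum>m\<in>UNIV. \<Sum>q\<in>UNIV. N (?\<omega> m q) m k q k))
          \<le> (\<Sum>k\<in>UNIV. C * Re (\<Sum>m\<in>UNIV. N (\<lambda>z. complex_of_real (\<kappa>3 z)) m k m k))"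
        by (intro sum_mono)
      then have "Re (\<Sum>k\<in>UNIV. \<Sum>m\<in>UNIV. \<Sum>q\<in>UNIV. N (?\<omega> m q) m k q k)
          \<le> C * Re (\<Sum>k\<in>UNIV. \<Sum>m\<in>UNIV. N (\<lambda>z. complex_of_real (\<kappa>3 z)) m k m k)"
        by (simp only: Re_sum sum_distrib_left)
      moreover have "(\<Sum>m\<in>UNIV. \<Sum>q\<in>UNIV. \<Sum>k\<in>UNIV. N (?\<omega> m q) k m k q) = (\<Sum>k\<in>UNIV. \<Sum>m\<in>UNIV. \<Sum>q\<in>UNIV. N (?\<omega> m q) m k q k)"
      proof -
        have "(\<Sum>m\<in>UNIV. \<Sum>q\<in>UNIV. \<Sum>k\<in>UNIV. N (?\<omega> m q) k m k q) = (\<Sum>m\<in>UNIV. \<Sum>q\<in>UNIV. \<Sum>k\<in>UNIV. N (?\<omega> m q) m k q k)"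
          by (intro sum.cong refl alt)
        also have "\<dots> = (\<Sum>m\<in>UNIV. \<Sum>k\<in>UNIV. \<Sum>q\<in>UNIV. N (?\<omega> m q) m k q k)"
          by (rule sum.cong[OF refl], rule sum.swap)
        also have "\<dots> = (\<Sum>k\<in>UNIV. \<Sum>m\<in>UNIV. \<Sum>q\<in>UNIV. N (?\<omega> m q) m k q k)" by (rule sum.swap)
        finally show ?thesis .
      qed
      ultimately have "Re (\<Sum>m\<in>UNIV. \<Sum>q\<in>UNIV. \<Sum>k\<in>UNIV. N (?\<omega> m q) k m k q)
          \<le> C * Re (\<Sum>k\<in>UNIV. \<Sum>m\<in>UNIV. N (\<lambda>z. complex_of_real (\<kappa>3 z)) m k m k)" by simp
      from mult_left_mono[OF this C0] cutoff_weight.weight_square_mass_bound[OF cw1[OF j] N]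
      show ?thesis unfolding C_def by linarith
    qed
  qed
qed

section \<open>Application to currents\<close>

text \<open>The function \<open>h\<close> will be the identity or complex conjugation, which covers
  linear and conjugate-linear arguments together.\<close>

lemma sum_axis:
  fixes f :: "complex^'n::finite \<Rightarrow> complex"
  assumes f: "\<And>c u v. f (c *s u + v) = h c * f u + f v" and h: "h 1 = 1"
  shows "f a = (\<Sum>k\<in>UNIV. h (a $ k) * f (axis k 1))"
proof -
  have f0: "f 0 = 0" using f[of 1 0 0] h by simp
  have "f (\<Sum>k\<in>I. (a $ k) *s axis k 1) = (\<Sum>k\<in>I. h (a $ k) * f (axis k 1))" if "finite I" for I
    using that by (induction I) (simp_all add: f0 f)
  from this[of UNIV] show ?thesis by (simp add: basis_expansion)
qed

lemma order0_current_expand: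
  fixes T :: "(complex^'n::finite \<Rightarrow> complex) \<Rightarrow> (complex^'n) list \<Rightarrow> (complex^'n) list \<Rightarrow> complex"
  assumes T: "order0_current \<Omega> p T" "length as = p" "length bs = p" "\<phi> \<in> Cc \<Omega>" "i < p"
  shows "T \<phi> (as[i := a]) (bs[i := b])
    = (\<Sum>k\<in>UNIV. \<Sum>l\<in>UNIV. a $ k * cnj (b $ l) * T \<phi> (as[i := axis k 1]) (bs[i := axis l 1]))"
proof -
  have "T \<phi> (as[i := a]) (bs[i := b]) = (\<Sum>k\<in>UNIV. a $ k * T \<phi> (as[i := axis k 1]) (bs[i := b]))"
    by (rule sum_axis[where h = "\<lambda>x. x", OF order0_current_multilinear(1)[OF T(1,2) _ T(4,5)] refl]) (simp add: T)
  also have "\<dots> = (\<Sum>k\<in>UNIV. a $ k * (\<Sum>l\<in>UNIV. cnj (b $ l) * T \<phi> (as[i := axis k 1]) (bs[i := axis l 1])))"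
  proof (intro sum.cong refl arg_cong2[where f = "(*)"])
    fix k
    show "T \<phi> (as[i := axis k 1]) (bs[i := b]) = (\<Sum>l\<in>UNIV. cnj (b $ l) * T \<phi> (as[i := axis k 1]) (bs[i := axis l 1]))"
      by (rule sum_axis[where h = cnj, OF order0_current_multilinear(2)[OF T(1) _ T(3,4,5)]]) (simp_all add: T)
  qed
  finally show ?thesis by (simp add: sum_distrib_left mult.assoc)
qed

lemma order0_current_expand0:
  assumes "order0_current \<Omega> p T" "length as = p - 1" "length bs = p - 1" "\<phi> \<in> Cc \<Omega>" "1 \<le> p"
  shows "T \<phi> (a # as) (b # bs)
    = (\<Sum>k\<in>UNIV. \<Sum>l\<in>UNIV. a $ k * cnj (b $ l) * T \<phi> (axis k 1 # as) (axis l 1 # bs))"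
  using order0_current_expand[OF assms(1) _ _ assms(4), of "a # as" "b # bs" 0 a b] assms by simp

lemma order0_current_expand1:
  assumes "order0_current \<Omega> p T" "length as = p - 2" "length bs = p - 2" "\<phi> \<in> Cc \<Omega>" "2 \<le> p"
  shows "T \<phi> (c # a # as) (d # b # bs)
    = (\<Sum>k\<in>UNIV. \<Sum>l\<in>UNIV. a $ k * cnj (b $ l) * T \<phi> (c # axis k 1 # as) (d # axis l 1 # bs))"
  using order0_current_expand[OF assms(1) _ _ assms(4), of "c # a # as" "d # b # bs" 1 a b] assms by simp

lemma positive_currentD:
  assumes "positive_current \<Omega> p T"
  shows "order0_current \<Omega> p T"
    and "\<phi> \<in> Cc \<Omega> \<Longrightarrow> nonneg_fun \<phi> \<Longrightarrow> length as = p \<Longrightarrow> Im (T \<phi> as as) = 0"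
    and "\<phi> \<in> Cc \<Omega> \<Longrightarrow> nonneg_fun \<phi> \<Longrightarrow> length as = p \<Longrightarrow> 0 \<le> Re (T \<phi> as as)"
  using assms by (simp_all add: positive_current_def)

lemma psh_currentD:
  assumes "psh_current \<Omega> p T" "\<psi> \<in> Dtest \<Omega>" "nonneg_fun \<psi>" "length gs = p - 1"
  shows "0 \<le> Re (\<Sum>k\<in>UNIV. \<Sum>l\<in>UNIV. T (ddbar \<psi> k l) (axis k 1 # gs) (axis l 1 # gs))"
  using assms unfolding psh_current_def Let_def dz_eq_wirt dzbar_eq_wirt by simp

lemma current_pos_form:
  fixes T :: "(complex^'n::finite \<Rightarrow> complex) \<Rightarrow> (complex^'n) list \<Rightarrow> (complex^'n) list \<Rightarrow> complex"
  assumes T: "positive_current \<Omega> p T" and p: "1 \<le> p" and gs: "length gs = p - 1"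
  shows "pos_form \<Omega> (\<lambda>\<phi> k l. T \<phi> (axis k 1 # gs) (axis l 1 # gs))"
  unfolding pos_form_def
proof (intro conjI ballI allI impI)
  note T0 = positive_currentD(1)[OF T]
  show "T (\<lambda>z. c * \<phi> z + \<psi> z) (axis k 1 # gs) (axis l 1 # gs)
     = c * T \<phi> (axis k 1 # gs) (axis l 1 # gs) + T \<psi> (axis k 1 # gs) (axis l 1 # gs)"
    if "\<phi> \<in> Dtest \<Omega>" "\<psi> \<in> Dtest \<Omega>" for \<phi> \<psi> c k l
    by (rule order0_current_linear(1)[OF T0 _ _ Dtest_subset_Cc[OF that(1)] Dtest_subset_Cc[OF that(2)]])
       (use p gs in simp_all)
  fix \<phi> and v :: "'n \<Rightarrow> complex" assume \<phi>: "\<phi> \<in> Dtest \<Omega>" "nonneg_fun \<phi>"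
  have "0 \<le> Re (T \<phi> ((\<chi> k. v k) # gs) ((\<chi> k. v k) # gs))"
    by (rule positive_currentD(3)[OF T Dtest_subset_Cc[OF \<phi>(1)] \<phi>(2)]) (use p gs in simp)
  then show "0 \<le> Re (\<Sum>k\<in>UNIV. \<Sum>l\<in>UNIV. v k * cnj (v l) * T \<phi> (axis k 1 # gs) (axis l 1 # gs))"
    unfolding order0_current_expand0[OF T0 gs gs Dtest_subset_Cc[OF \<phi>(1)] p, of "\<chi> k. v k" "\<chi> k. v k"] by simp
qed

lemma current_psh_form:
  assumes "psh_current \<Omega> p T" "length gs = p - 1"
  shows "psh_form \<Omega> (\<lambda>\<phi> k l. T \<phi> (axis k 1 # gs) (axis l 1 # gs))"
  unfolding psh_form_def
proof (intro ballI impI)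
  fix \<psi> assume "\<psi> \<in> Dtest \<Omega>" "nonneg_fun \<psi>"
  from psh_currentD[OF assms(1) this assms(2)]
  show "0 \<le> Re (\<Sum>k\<in>UNIV. \<Sum>l\<in>UNIV. T (ddbar \<psi> k l) (axis k 1 # gs) (axis l 1 # gs))" .
qed

lemma current_pos_form2:
  fixes T :: "(complex^'n::finite \<Rightarrow> complex) \<Rightarrow> (complex^'n) list \<Rightarrow> (complex^'n) list \<Rightarrow> complex"
  assumes T: "positive_current \<Omega> p T" and p: "2 \<le> p" and gs: "length gs = p - 2"
  shows "pos_form2 \<Omega> (\<lambda>\<phi> k m l q. T \<phi> (axis k 1 # axis m 1 # gs) (axis l 1 # axis q 1 # gs))"
  unfolding pos_form2_def
proof (intro conjI ballI allI impI)
  note T0 = positive_currentD(1)[OF T]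
  show "T (\<lambda>z. c * \<phi> z + \<psi> z) (axis k 1 # axis m 1 # gs) (axis l 1 # axis q 1 # gs)
     = c * T \<phi> (axis k 1 # axis m 1 # gs) (axis l 1 # axis q 1 # gs) + T \<psi> (axis k 1 # axis m 1 # gs) (axis l 1 # axis q 1 # gs)"
    if "\<phi> \<in> Dtest \<Omega>" "\<psi> \<in> Dtest \<Omega>" for \<phi> \<psi> c k m l q
    by (rule order0_current_linear(1)[OF T0 _ _ Dtest_subset_Cc[OF that(1)] Dtest_subset_Cc[OF that(2)]])
       (use p gs in simp_all)
  fix \<phi> and v w :: "'n \<Rightarrow> complex" assume \<phi>: "\<phi> \<in> Dtest \<Omega>" "nonneg_fun \<phi>"
  let ?v = "\<chi> k. v k" and ?w = "\<chi> k. w k"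
  have len: "length (?w # gs) = p - 1" "1 \<le> p" using p gs by simp_all
  have "0 \<le> Re (T \<phi> (?v # ?w # gs) (?v # ?w # gs))"
    by (rule positive_currentD(3)[OF T Dtest_subset_Cc[OF \<phi>(1)] \<phi>(2)]) (use p gs in simp)
  then show "0 \<le> Re (\<Sum>k\<in>UNIV. \<Sum>l\<in>UNIV. v k * cnj (v l) *
      (\<Sum>m\<in>UNIV. \<Sum>q\<in>UNIV. w m * cnj (w q) * T \<phi> (axis k 1 # axis m 1 # gs) (axis l 1 # axis q 1 # gs)))"
    unfolding order0_current_expand0[OF T0 len(1) len(1) Dtest_subset_Cc[OF \<phi>(1)] len(2), of ?v ?v]
    unfolding order0_current_expand1[OF T0 gs gs Dtest_subset_Cc[OF \<phi>(1)] p, of _ ?w _ ?w] by simp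
qed

text \<open>The vector w is inserted as a constant form into the argument lists of the current, so
  the slice at w inherits dd^c \<ge> 0 from plurisubharmonicity of \<open>T\<close> with
  \<open>gs\<close> extended by w.\<close>

lemma current_psh_form2:
  fixes T :: "(complex^'n::finite \<Rightarrow> complex) \<Rightarrow> (complex^'n) list \<Rightarrow> (complex^'n) list \<Rightarrow> complex"
  assumes T: "order0_current \<Omega> p T" "psh_current \<Omega> p T" and p: "2 \<le> p" and gs: "length gs = p - 2"
  shows "psh_form2 \<Omega> (\<lambda>\<phi> k m l q. T \<phi> (axis k 1 # axis m 1 # gs) (axis l 1 # axis q 1 # gs))"
  unfolding psh_form2_def psh_form_def
proof (intro allI ballI impI)
  fix w :: "'n \<Rightarrow> complex" and \<psi> assume \<psi>: "\<psi> \<in> Dtest \<Omega>" "nonneg_fun \<psi>"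
  let ?w = "\<chi> k. w k"
  have len: "length (?w # gs) = p - 1" using p gs by simp
  have D: "ddbar \<psi> k l \<in> Cc \<Omega>" for k l by (rule Dtest_subset_Cc[OF Dtest_wirt[OF Dtest_wirt[OF \<psi>(1)]]])
  from psh_currentD[OF T(2) \<psi> len]
  show "0 \<le> Re (\<Sum>k\<in>UNIV. \<Sum>l\<in>UNIV. \<Sum>m\<in>UNIV. \<Sum>q\<in>UNIV. w m * cnj (w q) *
      T (ddbar \<psi> k l) (axis k 1 # axis m 1 # gs) (axis l 1 # axis q 1 # gs))"
    unfolding order0_current_expand1[OF T(1) gs gs D p, of _ _ _ ?w _ ?w] by simp
qed

lemma alternating_swap:
  fixes f :: "complex^'n::finite \<Rightarrow> complex^'n \<Rightarrow> complex"
  assumes add1: "\<And>u v y. f (u + v) y = f u y + f v y" and add2: "\<And>x u v. f x (u + v) = f x u + f x v"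
    and alt: "\<And>x. f x x = 0"
  shows "f y x = - f x y"
proof -
  have "0 = f (x + y) (x + y)" by (simp only: alt)
  also have "\<dots> = f x y + f y x" by (simp only: add1 add2) (simp add: alt)
  finally have "f x y + f y x = 0" by (rule sym)
  then show ?thesis using minus_unique[of "f x y" "f y x"] by simp
qed

lemma current_alternating2:
  fixes T :: "(complex^'n::finite \<Rightarrow> complex) \<Rightarrow> (complex^'n) list \<Rightarrow> (complex^'n) list \<Rightarrow> complex"
  assumes T: "order0_current \<Omega> p T" and p: "2 \<le> p" and gs: "length gs = p - 2"
  shows "alternating2 \<Omega> (\<lambda>\<phi> k m l q. T \<phi> (axis k 1 # axis m 1 # gs) (axis l 1 # axis q 1 # gs))"
  unfolding alternating2_def
proof (intro ballI allI conjI)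
  fix \<phi> k m l q assume "\<phi> \<in> Dtest \<Omega>"
  then have \<phi>: "\<phi> \<in> Cc \<Omega>" by (rule Dtest_subset_Cc)
  have len: "length (x # y # gs) = p" for x y :: "complex^'n" using p gs by simp
  have i: "0 < p" "1 < p" using p by simp_all
  have ma: "multilin_alt p (\<lambda>as. T \<phi> as (x # y # gs))" "conj_multilin_alt p (\<lambda>bs. T \<phi> (x # y # gs) bs)" for x y
    using T \<phi> len[of x y] unfolding order0_current_def by simp_all
  have alt: "T \<phi> (u # u # gs) (x # y # gs) = 0" "T \<phi> (x # y # gs) (u # u # gs) = 0" for x y u
    using conjunct2[OF ma(1)[unfolded multilin_alt_def], THEN spec, THEN spec, THEN spec, of "u # u # gs" 0 1 x y]
      conjunct2[OF ma(2)[unfolded conj_multilin_alt_def], THEN spec, THEN spec, THEN spec, of "u # u # gs" 0 1 x y] len[of u u] i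
    by simp_all
  have a1: "T \<phi> ((u + v) # y # gs) (x # x' # gs) = T \<phi> (u # y # gs) (x # x' # gs) + T \<phi> (v # y # gs) (x # x' # gs)" for u v y x x'
    using order0_current_multilinear(1)[OF T len len \<phi> i(1), of u y 1 u v x x'] by simp
  have a2: "T \<phi> (y # (u + v) # gs) (x # x' # gs) = T \<phi> (y # u # gs) (x # x' # gs) + T \<phi> (y # v # gs) (x # x' # gs)" for u v y x x'
    using order0_current_multilinear(1)[OF T len len \<phi> i(2), of y u 1 u v x x'] by simp
  have b1: "T \<phi> (x # x' # gs) ((u + v) # y # gs) = T \<phi> (x # x' # gs) (u # y # gs) + T \<phi> (x # x' # gs) (v # y # gs)" for u v y x x'
    using order0_current_multilinear(2)[OF T len len \<phi> i(1), of x x' u y 1 u v] by simp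
  have b2: "T \<phi> (x # x' # gs) (y # (u + v) # gs) = T \<phi> (x # x' # gs) (y # u # gs) + T \<phi> (x # x' # gs) (y # v # gs)" for u v y x x'
    using order0_current_multilinear(2)[OF T len len \<phi> i(2), of x x' y u 1 u v] by simp
  show "T \<phi> (axis m 1 # axis k 1 # gs) (axis l 1 # axis q 1 # gs) = - T \<phi> (axis k 1 # axis m 1 # gs) (axis l 1 # axis q 1 # gs)"
    by (rule alternating_swap[where f = "\<lambda>x y. T \<phi> (x # y # gs) (axis l 1 # axis q 1 # gs)", OF a1 a2 alt(1)])
  show "T \<phi> (axis k 1 # axis m 1 # gs) (axis q 1 # axis l 1 # gs) = - T \<phi> (axis k 1 # axis m 1 # gs) (axis l 1 # axis q 1 # gs)"
    by (rule alternating_swap[where f = "\<lambda>x y. T \<phi> (axis k 1 # axis m 1 # gs) (x # y # gs)", OF b1 b2 alt(2)])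
qed

section \<open>Mass bounds for powers of the sequence times the current\<close>

text \<open>The entries of the rank one matrix of v are at most the square of the sum of the |v_k|,
  so b times the identity dominates it. The trace, for which the mass bounds are stated, thus
  controls the current on every constant form.\<close>

lemma trace_dominates:
  fixes A :: "'n::finite \<Rightarrow> 'n \<Rightarrow> complex" and v :: "'n \<Rightarrow> complex"
  assumes A: "\<And>v. 0 \<le> Re (\<Sum>k\<in>UNIV. \<Sum>l\<in>UNIV. v k * cnj (v l) * A k l)"
  defines "b \<equiv> real CARD('n) * ((\<Sum>k\<in>UNIV. cmod (v k)) * (\<Sum>k\<in>UNIV. cmod (v k)))"
  shows "Re (\<Sum>k\<in>UNIV. \<Sum>l\<in>UNIV. v k * cnj (v l) * A k l) \<le> b * Re (\<Sum>k\<in>UNIV. A k k)"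
proof -
  have "psd (\<lambda>k l. of_real b * delta k l - v k * cnj (v l))"
    unfolding b_def
  proof (rule psd_dominated)
    show "v l * cnj (v k) = cnj (v k * cnj (v l))" for k l by simp
    show "cmod (v k * cnj (v l)) \<le> (\<Sum>k\<in>UNIV. cmod (v k)) * (\<Sum>k\<in>UNIV. cmod (v k))" for k l
      unfolding norm_mult complex_mod_cnj by (intro mult_mono member_le_sum sum_nonneg) auto
  qed
  from psd_trace_nonneg[OF A this]
  have "0 \<le> Re ((\<Sum>k\<in>UNIV. \<Sum>l\<in>UNIV. of_real b * delta k l * A k l) - (\<Sum>k\<in>UNIV. \<Sum>l\<in>UNIV. v k * cnj (v l) * A k l))"
    by (simp add: left_diff_distrib sum_subtractf)
  then show "Re (\<Sum>k\<in>UNIV. \<Sum>l\<in>UNIV. v k * cnj (v l) * A k l) \<le> b * Re (\<Sum>k\<in>UNIV. A k k)"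
    unfolding sum_delta_form by simp
qed

lemma current_pos_functional:
  assumes T: "positive_current \<Omega> p T" and as: "length as = p"
  shows "pos_functional \<Omega> (\<lambda>\<phi>. Re (T \<phi> as as))"
  unfolding pos_functional_def
proof (intro conjI ballI allI impI)
  show "Re (T (\<lambda>z. complex_of_real c * \<phi> z + \<psi> z) as as) = c * Re (T \<phi> as as) + Re (T \<psi> as as)"
    if "\<phi> \<in> Cc \<Omega>" "\<psi> \<in> Cc \<Omega>" for \<phi> \<psi> c
    using order0_current_linear(1)[OF positive_currentD(1)[OF T] as as that] by simp
  show "0 \<le> Re (T \<phi> as as)" if "\<phi> \<in> Cc \<Omega>" "nonneg_fun \<phi>" for \<phi>
    by (rule positive_currentD(3)[OF T that as])
qed

lemma pos_functional_le:
  assumes \<Lambda>: "pos_functional \<Omega> \<Lambda>" and f: "f \<in> Cc \<Omega>" and h: "h \<in> Cc \<Omega>"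
    and le: "nonneg_fun (\<lambda>z. complex_of_real c * h z - f z)"
  shows "\<Lambda> f \<le> c * \<Lambda> h"
proof -
  have mf: "(\<lambda>z. - 1 * f z) \<in> Cc \<Omega>" by (rule Cc_scale[OF f])
  have "(\<lambda>z. complex_of_real c * h z + - 1 * f z) \<in> Cc \<Omega>" by (intro Cc_add Cc_scale h f)
  moreover have "(\<lambda>z. complex_of_real c * h z + - 1 * f z) = (\<lambda>z. complex_of_real c * h z - f z)" by simp
  ultimately have "0 \<le> \<Lambda> (\<lambda>z. complex_of_real c * h z - f z)"
    using \<Lambda> le by (simp add: pos_functional_def)
  also have "(\<lambda>z. complex_of_real c * h z - f z) = (\<lambda>z. complex_of_real (-1) * f z + complex_of_real c * h z)"
    by (simp add: fun_eq_iff)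
  also have "\<Lambda> \<dots> = (-1) * \<Lambda> f + \<Lambda> (\<lambda>z. complex_of_real c * h z)"
    by (rule pos_functional_linear[OF \<Lambda> f Cc_scale[OF h]])
  also have "\<Lambda> (\<lambda>z. complex_of_real c * h z) = c * \<Lambda> h"
  proof -
    have z: "(\<lambda>z. 0) \<in> Cc \<Omega>" by (rule Dtest_subset_Cc[OF Dtest_zero])
    have "\<Lambda> (\<lambda>z. 0) = 0" using pos_functional_linear[OF \<Lambda> z z, of 1] by simp
    then show ?thesis using pos_functional_linear[OF \<Lambda> h z, of c] by simp
  qed
  finally show ?thesis by simp
qed

lemma Cc_bounded:
  assumes "\<phi> \<in> Cc \<Omega>"
  obtains m where "0 \<le> m" "\<And>z. cmod (\<phi> z) \<le> m"
proof -
  have c: "continuous_on UNIV \<phi>" using assms by (simp add: Cc_def)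
  have "bounded (\<phi> ` supp \<phi>)"
    by (rule compact_imp_bounded[OF compact_continuous_image[OF continuous_on_subset[OF c subset_UNIV] Cc_supp(1)[OF assms]]])
  then obtain m where m: "0 < m" "\<And>x. x \<in> \<phi> ` supp \<phi> \<Longrightarrow> norm x \<le> m" unfolding bounded_pos by blast
  have "cmod (\<phi> z) \<le> m" for z
  proof (cases "z \<in> supp \<phi>")
    case True
    then show ?thesis using m(2) by blast
  next
    case False
    then have "\<phi> z = 0" by (rule notin_supp)
    then show ?thesis using m(1) by simp
  qed
  then show ?thesis using m(1) that[of m] by simp
qed

text \<open>Pointwise comparison of u \<phi> with the test function \<kappa> d whose mass is
  controlled. The relation between u and d is asked for only where \<phi> is nonzero, since only
  there the weight is known to dominate.\<close>

lemma nonneg_dominated: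
  assumes \<phi>: "nonneg_fun \<phi>" "\<And>z. cmod (\<phi> z) \<le> m" and m: "0 \<le> m" and E: "0 \<le> E"
    and \<kappa>: "\<And>z. 0 \<le> \<kappa> z" and d: "\<And>z. 0 \<le> d z"
    and u: "\<And>z. \<phi> z \<noteq> 0 \<Longrightarrow> \<kappa> z = 1 \<and> 0 \<le> u z \<and> u z \<le> E * d z"
  shows "nonneg_fun (\<lambda>z. complex_of_real (m * E) * (complex_of_real (\<kappa> z) * complex_of_real (d z)) - complex_of_real (u z) * \<phi> z)"
  unfolding nonneg_fun_def
proof
  fix z
  have \<phi>z: "Im (\<phi> z) = 0" "0 \<le> Re (\<phi> z)" using \<phi>(1) by (simp_all add: nonneg_fun_def)
  have "u z * Re (\<phi> z) \<le> m * E * (\<kappa> z * d z)"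
  proof (cases "\<phi> z = 0")
    case True
    have "0 \<le> m * E * (\<kappa> z * d z)" by (intro mult_nonneg_nonneg m E \<kappa> d)
    then show ?thesis using True by simp
  next
    case False
    have "Re (\<phi> z) \<le> m" using \<phi>(2)[of z] complex_Re_le_cmod[of "\<phi> z"] by linarith
    then have "u z * Re (\<phi> z) \<le> (E * d z) * m"
      using u[OF False] \<phi>z m E d[of z] by (intro mult_mono) auto
    then show ?thesis using u[OF False] by (simp add: mult_ac)
  qed
  then show "Im (complex_of_real (m * E) * (complex_of_real (\<kappa> z) * complex_of_real (d z)) - complex_of_real (u z) * \<phi> z) = 0 \<and>
     0 \<le> Re (complex_of_real (m * E) * (complex_of_real (\<kappa> z) * complex_of_real (d z)) - complex_of_real (u z) * \<phi> z)"
    using \<phi>z by simp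
qed

text \<open>For q < 1 the density with exponent q dominates the q-th power of the negative part. At
  q = 1 its factor 1 - q vanishes, and the square of the density with exponent 1/2 takes over; this
  requires a second pair of arguments, hence p \<ge> 2. In both cases \<open>trace_dominates\<close>
  passes from traces to the given arguments \<open>as\<close>.\<close>

lemma current_mass_bounded:
  fixes T :: "(complex^'n::finite \<Rightarrow> complex) \<Rightarrow> (complex^'n) list \<Rightarrow> (complex^'n) list \<Rightarrow> complex"
    and G :: "nat \<Rightarrow> complex^'n \<Rightarrow> real"
  assumes \<Omega>: "open \<Omega>" and L: "compact L" "L \<subseteq> \<Omega>"
    and G: "\<And>j. smooth_on \<Omega> (G j)" "\<And>j. psh \<Omega> (\<lambda>z. ereal (G j z))"
    and dec: "\<And>j z. z \<in> \<Omega> \<Longrightarrow> G j z \<le> G 0 z"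
    and bd: "\<And>K. compact K \<Longrightarrow> K \<subseteq> \<Omega> - L \<Longrightarrow>
      \<exists>D J. \<forall>j\<ge>J. \<forall>z\<in>K. \<bar>G j z\<bar> \<le> D \<and> (\<forall>v\<in>Basis. \<bar>dirderiv (G j) v z\<bar> \<le> D)"
    and T: "positive_current \<Omega> p T" "psh_current \<Omega> p T"
    and \<phi>: "\<phi> \<in> Cc \<Omega>" "nonneg_fun \<phi>" and as: "length as = p"
    and q: "0 < q" "(1 \<le> p \<and> q < 1) \<or> (2 \<le> p \<and> q = 1)"
  shows "\<exists>B J. \<forall>j\<ge>J. Re (T (\<lambda>z. complex_of_real (max (- G j z) 0 powr q) * \<phi> z) as as) \<le> B"
proof -
  obtain m where m: "0 \<le> m" "\<And>z. cmod (\<phi> z) \<le> m" by (rule Cc_bounded[OF \<phi>(1)]) (rule that; assumption)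
  have K: "compact (supp \<phi>)" "supp \<phi> \<subseteq> \<Omega>" by (rule Cc_supp[OF \<phi>(1)])+
  have T0: "order0_current \<Omega> p T" by (rule positive_currentD(1)[OF T(1)])
  have uC: "(\<lambda>z. complex_of_real (max (- G j z) 0 powr q) * \<phi> z) \<in> Cc \<Omega>" for j
    by (rule Cc_times[OF \<Omega> \<phi>(1) powr_max_continuous[OF continuous_on_minus[OF smooth_on_continuous[OF G(1)]] q(1)]])
  define q' where "q' = (if q < 1 then q else 1 / 2)"
  have q': "0 < q'" "0 \<le> q'" "q' \<le> 1" "q' < 1" using q by (auto simp: q'_def)
  obtain \<kappa> \<kappa>2 \<kappa>3 :: "complex^'n \<Rightarrow> real" and c0 R C J where
    \<kappa>: "smooth_on UNIV \<kappa>" "\<And>z. 0 \<le> \<kappa> z" "compact (supp \<kappa>)" "\<And>j. supp \<kappa> \<subseteq> weight_dom \<Omega> (G j) c0 R" "\<And>z. z \<in> supp \<phi> \<Longrightarrow> \<kappa> z = 1"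
    and c0: "0 \<le> c0"
    and bound1: "\<And>j M. j \<ge> J \<Longrightarrow> pos_form \<Omega> M \<Longrightarrow> psh_form \<Omega> M \<Longrightarrow>
       Re (\<Sum>k\<in>UNIV. M (\<lambda>z. complex_of_real (\<kappa> z) * complex_of_real (weight_dens q' (G j) c0 R z)) k k)
        \<le> C * Re (\<Sum>k\<in>UNIV. M (\<lambda>z. complex_of_real (\<kappa>2 z)) k k)"
    and bound2: "\<And>j N. j \<ge> J \<Longrightarrow> pos_form2 \<Omega> N \<Longrightarrow> psh_form2 \<Omega> N \<Longrightarrow> alternating2 \<Omega> N \<Longrightarrow>
       Re (\<Sum>m\<in>UNIV. \<Sum>k\<in>UNIV. N (\<lambda>z. complex_of_real (\<kappa> z) *
          (complex_of_real (weight_dens q' (G j) c0 R z) * complex_of_real (weight_dens q' (G j) c0 R z))) k m k m)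
        \<le> C * (C * Re (\<Sum>k\<in>UNIV. \<Sum>m\<in>UNIV. N (\<lambda>z. complex_of_real (\<kappa>3 z)) m k m k))"
    by (rule uniform_mass_bounds[OF \<Omega> L K G dec bd q'(2,3)], assumption, assumption, assumption)
       (rule that; assumption)
  define d where "d j = weight_dens q' (G j) c0 R" for j
  have d0: "0 \<le> d j z" for j z using q' by (simp add: d_def weight_dens_def)
  have dsm: "smooth_on (weight_dom \<Omega> (G j) c0 R) (\<lambda>z. complex_of_real (d j z))" for j
    unfolding d_def
    by (rule smooth_on_of_real[OF open_weight_dom[OF \<Omega> smooth_on_continuous[OF G(1)]] smooth_on_weight_dens(2)[OF \<Omega> G(1)]])
  have Wj: "open (weight_dom \<Omega> (G j) c0 R)" "weight_dom \<Omega> (G j) c0 R \<subseteq> \<Omega>" for j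
    using open_weight_dom[OF \<Omega> smooth_on_continuous[OF G(1)]] by (auto simp: weight_dom_def)
  have \<kappa>D: "(\<lambda>z. complex_of_real (\<kappa> z)) \<in> Dtest \<Omega>"
    by (rule Dtest_of_real[OF \<kappa>(1,3) subset_trans[OF \<kappa>(4) Wj(2)]])
  have \<kappa>s: "supp (\<lambda>z. complex_of_real (\<kappa> z)) \<subseteq> weight_dom \<Omega> (G j) c0 R" for j using \<kappa>(4)[of j] by simp
  have on: "\<kappa> z = 1 \<and> 0 < c0 - G j z \<and> max (- G j z) 0 \<le> c0 - G j z \<and> 0 < R - z \<bullet> z \<and> R - z \<bullet> z \<le> R" if "\<phi> z \<noteq> 0" for j z
  proof -
    have zs: "z \<in> supp \<phi>" using notin_supp[of z \<phi>] that by blast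
    have k1: "\<kappa> z = 1" by (rule \<kappa>(5)[OF zs])
    then have "z \<in> supp \<kappa>" using notin_supp[of z \<kappa>] by auto
    then have "z \<in> weight_dom \<Omega> (G j) c0 R" using \<kappa>(4) by blast
    then show ?thesis using k1 c0 by (auto simp: weight_dom_def)
  qed
  note \<Lambda> = current_pos_functional[OF T(1) as]
  show ?thesis
  proof (cases "q < 1")
    case True
    then have qq: "q' = q" "1 \<le> p" using q by (auto simp: q'_def)
    obtain a gs where ag: "as = a # gs" "length gs = p - 1" using as qq(2) by (cases as) auto
    define M where "M \<psi> k l = T \<psi> (axis k 1 # gs) (axis l 1 # gs)" for \<psi> k l
    have M: "pos_form \<Omega> M" "psh_form \<Omega> M"
      unfolding M_def[abs_def] by (rule current_pos_form[OF T(1) qq(2) ag(2)], rule current_psh_form[OF T(2) ag(2)])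
    define b where "b = real CARD('n) * ((\<Sum>k\<in>UNIV. cmod (a $ k)) * (\<Sum>k\<in>UNIV. cmod (a $ k)))"
    \<comment> \<open>Compensates the factor 1 - q of the density and its power r^(-q), which is at
      least R^(-q).\<close>
    define E where "E = R powr q / (1 - q)"
    have E0: "0 \<le> E" using True by (simp add: E_def)
    have "Re (T (\<lambda>z. complex_of_real (max (- G j z) 0 powr q) * \<phi> z) as as)
       \<le> m * E * (b * (C * Re (\<Sum>k\<in>UNIV. M (\<lambda>z. complex_of_real (\<kappa>2 z)) k k)))" if j: "j \<ge> J" for j
    proof -
      let ?f = "\<lambda>z. complex_of_real (\<kappa> z) * complex_of_real (d j z)"
      have fD: "?f \<in> Dtest \<Omega>" by (rule Dtest_mult[OF \<kappa>D Wj(1) \<kappa>s dsm])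
      have fn: "nonneg_fun ?f" using \<kappa>(2) d0 by (simp add: nonneg_fun_def)
      have "Re (T (\<lambda>z. complex_of_real (max (- G j z) 0 powr q) * \<phi> z) as as) \<le> m * E * Re (T ?f as as)"
      proof (rule pos_functional_le[OF \<Lambda> uC Dtest_subset_Cc[OF fD] nonneg_dominated[OF \<phi>(2) m(2,1) E0 \<kappa>(2) d0]])
        fix z assume "\<phi> z \<noteq> 0"
        note o = on[OF this, of j]
        have "max (- G j z) 0 powr q \<le> (c0 - G j z) powr q" using o q by (intro powr_mono2) auto
        also have "\<dots> = (c0 - G j z) powr q * (R powr (- q) * R powr q)"
        proof -
          have "0 < R" using o by linarith
          then show ?thesis by (simp add: powr_add[symmetric])
        qed
        also have "\<dots> \<le> (c0 - G j z) powr q * ((R - z \<bullet> z) powr (- q) * R powr q)"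
          using o q by (intro mult_left_mono mult_right_mono powr_mono2') auto
        also have "\<dots> = E * d j z" using True by (simp add: E_def d_def weight_dens_def qq)
        finally show "\<kappa> z = 1 \<and> 0 \<le> max (- G j z) 0 powr q \<and> max (- G j z) 0 powr q \<le> E * d j z"
          using o by simp
      qed
      also have "\<dots> \<le> m * E * (b * (C * Re (\<Sum>k\<in>UNIV. M (\<lambda>z. complex_of_real (\<kappa>2 z)) k k)))"
      proof (intro mult_left_mono mult_nonneg_nonneg m E0)
        have "Re (T ?f as as) = Re (\<Sum>k\<in>UNIV. \<Sum>l\<in>UNIV. a $ k * cnj (a $ l) * M ?f k l)"
          unfolding ag(1) M_def order0_current_expand0[OF T0 ag(2,2) Dtest_subset_Cc[OF fD] qq(2), of a a] ..
        also have "\<dots> \<le> b * Re (\<Sum>k\<in>UNIV. M ?f k k)"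
          unfolding b_def by (rule trace_dominates[OF pos_form_pos[OF M(1) fD fn]])
        also have "\<dots> \<le> b * (C * Re (\<Sum>k\<in>UNIV. M (\<lambda>z. complex_of_real (\<kappa>2 z)) k k))"
        proof (rule mult_left_mono)
          show "0 \<le> b" by (simp add: b_def sum_nonneg)
          show "Re (\<Sum>k\<in>UNIV. M ?f k k) \<le> C * Re (\<Sum>k\<in>UNIV. M (\<lambda>z. complex_of_real (\<kappa>2 z)) k k)"
            unfolding d_def by (rule bound1[OF j M])
        qed
        finally show "Re (T ?f as as) \<le> b * (C * Re (\<Sum>k\<in>UNIV. M (\<lambda>z. complex_of_real (\<kappa>2 z)) k k))" .
      qed
      finally show ?thesis .
    qed
    then show ?thesis by (intro exI allI impI)
  next
    case False
    then have qq: "q' = 1 / 2" "q = 1" "2 \<le> p" using q by (auto simp: q'_def)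
    obtain a as' where a: "as = a # as'" using as qq(3) by (cases as) auto
    obtain a' gs where a': "as' = a' # gs" using as qq(3) a by (cases as') auto
    have gs: "length gs = p - 2" using as a a' by simp
    have gs1: "length (a' # gs) = p - 1" "1 \<le> p" using gs qq(3) by simp_all
    define N where "N \<psi> k n l r = T \<psi> (axis k 1 # axis n 1 # gs) (axis l 1 # axis r 1 # gs)" for \<psi> k n l r
    have N: "pos_form2 \<Omega> N" "psh_form2 \<Omega> N" "alternating2 \<Omega> N"
      unfolding N_def[abs_def]
      by (rule current_pos_form2[OF T(1) qq(3) gs], rule current_psh_form2[OF T0 T(2) qq(3) gs],
          rule current_alternating2[OF T0 qq(3) gs])
    define b where "b = real CARD('n) * ((\<Sum>k\<in>UNIV. cmod (a $ k)) * (\<Sum>k\<in>UNIV. cmod (a $ k)))"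
    define b' where "b' = real CARD('n) * ((\<Sum>k\<in>UNIV. cmod (a' $ k)) * (\<Sum>k\<in>UNIV. cmod (a' $ k)))"
    \<comment> \<open>With exponent 1/2 the squared density is s / (4 r), and r \<le> R. The maximum
      keeps E \<ge> 0 even if \<phi> vanishes identically, when the sign of R is unknown.\<close>
    define E where "E = 4 * max R 0"
    have E0: "0 \<le> E" by (simp add: E_def)
    define X where "X = C * (C * Re (\<Sum>k\<in>UNIV. \<Sum>n\<in>UNIV. N (\<lambda>z. complex_of_real (\<kappa>3 z)) n k n k))"
    have "Re (T (\<lambda>z. complex_of_real (max (- G j z) 0 powr q) * \<phi> z) as as) \<le> m * E * (b * (b' * X))" if j: "j \<ge> J" for j
    proof -
      let ?f = "\<lambda>z. complex_of_real (\<kappa> z) * complex_of_real (d j z * d j z)"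
      have fD: "?f \<in> Dtest \<Omega>" unfolding of_real_mult
        by (rule Dtest_mult[OF \<kappa>D Wj(1) \<kappa>s smooth_on_mult[OF Wj(1) dsm dsm]])
      have fn: "nonneg_fun ?f" using \<kappa>(2) d0 by (simp add: nonneg_fun_def)
      have dd0: "0 \<le> d j z * d j z" for z by simp
      have "Re (T (\<lambda>z. complex_of_real (max (- G j z) 0 powr q) * \<phi> z) as as) \<le> m * E * Re (T ?f as as)"
      proof (rule pos_functional_le[OF \<Lambda> uC Dtest_subset_Cc[OF fD] nonneg_dominated[OF \<phi>(2) m(2,1) E0 \<kappa>(2) dd0]])
        fix z assume "\<phi> z \<noteq> 0"
        note o = on[OF this, of j]
        let ?s = "c0 - G j z" and ?r = "R - z \<bullet> z"
        have h: "?s powr (1/2) * ?s powr (1/2) = ?s"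
          using o by (simp add: powr_add[symmetric])
        have "?r powr (-1/2) * ?r powr (-1/2) = ?r powr (-1/2 + -1/2)" by (rule powr_add[symmetric])
        also have "\<dots> = inverse ?r" using o powr_minus[of ?r 1] by simp
        finally have h': "?r powr (-1/2) * ?r powr (-1/2) = inverse ?r" .
        have "d j z * d j z = (?s powr (1/2) * ?s powr (1/2)) * (?r powr (-1/2) * ?r powr (-1/2)) / 4"
          by (simp add: d_def weight_dens_def qq field_simps)
        then have dd: "d j z * d j z = ?s * inverse ?r / 4" unfolding h h' .
        have "max (- G j z) 0 powr q \<le> ?s" using o qq by simp
        also have "\<dots> = (4 * ?r) * (d j z * d j z)"
        proof -
          have "(4 * x) * (y * i / 4) = y * (x * i)" for x y i :: real by simp
          moreover have "?r * inverse ?r = 1" using o by simp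
          ultimately show ?thesis unfolding dd by (simp only: mult_1_right)
        qed
        also have "\<dots> \<le> E * (d j z * d j z)"
        proof (rule mult_right_mono[OF _ dd0])
          have "?r \<le> R" using o by blast
          then have "?r \<le> max R 0" by (rule max.coboundedI1)
          then show "4 * ?r \<le> E" unfolding E_def by (rule mult_left_mono) simp
        qed
        finally show "\<kappa> z = 1 \<and> 0 \<le> max (- G j z) 0 powr q \<and> max (- G j z) 0 powr q \<le> E * (d j z * d j z)"
          using o by simp
      qed
      also have "\<dots> \<le> m * E * (b * (b' * X))"
      proof (intro mult_left_mono mult_nonneg_nonneg m E0)
        have bb: "0 \<le> b" "0 \<le> b'" by (simp_all add: b_def b'_def sum_nonneg)
        have "Re (T ?f as as) = Re (\<Sum>k\<in>UNIV. \<Sum>l\<in>UNIV. a $ k * cnj (a $ l) *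
            (\<Sum>n\<in>UNIV. \<Sum>r\<in>UNIV. a' $ n * cnj (a' $ r) * N ?f k n l r))"
          unfolding a a' N_def order0_current_expand0[OF T0 gs1(1,1) Dtest_subset_Cc[OF fD] gs1(2), of a a]
          unfolding order0_current_expand1[OF T0 gs gs Dtest_subset_Cc[OF fD] qq(3), of _ a' _ a'] ..
        also have "\<dots> \<le> b * Re (\<Sum>k\<in>UNIV. \<Sum>n\<in>UNIV. \<Sum>r\<in>UNIV. a' $ n * cnj (a' $ r) * N ?f k n k r)"
          unfolding b_def by (rule trace_dominates[OF pos_form_pos[OF pos_form2_slice[OF N(1)] fD fn]])
        also have "\<dots> \<le> b * (b' * X)"
        proof (rule mult_left_mono[OF _ bb(1)])
          \<comment> \<open>The first pair is already reduced to a trace. For each of its indices k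
            the second pair is reduced likewise, positivity being tested with the unit vector e_k in
            the first pair.\<close>
          have "Re (\<Sum>n\<in>UNIV. \<Sum>r\<in>UNIV. a' $ n * cnj (a' $ r) * N ?f k n k r) \<le> b' * Re (\<Sum>n\<in>UNIV. N ?f k n k n)" for k
            unfolding b'_def
          proof (rule trace_dominates)
            fix w :: "'n \<Rightarrow> complex"
            have "0 \<le> Re (\<Sum>i\<in>UNIV. \<Sum>l\<in>UNIV. of_bool (i = k) * cnj (of_bool (l = k)) *
                (\<Sum>n\<in>UNIV. \<Sum>r\<in>UNIV. w n * cnj (w r) * N ?f i n l r))"
              by (rule pos_form_pos[OF pos_form2_slice[OF N(1)] fD fn, of "\<lambda>i. of_bool (i = k)" w])
            also have "(\<Sum>i\<in>UNIV. \<Sum>l\<in>UNIV. of_bool (i = k) * cnj (of_bool (l = k)) *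
                (\<Sum>n\<in>UNIV. \<Sum>r\<in>UNIV. w n * cnj (w r) * N ?f i n l r)) = (\<Sum>n\<in>UNIV. \<Sum>r\<in>UNIV. w n * cnj (w r) * N ?f k n k r)"
              by (rule sum_unit_form)
            finally show "0 \<le> Re (\<Sum>n\<in>UNIV. \<Sum>r\<in>UNIV. w n * cnj (w r) * N ?f k n k r)" .
          qed
          then have "(\<Sum>k\<in>UNIV. Re (\<Sum>n\<in>UNIV. \<Sum>r\<in>UNIV. a' $ n * cnj (a' $ r) * N ?f k n k r))
              \<le> (\<Sum>k\<in>UNIV. b' * Re (\<Sum>n\<in>UNIV. N ?f k n k n))" by (intro sum_mono)
          also have "\<dots> = b' * Re (\<Sum>k\<in>UNIV. \<Sum>n\<in>UNIV. N ?f k n k n)" by (simp only: Re_sum sum_distrib_left)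
          also have "(\<Sum>k\<in>UNIV. \<Sum>n\<in>UNIV. N ?f k n k n) = (\<Sum>n\<in>UNIV. \<Sum>k\<in>UNIV. N ?f k n k n)" by (rule sum.swap)
          also have "b' * Re (\<Sum>n\<in>UNIV. \<Sum>k\<in>UNIV. N ?f k n k n) \<le> b' * X"
            unfolding X_def d_def of_real_mult by (rule mult_left_mono[OF bound2[OF j N] bb(2)])
          finally show "Re (\<Sum>k\<in>UNIV. \<Sum>n\<in>UNIV. \<Sum>r\<in>UNIV. a' $ n * cnj (a' $ r) * N ?f k n k r) \<le> b' * X"
            by (simp only: Re_sum)
        qed
        finally show "Re (T ?f as as) \<le> b * (b' * X)" .
      qed
      finally show ?thesis .
    qed
    then show ?thesis by (intro exI allI impI)
  qed
qed

section \<open>Bounds off the unbounded locus and conclusion\<close>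

lemma uniform_limit_eventually_bounded:
  fixes F :: "nat \<Rightarrow> 'a::topological_space \<Rightarrow> real"
  assumes "compact K" "\<And>j. continuous_on K (F j)" "uniform_limit K F f sequentially"
  shows "\<exists>D J. \<forall>j\<ge>J. \<forall>z\<in>K. \<bar>F j z\<bar> \<le> D"
proof -
  obtain J where J: "\<And>j z. j \<ge> J \<Longrightarrow> z \<in> K \<Longrightarrow> dist (F j z) (f z) < 1"
    using uniform_limitD[OF assms(3) zero_less_one] unfolding eventually_sequentially by blast
  have "bounded (F J ` K)" by (rule compact_imp_bounded[OF compact_continuous_image[OF assms(2,1)]])
  then obtain b where b: "\<And>z. z \<in> K \<Longrightarrow> \<bar>F J z\<bar> \<le> b" unfolding bounded_real by blast
  have "\<bar>F j z\<bar> \<le> b + 2" if "j \<ge> J" "z \<in> K" for j z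
    using J[OF that] J[OF order_refl that(2)] b[OF that(2)] unfolding dist_real_def by linarith
  then show ?thesis by blast
qed

text \<open>Uniform convergence on \<open>K\<close> bounds the functions and each derivative from
  some index on. As \<open>Basis\<close> is finite, sums over it provide a common bound and a common
  index.\<close>

lemma admissible_C1_bounded:
  fixes G :: "nat \<Rightarrow> complex^'n::finite \<Rightarrow> real"
  assumes G: "admissible_seq \<Omega> g G" and K: "compact K" "K \<subseteq> \<Omega> - unbounded_locus \<Omega> g"
  shows "\<exists>D J. \<forall>j\<ge>J. \<forall>z\<in>K. \<bar>G j z\<bar> \<le> D \<and> (\<forall>v\<in>Basis. \<bar>dirderiv (G j) v z\<bar> \<le> D)"
proof -
  have lim: "uniform_limit K G (\<lambda>z. real_of_ereal (g z)) sequentially"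
    "\<And>v. v \<in> Basis \<Longrightarrow> uniform_limit K (\<lambda>j. dirderiv (G j) v) (dirderiv (\<lambda>z. real_of_ereal (g z)) v) sequentially"
    using G K unfolding admissible_seq_def by simp_all
  have sub: "K \<subseteq> \<Omega>" using K(2) by blast
  obtain D0 J0 where 0: "\<And>j z. j \<ge> J0 \<Longrightarrow> z \<in> K \<Longrightarrow> \<bar>G j z\<bar> \<le> D0"
    using uniform_limit_eventually_bounded[OF K(1) continuous_on_subset[OF smooth_on_continuous[OF admissible_smooth[OF G]] sub] lim(1)]
    by blast
  have "\<forall>v\<in>Basis. \<exists>DJ. \<forall>j\<ge>snd DJ. \<forall>z\<in>K. \<bar>dirderiv (G j) v z\<bar> \<le> fst DJ"
  proof
    fix v :: "complex^'n" assume v: "v \<in> Basis"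
    obtain D J where "\<forall>j\<ge>J. \<forall>z\<in>K. \<bar>dirderiv (G j) v z\<bar> \<le> D"
      using uniform_limit_eventually_bounded[OF K(1) continuous_on_subset[OF smooth_on_continuous[OF smooth_on_dirderiv[OF admissible_smooth[OF G] v]] sub] lim(2)[OF v]]
      by blast
    then show "\<exists>DJ. \<forall>j\<ge>snd DJ. \<forall>z\<in>K. \<bar>dirderiv (G j) v z\<bar> \<le> fst DJ"
      by (intro exI[of _ "(D, J)"]) simp
  qed
  from bchoice[OF this] obtain f where f: "\<And>v j z. v \<in> Basis \<Longrightarrow> j \<ge> snd (f v) \<Longrightarrow> z \<in> K \<Longrightarrow> \<bar>dirderiv (G j) v z\<bar> \<le> fst (f v)"
    by blast
  define D where "D = \<bar>D0\<bar> + (\<Sum>v\<in>Basis. \<bar>fst (f v)\<bar>)"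
  define J where "J = J0 + (\<Sum>v\<in>(Basis :: (complex^'n) set). snd (f v))"
  have "\<bar>G j z\<bar> \<le> D \<and> (\<forall>v\<in>Basis. \<bar>dirderiv (G j) v z\<bar> \<le> D)" if "j \<ge> J" "z \<in> K" for j z
  proof (intro conjI ballI)
    have "j \<ge> J0" using that(1) by (simp add: J_def)
    then have "\<bar>G j z\<bar> \<le> D0" using 0 that(2) by blast
    moreover have "0 \<le> (\<Sum>v\<in>Basis. \<bar>fst (f v)\<bar>)" by (simp add: sum_nonneg)
    ultimately show "\<bar>G j z\<bar> \<le> D" unfolding D_def by linarith
    fix v :: "complex^'n" assume v: "v \<in> Basis"
    have "snd (f v) \<le> (\<Sum>v\<in>Basis. snd (f v))" using v by (intro member_le_sum) auto
    then have "\<bar>dirderiv (G j) v z\<bar> \<le> fst (f v)" using f[OF v _ that(2)] that(1) by (simp add: J_def)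
    moreover have "\<bar>fst (f v)\<bar> \<le> (\<Sum>v\<in>Basis. \<bar>fst (f v)\<bar>)" using v by (intro member_le_sum) auto
    ultimately show "\<bar>dirderiv (G j) v z\<bar> \<le> D" unfolding D_def by linarith
  qed
  then show ?thesis by blast
qed

theorem theorem2p3:
  fixes \<Omega> :: "(complex^'n::finite) set"
    and p :: nat
    and T :: "(complex^'n \<Rightarrow> complex) \<Rightarrow> (complex^'n) list \<Rightarrow> (complex^'n) list \<Rightarrow> complex"
    and g :: "complex^'n \<Rightarrow> ereal"
  assumes "open \<Omega>"
    and "1 \<le> p" and "p \<le> CARD('n)"
    and "positive_current \<Omega> p T" and "psh_current \<Omega> p T"
    and "g \<in> psh_neg \<Omega>"
    and "\<forall>z\<in>\<Omega> - unbounded_locus \<Omega> g. g z \<noteq> -\<infinity>"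
    and "Ck 1 (\<Omega> - unbounded_locus \<Omega> g) (\<lambda>z. real_of_ereal (g z))"
    and "compact (unbounded_locus \<Omega> g)"
  shows "(\<forall>\<epsilon>::real. 0 < \<epsilon> \<and> \<epsilon> < 1 \<longrightarrow>
           (\<exists>S. \<forall>G. admissible_seq \<Omega> g G \<longrightarrow>
              weak_star_tendsto \<Omega> p (\<lambda>j. mult_current (\<lambda>z. \<bar>G j z\<bar> powr (1 - \<epsilon>)) T) S))
         \<and> (unbounded_locus \<Omega> g = pole_set \<Omega> g \<and> 2 \<le> p \<longrightarrow>
           (\<exists>S. \<forall>G. admissible_seq \<Omega> g G \<longrightarrow>
              weak_star_tendsto \<Omega> p (\<lambda>j. mult_current (G j) T) S))"
proof -
  note \<Omega> = assms(1) and T = assms(4,5)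
  have T0: "order0_current \<Omega> p T" by (rule positive_currentD(1)[OF T(1)])
  have L: "unbounded_locus \<Omega> g \<subseteq> \<Omega>" by (auto simp: unbounded_locus_def)
  \<comment> \<open>The q-th power of |G_j| is the sum of these two functions, and for q = 1 their
    difference is G_j. Each is monotone in j, which the power of |G_j| need not be where G_j changes
    sign.\<close>
  let ?P = "\<lambda>q (G :: nat \<Rightarrow> complex^'n \<Rightarrow> real) j z. max (G j z) 0 powr q"
  let ?N = "\<lambda>q (G :: nat \<Rightarrow> complex^'n \<Rightarrow> real) j z. max (- G j z) 0 powr q"
  have PC: "continuous_on \<Omega> (?P q G j)" and NC: "continuous_on \<Omega> (?N q G j)"
    if "admissible_seq \<Omega> g G" "0 < q" for q G j
    by (rule powr_max_continuous[OF admissible_continuous[OF that(1)] that(2)],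
        rule powr_max_continuous[OF continuous_on_minus[OF admissible_continuous[OF that(1)]] that(2)])
  \<comment> \<open>On equal arguments a positive current takes real values, so convergence of the
    real parts is all that has to be shown.\<close>
  have real: "T (\<lambda>z. complex_of_real (u z) * \<phi> z) as as = complex_of_real (Re (T (\<lambda>z. complex_of_real (u z) * \<phi> z) as as))"
    if \<phi>: "\<phi> \<in> Cc \<Omega>" "nonneg_fun \<phi>" and as: "length as = p" and u: "continuous_on \<Omega> u" "\<And>z. 0 \<le> u z" for u \<phi> as
  proof -
    have "nonneg_fun (\<lambda>z. complex_of_real (u z) * \<phi> z)" using \<phi>(2) u(2) by (simp add: nonneg_fun_def)
    from positive_currentD(2)[OF T(1) Cc_times[OF \<Omega> \<phi>(1) u(1)] this as] show ?thesis by (simp add: complex_eq_iff)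
  qed
  have positive_part: "\<exists>l. \<forall>G. admissible_seq \<Omega> g G \<longrightarrow>
      (\<lambda>j. T (\<lambda>z. complex_of_real (?P q G j z) * \<phi> z) as as) \<longlonglongrightarrow> l"
    if q: "0 < q" "(1 \<le> p \<and> q < 1) \<or> (2 \<le> p \<and> q = 1)" and \<phi>: "\<phi> \<in> Cc \<Omega>" "nonneg_fun \<phi>" and as: "length as = p"
    for q \<phi> as
  proof -
    have q1: "q \<le> 1" using q by auto
    obtain l where l: "\<forall>G. admissible_seq \<Omega> g G \<longrightarrow> (\<lambda>j. Re (T (\<lambda>z. complex_of_real (?P q G j z) * \<phi> z) as as)) \<longlonglongrightarrow> l"
      by (rule exE[OF admissible_positive_part_limit[OF \<Omega> current_pos_functional[OF T(1) as] \<phi> q(1) q1]]) (erule that)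
    have "(\<lambda>j. T (\<lambda>z. complex_of_real (?P q G j z) * \<phi> z) as as) \<longlonglongrightarrow> complex_of_real l" if G: "admissible_seq \<Omega> g G" for G
      by (subst real[OF \<phi> as PC[OF G q(1)] powr_ge_zero]) (rule tendsto_of_real[OF l[THEN spec, THEN mp, OF G]])
    then show ?thesis by (intro exI[of _ "complex_of_real l"] allI impI)
  qed
  have negative_part: "\<exists>l. \<forall>G. admissible_seq \<Omega> g G \<longrightarrow>
      (\<lambda>j. T (\<lambda>z. complex_of_real (?N q G j z) * \<phi> z) as as) \<longlonglongrightarrow> l"
    if q: "0 < q" "(1 \<le> p \<and> q < 1) \<or> (2 \<le> p \<and> q = 1)" and \<phi>: "\<phi> \<in> Cc \<Omega>" "nonneg_fun \<phi>" and as: "length as = p"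
    for q \<phi> as
  proof -
    have q1: "q \<le> 1" using q by auto
    have "\<exists>l. \<forall>G. admissible_seq \<Omega> g G \<longrightarrow> (\<lambda>j. Re (T (\<lambda>z. complex_of_real (?N q G j z) * \<phi> z) as as)) \<longlonglongrightarrow> l"
    proof (rule admissible_negative_part_limit[OF \<Omega> current_pos_functional[OF T(1) as] \<phi> q(1) q1])
      fix G assume G: "admissible_seq \<Omega> g G"
      show "\<exists>B J. \<forall>j\<ge>J. Re (T (\<lambda>z. complex_of_real (?N q G j z) * \<phi> z) as as) \<le> B"
        by (rule current_mass_bounded[OF \<Omega> assms(9) L admissible_smooth[OF G] admissible_psh[OF G]
            admissible_decreasing[OF G _ le0] admissible_C1_bounded[OF G] T \<phi> as q])
    qed
    then obtain l where l: "\<forall>G. admissible_seq \<Omega> g G \<longrightarrow> (\<lambda>j. Re (T (\<lambda>z. complex_of_real (?N q G j z) * \<phi> z) as as)) \<longlonglongrightarrow> l"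
      by (rule exE) (erule that)
    have "(\<lambda>j. T (\<lambda>z. complex_of_real (?N q G j z) * \<phi> z) as as) \<longlonglongrightarrow> complex_of_real l" if G: "admissible_seq \<Omega> g G" for G
      by (subst real[OF \<phi> as NC[OF G q(1)] powr_ge_zero]) (rule tendsto_of_real[OF l[THEN spec, THEN mp, OF G]])
    then show ?thesis by (intro exI[of _ "complex_of_real l"] allI impI)
  qed
  \<comment> \<open>The constant c will be 1 for the power of |G_j|, and -1 with q = 1 for G_j
    itself.\<close>
  have glue: "\<exists>S. \<forall>G. admissible_seq \<Omega> g G \<longrightarrow> weak_star_tendsto \<Omega> p (\<lambda>j. mult_current (u G j) T) S"
    if q: "0 < q" "(1 \<le> p \<and> q < 1) \<or> (2 \<le> p \<and> q = 1)"
      and u: "\<And>G j z. u G j z = ?P q G j z + c * ?N q G j z"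
    for q c and u :: "(nat \<Rightarrow> complex^'n \<Rightarrow> real) \<Rightarrow> nat \<Rightarrow> complex^'n \<Rightarrow> real"
  proof -
    have uC: "continuous_on \<Omega> (u G j)" if "admissible_seq \<Omega> g G" for G j
      unfolding u[abs_def] by (intro continuous_intros PC[OF that q(1)] NC[OF that q(1)])
    have diag: "\<exists>l. \<forall>G. admissible_seq \<Omega> g G \<longrightarrow> (\<lambda>j. T (\<lambda>z. complex_of_real (u G j z) * \<phi> z) as as) \<longlonglongrightarrow> l"
      if \<phi>: "\<phi> \<in> Cc \<Omega>" "nonneg_fun \<phi>" and as: "length as = p" for \<phi> as
    proof -
      obtain l where l: "\<forall>G. admissible_seq \<Omega> g G \<longrightarrow>
          (\<lambda>j. T (\<lambda>z. complex_of_real (?P q G j z) * \<phi> z) as as) \<longlonglongrightarrow> l"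
        by (rule exE[OF positive_part[OF q \<phi> as]]) (erule that)
      obtain l' where l': "\<forall>G. admissible_seq \<Omega> g G \<longrightarrow>
          (\<lambda>j. T (\<lambda>z. complex_of_real (?N q G j z) * \<phi> z) as as) \<longlonglongrightarrow> l'"
        by (rule exE[OF negative_part[OF q \<phi> as]]) (erule that)
      have "(\<lambda>j. T (\<lambda>z. complex_of_real (u G j z) * \<phi> z) as as) \<longlonglongrightarrow> of_real c * l' + l" if G: "admissible_seq \<Omega> g G" for G
      proof -
        have "T (\<lambda>z. complex_of_real (u G j z) * \<phi> z) as as
           = of_real c * T (\<lambda>z. complex_of_real (?N q G j z) * \<phi> z) as as + T (\<lambda>z. complex_of_real (?P q G j z) * \<phi> z) as as" for j
        proof -
          have "(\<lambda>z. complex_of_real (u G j z) * \<phi> z)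
             = (\<lambda>z. of_real c * (complex_of_real (?N q G j z) * \<phi> z) + complex_of_real (?P q G j z) * \<phi> z)"
            by (rule ext) (simp add: u algebra_simps)
          then show ?thesis
            using order0_current_linear(1)[OF T0 as as Cc_times[OF \<Omega> \<phi>(1) NC[OF G q(1)]] Cc_times[OF \<Omega> \<phi>(1) PC[OF G q(1)]]]
            by simp
        qed
        then show ?thesis by (simp only:) (intro tendsto_intros l[THEN spec, THEN mp, OF G] l'[THEN spec, THEN mp, OF G])
      qed
      then show ?thesis by blast
    qed
    \<comment> \<open>One limit l serves all admissible sequences, so the chosen value does not
      depend on \<open>G\<close>, and a single \<open>S\<close> works for all of them.\<close>
    define S where "S \<phi> as bs = (SOME l. \<forall>G. admissible_seq \<Omega> g G \<longrightarrow> (\<lambda>j. T (\<lambda>z. complex_of_real (u G j z) * \<phi> z) as bs) \<longlonglongrightarrow> l)" for \<phi> as bs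
    have "weak_star_tendsto \<Omega> p (\<lambda>j. mult_current (u G j) T) S" if G: "admissible_seq \<Omega> g G" for G
      unfolding weak_star_tendsto_def mult_current_def
    proof (intro ballI allI impI)
      fix \<phi> and as bs :: "(complex^'n) list" assume \<phi>: "\<phi> \<in> Dtest \<Omega>" and len: "length as = p \<and> length bs = p"
      have "\<exists>l. \<forall>G. admissible_seq \<Omega> g G \<longrightarrow> (\<lambda>j. T (\<lambda>z. complex_of_real (u G j z) * \<phi> z) as bs) \<longlonglongrightarrow> l"
        by (rule current_limit_polarize[where A = "admissible_seq \<Omega> g", OF T0 \<Omega> uC diag Dtest_subset_Cc[OF \<phi>] conjunct1[OF len] conjunct2[OF len]])
      from someI_ex[OF this] show "(\<lambda>j. T (\<lambda>z. complex_of_real (u G j z) * \<phi> z) as bs) \<longlonglongrightarrow> S \<phi> as bs"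
        unfolding S_def using G by blast
    qed
    then show ?thesis by blast
  qed
  show ?thesis
  proof (intro conjI allI impI)
    fix \<epsilon> :: real assume \<epsilon>: "0 < \<epsilon> \<and> \<epsilon> < 1"
    show "\<exists>S. \<forall>G. admissible_seq \<Omega> g G \<longrightarrow>
              weak_star_tendsto \<Omega> p (\<lambda>j. mult_current (\<lambda>z. \<bar>G j z\<bar> powr (1 - \<epsilon>)) T) S"
      by (rule glue[of "1 - \<epsilon>" "\<lambda>G j z. \<bar>G j z\<bar> powr (1 - \<epsilon>)" 1]) (use \<epsilon> assms(2) in \<open>auto simp: max_def\<close>)
  next
    assume "unbounded_locus \<Omega> g = pole_set \<Omega> g \<and> 2 \<le> p"
    then show "\<exists>S. \<forall>G. admissible_seq \<Omega> g G \<longrightarrow> weak_star_tendsto \<Omega> p (\<lambda>j. mult_current (G j) T) S"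
      by (intro glue[of 1 "\<lambda>G. G" "-1"]) (auto simp: max_def)
  qed
qed

end
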